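(* Let $(G,K,L,\theta,\phi)$ be a character five such that $|G:K|$ and $|K:L|$ are coprime and $|G:L|$ is odd, and let $H/L$ be a complement of $K/L$ in $G/L$. Let $\psi$ be the unique magic character of $H/L$ with determinant $1$, and consider the bijection between $\operatorname{Irr}(G\mid\theta)$ and $\operatorname{Irr}(H\mid\phi)$ in which $\chi$ and $\xi$ correspond if and only if $\chi_H=\psi\xi$. Then $\chi\in\operatorname{Irr}(G\mid\theta)$ and $\xi\in\operatorname{Irr}(H\mid\phi)$ correspond if and only if the multiplicity $(\chi_H,\xi)$ is odd.
   Context: All groups are finite and characters are complex. $a^x=x^{-1}ax$; $e_\phi=\frac{\phi(1)}{|L|}\sum_{l\in L}\phi(l^{-1})l$. A character five is a quintuple $(G,K,L,\theta,\phi)$ where $G$ is a finite group, $L\leq K$ are normal subgroups of $G$, $\phi\in\operatorname{Irr}(L)$ is invariant in $G$ and fully ramified in $K$ (i.e. there is exactly one irreducible character of $K$ lying above $\phi$), and $\theta$ is this unique character of $K$ above $\phi$. $S=(\mathbb{C}Ke_\phi)^L$ is the centralizer of $L$ in $\mathbb{C}Ke_\phi$; it is isomorphic to $\operatorname{Mat}_n(\mathbb{C})$ with $n^2=|K/L|$, and $G/L$ acts on it by conjugation. A magic representation on a complement $H/L$ of $K/L$ in $G/L$ is a homomorphism $\sigma\colon H/L\to S^*$ with $s^x=s^{\sigma(x)}:=\sigma(x)^{-1}s\sigma(x)$ for all $x\in H/L$, $s\in S$. A magic character is the character $\psi(x)=\operatorname{tr}(\sigma(x))$ of a magic representation $\sigma$,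 with trace taken in $S\cong\operatorname{Mat}_n(\mathbb{C})$; it is also viewed as a character of $H$. It has determinant $1$ if $\det\sigma(x)=1$ for all $x$. When $|G:K|$ and $|K:L|$ are coprime, there is a unique magic character $\psi$ of $H/L$ of determinant $1$, it vanishes nowhere, and $\chi_H=\psi\xi$ defines a bijection between $\operatorname{Irr}(G\mid\theta)$ and $\operatorname{Irr}(H\mid\phi)$ (irreducible characters of $G$ above $\theta$, respectively of $H$ above $\phi$). *)

theory Defs
  imports "HOL-Algebra.QuotRing" "Jordan_Normal_Form.VS_Connect"
begin

section \<open>Complex characters of finite groups\<close>

definition trace_mat :: "complex mat \<Rightarrow> complex" where
  "trace_mat A = (\<Sum>i<dim_row A. A $$ (i, i))"

definition representation ::
    "('a, 'b) monoid_scheme \<Rightarrow> nat \<Rightarrow> ('a \<Rightarrow> complex mat) \<Rightarrow> bool" where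
  "representation G n \<rho> \<longleftrightarrow> \<rho> \<in> hom G (units_of (ring_mat TYPE(complex) n ()))"

definition irreducible_representation ::
    "('a, 'b) monoid_scheme \<Rightarrow> nat \<Rightarrow> ('a \<Rightarrow> complex mat) \<Rightarrow> bool" where
  "irreducible_representation G n \<rho> \<longleftrightarrow>
     representation G n \<rho> \<and> 0 < n \<and>
     (\<forall>W. VectorSpace.subspace class_ring W (module_vec TYPE(complex) n) \<longrightarrow>
          (\<forall>g\<in>carrier G. \<forall>w\<in>W. \<rho> g *\<^sub>v w \<in> W) \<longrightarrow>
          W = {0\<^sub>v n} \<or> W = carrier_vec n)"

text \<open>Class functions on a group (or on a subgroup, given as a group by restricting the
  carrier) are extensional functions on the carrier, so that equality of characters is
  equality of functions.\<close>

definition Irr :: "('a, 'b) monoid_scheme \<Rightarrow> ('a \<Rightarrow> complex) set" where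
  "Irr G = {restrict (\<lambda>g. trace_mat (\<rho> g)) (carrier G) | n \<rho>. irreducible_representation G n \<rho>}"

definition char_inner ::
    "('a, 'b) monoid_scheme \<Rightarrow> ('a \<Rightarrow> complex) \<Rightarrow> ('a \<Rightarrow> complex) \<Rightarrow> complex" where
  "char_inner G \<alpha> \<beta> = (\<Sum>g\<in>carrier G. \<alpha> g * cnj (\<beta> g)) / of_nat (Coset.order G)"

definition Irr_above ::
    "('a, 'b) monoid_scheme \<Rightarrow> 'a set \<Rightarrow> ('a \<Rightarrow> complex) \<Rightarrow> ('a \<Rightarrow> complex) set" where
  "Irr_above G N \<phi> = {\<chi> \<in> Irr G. char_inner (G\<lparr>carrier := N\<rparr>) (restrict \<chi> N) \<phi> \<noteq> 0}"


section \<open>Character fives\<close>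

definition invariant_character :: "('a, 'b) monoid_scheme \<Rightarrow> 'a set \<Rightarrow> ('a \<Rightarrow> complex) \<Rightarrow> bool" where
  "invariant_character G L \<phi> \<longleftrightarrow>
     (\<forall>g\<in>carrier G. \<forall>l\<in>L. \<phi> (inv\<^bsub>G\<^esub> g \<otimes>\<^bsub>G\<^esub> l \<otimes>\<^bsub>G\<^esub> g) = \<phi> l)"

definition fully_ramified ::
    "('a, 'b) monoid_scheme \<Rightarrow> 'a set \<Rightarrow> 'a set \<Rightarrow> ('a \<Rightarrow> complex) \<Rightarrow> bool" where
  "fully_ramified G K L \<phi> \<longleftrightarrow> (\<exists>!\<eta>. \<eta> \<in> Irr_above (G\<lparr>carrier := K\<rparr>) L \<phi>)"

definition character_five ::
    "('a, 'b) monoid_scheme \<Rightarrow> 'a set \<Rightarrow> 'a set \<Rightarrow> ('a \<Rightarrow> complex) \<Rightarrow> ('a \<Rightarrow> complex) \<Rightarrow> bool" where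
  "character_five G K L \<theta> \<phi> \<longleftrightarrow>
     group G \<and> finite (carrier G) \<and> K \<lhd> G \<and> L \<lhd> G \<and> L \<subseteq> K \<and>
     \<phi> \<in> Irr (G\<lparr>carrier := L\<rparr>) \<and> invariant_character G L \<phi> \<and>
     fully_ramified G K L \<phi> \<and> \<theta> \<in> Irr_above (G\<lparr>carrier := K\<rparr>) L \<phi>"

definition is_complement :: "('a, 'b) monoid_scheme \<Rightarrow> 'a set \<Rightarrow> 'a set \<Rightarrow> bool" where
  "is_complement G N U \<longleftrightarrow> subgroup U G \<and> U \<inter> N = {\<one>\<^bsub>G\<^esub>} \<and> U <#>\<^bsub>G\<^esub> N = carrier G"


section \<open>The algebra S\<close>

text \<open>An element of the group algebra is the function giving its coefficients, zero outside
  the carrier; multiplication is convolution.\<close>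

definition group_algebra :: "('a, 'b) monoid_scheme \<Rightarrow> ('a \<Rightarrow> complex) ring" where
  "group_algebra G =
     \<lparr> carrier = {f. \<forall>x. x \<notin> carrier G \<longrightarrow> f x = 0},
       mult = (\<lambda>f g x. if x \<in> carrier G
                then \<Sum>y\<in>carrier G. f y * g (inv\<^bsub>G\<^esub> y \<otimes>\<^bsub>G\<^esub> x) else 0),
       one = (\<lambda>x. of_bool (x = \<one>\<^bsub>G\<^esub>)),
       zero = (\<lambda>x. 0),
       add = (\<lambda>f g x. f x + g x) \<rparr>"

definition group_elem :: "'a \<Rightarrow> 'a \<Rightarrow> complex" where
  "group_elem g = (\<lambda>x. of_bool (x = g))"

definition central_idem ::
    "('a, 'b) monoid_scheme \<Rightarrow> 'a set \<Rightarrow> ('a \<Rightarrow> complex) \<Rightarrow> 'a \<Rightarrow> complex" where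
  "central_idem G L \<phi> =
     (\<lambda>l. if l \<in> L then \<phi> \<one>\<^bsub>G\<^esub> / of_nat (card L) * \<phi> (inv\<^bsub>G\<^esub> l) else 0)"

text \<open>The algebra $S = (\mathbb{C}Ke_\phi)^L$, whose identity is $e_\phi$. All products are taken in
  the group algebra of the whole group, which acts on $S$ by conjugation.\<close>

definition S_alg ::
    "('a, 'b) monoid_scheme \<Rightarrow> 'a set \<Rightarrow> 'a set \<Rightarrow> ('a \<Rightarrow> complex) \<Rightarrow> ('a \<Rightarrow> complex) ring" where
  "S_alg G K L \<phi> = (group_algebra G)
     \<lparr> carrier :=
         {s. (\<exists>a\<in>carrier (group_algebra (G\<lparr>carrier := K\<rparr>)).
                s = a \<otimes>\<^bsub>group_algebra G\<^esub> central_idem G L \<phi>) \<and>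
             (\<forall>l\<in>L. group_elem l \<otimes>\<^bsub>group_algebra G\<^esub> s = s \<otimes>\<^bsub>group_algebra G\<^esub> group_elem l)},
       one := central_idem G L \<phi> \<rparr>"

definition conj_elem ::
    "('a, 'b) monoid_scheme \<Rightarrow> ('a \<Rightarrow> complex) \<Rightarrow> 'a \<Rightarrow> 'a \<Rightarrow> complex" where
  "conj_elem G s x =
     group_elem (inv\<^bsub>G\<^esub> x) \<otimes>\<^bsub>group_algebra G\<^esub> s \<otimes>\<^bsub>group_algebra G\<^esub> group_elem x"

text \<open>The identifications of $S$ with $\mathrm{Mat}_n(\mathbb{C})$, as complex algebras. Any two
  differ by an inner automorphism, so traces and determinants do not depend on the choice.\<close>

definition S_matrix_isos ::
    "('a, 'b) monoid_scheme \<Rightarrow> 'a set \<Rightarrow> 'a set \<Rightarrow> ('a \<Rightarrow> complex) \<Rightarrow>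
     (('a \<Rightarrow> complex) \<Rightarrow> complex mat) set" where
  "S_matrix_isos G K L \<phi> =
     {\<tau>. \<exists>n. n\<^sup>2 = Coset.order (G\<lparr>carrier := K\<rparr> Mod L) \<and>
          \<tau> \<in> ring_iso (S_alg G K L \<phi>) (ring_mat TYPE(complex) n ()) \<and>
          (\<forall>c. \<forall>s\<in>carrier (S_alg G K L \<phi>). \<tau> (\<lambda>x. c * s x) = c \<cdot>\<^sub>m \<tau> s)}"


section \<open>Magic representations and characters\<close>

text \<open>Elements of $H/L$ are cosets. Since $L$ centralizes $S$, a coset acts on $S$ through any
  of its representatives.\<close>

definition magic_representation ::
    "('a, 'b) monoid_scheme \<Rightarrow> 'a set \<Rightarrow> 'a set \<Rightarrow> ('a \<Rightarrow> complex) \<Rightarrow> 'a set \<Rightarrow>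
     ('a set \<Rightarrow> 'a \<Rightarrow> complex) \<Rightarrow> bool" where
  "magic_representation G K L \<phi> H \<sigma> \<longleftrightarrow>
     \<sigma> \<in> hom (G\<lparr>carrier := H\<rparr> Mod L) (units_of (S_alg G K L \<phi>)) \<and>
     (\<forall>C\<in>carrier (G\<lparr>carrier := H\<rparr> Mod L). \<forall>x\<in>C. \<forall>s\<in>carrier (S_alg G K L \<phi>).
        conj_elem G s x =
          inv\<^bsub>S_alg G K L \<phi>\<^esub> (\<sigma> C) \<otimes>\<^bsub>S_alg G K L \<phi>\<^esub> s \<otimes>\<^bsub>S_alg G K L \<phi>\<^esub> \<sigma> C)"

definition magic_character_det_one ::
    "('a, 'b) monoid_scheme \<Rightarrow> 'a set \<Rightarrow> 'a set \<Rightarrow> ('a \<Rightarrow> complex) \<Rightarrow> 'a set \<Rightarrow>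
     ('a set \<Rightarrow> complex) \<Rightarrow> bool" where
  "magic_character_det_one G K L \<phi> H \<psi> \<longleftrightarrow>
     (\<exists>\<sigma>. \<exists>\<tau>\<in>S_matrix_isos G K L \<phi>.
        magic_representation G K L \<phi> H \<sigma> \<and>
        \<psi> = restrict (\<lambda>C. trace_mat (\<tau> (\<sigma> C))) (carrier (G\<lparr>carrier := H\<rparr> Mod L)) \<and>
        (\<forall>C\<in>carrier (G\<lparr>carrier := H\<rparr> Mod L). Determinant.det (\<tau> (\<sigma> C)) = 1))"

end

theory Submission
  imports Defs "HOL-Number_Theory.Number_Theory" "Jordan_Normal_Form.Schur_Decomposition"
begin

text \<open>
  The heart of the matter is that \<open>\<psi>(h) - 1\<close> is twice an algebraic integer for every \<open>h \<in> H\<close>.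
  Identify \<open>S\<close> with the algebra of \<open>n \<times> n\<close> matrices and choose units \<open>M k\<close> of determinant \<open>1\<close> in the
  part of \<open>S\<close> supported on the coset \<open>k L\<close>. For \<open>U = \<sigma>(h)\<close> the sum over \<open>k \<in> K\<close> of the products of
  the inverse of \<open>M k\<close> with its conjugate by \<open>h\<close> equals \<open>n |L| tr(U') U\<close>, where \<open>U'\<close> is the inverse of \<open>U\<close>.
  Its trace shows that \<open>\<psi>(h) \<psi>(h')\<close>, with \<open>h'\<close> the inverse of \<open>h\<close>, is the order of the centralizer
  of \<open>h\<close> in \<open>K/L\<close>, an odd number; the traces of its powers show that a multiple of
  \<open>\<psi>(h')^j \<psi>(h^j)\<close> lies in \<open>\<int>[\<zeta>]\<close> for an \<open>n\<close>-th root of unity \<open>\<zeta>\<close>. The Galois automorphism that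
  fixes \<open>n\<close>-th and inverts \<open>|G:K|\<close>-th roots of unity then gives \<open>\<psi>(h) = \<psi>(h')\<close>, because the
  determinant is \<open>1\<close> and the orders are coprime. So \<open>\<psi>(h)^2\<close> is odd. It is congruent to \<open>\<psi>(h^2)\<close>
  modulo \<open>2\<close>, and every element of \<open>H/L\<close> is a square.

  Since the mean of \<open>\<xi>' cnj \<xi>\<close> over a coset of \<open>L\<close> is an algebraic integer and \<open>|H:L|\<close> is odd,
  \<open>(\<psi> \<xi>', \<xi>)\<close> and \<open>(\<xi>', \<xi>)\<close> have the same parity for irreducible \<open>\<xi>\<close> and \<open>\<xi>'\<close>. Finally
  \<open>\<chi>\<close> restricts to \<open>\<psi> \<xi>'\<close> for some irreducible \<open>\<xi>'\<close>: on a module \<open>V\<close> affording \<open>\<chi>\<close> the elements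
  \<open>h \<sigma>(h')\<close> commute with \<open>S\<close>, so \<open>H\<close> acts through them on \<open>E V\<close> for a primitive idempotent \<open>E\<close> of \<open>S\<close>.
\<close>

section \<open>Integral combinations of roots of unity\<close>

text \<open>Determinant 1 is what keeps the field of coefficients small. A unit of S supported on
  one coset of L is determined up to a scalar, and determinant 1 leaves only n-th roots of unity for
  that scalar; the trace is 0 unless the coset is L itself. So every product of such units has its
  trace in \<int>[\<zeta>], and U^j, multiplied by (n |L| tr(U'))^j, is a sum of such products. On
  the other hand the eigenvalues of U are |G:K|-th roots of unity. It is the coprimality of the two
  orders that lets one automorphism act on the eigenvalues and leave the traces of the products
  alone.

  Algebraic integers occur only as elements of a ring \<int>[z] for a root of unity z, where a
  rational number is an integer; a congruence modulo 2 needs no more. The Galois automorphism is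
  replaced by a statement about polynomials: one with integer coefficients that vanishes at z
  vanishes at z^k if k is prime to an exponent of z.\<close>

definition ipoly :: "int poly \<Rightarrow> complex \<Rightarrow> complex" where
  "ipoly F z = poly (map_poly of_int F) z"

text \<open>The ring \<int>[z]. Divisibility by 2 is tested in it for a root of unity
  \<open>z\<close>, where \<open>int_adj_rational_is_int\<close> applies.\<close>

definition int_adj :: "complex \<Rightarrow> complex set" where
  "int_adj z = range (\<lambda>F. ipoly F z)"

lemma ipoly_simps [simp]:
  "ipoly 0 z = 0" "ipoly 1 z = 1"
  "ipoly (F + F') z = ipoly F z + ipoly F' z"
  "ipoly (F - F') z = ipoly F z - ipoly F' z"
  "ipoly (- F) z = - ipoly F z"
  "ipoly (F * F') z = ipoly F z * ipoly F' z"
  "ipoly (F ^ k) z = ipoly F z ^ k"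
  "ipoly (pCons a F) z = of_int a + z * ipoly F z"
  "ipoly (Polynomial.monom a k) z = of_int a * z ^ k"
  "ipoly (Polynomial.smult a F) z = of_int a * ipoly F z"
  by (auto simp: ipoly_def hom_distribs poly_monom)

lemma int_adj_intros [intro]:
  "0 \<in> int_adj z" "1 \<in> int_adj z" "of_int a \<in> int_adj z" "of_nat b \<in> int_adj z" "z \<in> int_adj z"
proof -
  show "0 \<in> int_adj z" "1 \<in> int_adj z" "of_int a \<in> int_adj z" "of_nat b \<in> int_adj z" "z \<in> int_adj z"
    using rangeI[of "\<lambda>F. ipoly F z" 0] rangeI[of "\<lambda>F. ipoly F z" 1] rangeI[of "\<lambda>F. ipoly F z" "[:a:]"]
      rangeI[of "\<lambda>F. ipoly F z" "[:int b:]"] rangeI[of "\<lambda>F. ipoly F z" "[:0,1:]"]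
    by (auto simp: int_adj_def)
qed

lemma int_adj_add [intro]: "x \<in> int_adj z \<Longrightarrow> y \<in> int_adj z \<Longrightarrow> x + y \<in> int_adj z"
  unfolding int_adj_def by (auto simp flip: ipoly_simps)
lemma int_adj_diff [intro]: "x \<in> int_adj z \<Longrightarrow> y \<in> int_adj z \<Longrightarrow> x - y \<in> int_adj z"
  unfolding int_adj_def by (auto simp flip: ipoly_simps)
lemma int_adj_mult [intro]: "x \<in> int_adj z \<Longrightarrow> y \<in> int_adj z \<Longrightarrow> x * y \<in> int_adj z"
  unfolding int_adj_def by (auto simp flip: ipoly_simps)
lemma int_adj_power [intro]: "x \<in> int_adj z \<Longrightarrow> x ^ k \<in> int_adj z"
  by (induction k) auto
lemma int_adj_sum [intro]: "(\<And>a. a \<in> A \<Longrightarrow> f a \<in> int_adj z) \<Longrightarrow> sum f A \<in> int_adj z"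
  by (induction A rule: infinite_finite_induct) auto
lemma int_adj_sum_list [intro]: "(\<And>a. a \<in> set xs \<Longrightarrow> a \<in> int_adj z) \<Longrightarrow> sum_list xs \<in> int_adj z"
  by (induction xs) auto

text \<open>Gauss's lemma: the content is multiplicative, so \<open>c\<close> divides the content of
  the cofactor of \<open>f\<close> and can be cancelled. It clears the leading coefficient that
  pseudo-division introduces.\<close>

lemma primitive_dvd_of_smult_dvd:
  fixes f F :: "int poly"
  assumes "content f = 1" and "c \<noteq> 0" and "f dvd Polynomial.smult c F"
  shows "f dvd F"
proof -
  obtain q where q: "Polynomial.smult c F = f * q" using assms(3) by blast
  have "content (Polynomial.smult c F) = content q" using assms(1) by (simp add: q content_mult)
  then have "c dvd content q" unfolding content_smult using dvd_triv_left[of "normalize c" "content F"] by simp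
  then have "[:c:] dvd q" by (simp add: const_poly_dvd_iff_dvd_content)
  then obtain r where r: "q = Polynomial.smult c r" by (auto elim!: dvdE)
  then have "Polynomial.smult c F = Polynomial.smult c (f * r)" using q by simp
  then have "F = f * r" using \<open>c \<noteq> 0\<close> smult_cancel by blast
  then show ?thesis by simp
qed

text \<open>Take a nonzero polynomial of least degree that vanishes at \<open>z\<close> and make it
  primitive. Pseudo-division by it leaves no remainder, so by Gauss's lemma it divides every integer
  polynomial that vanishes at \<open>z\<close>; it divides x^N - 1 and therefore has leading
  coefficient 1 or -1.\<close>

lemma root_of_unity_minpoly:
  assumes "z ^ N = (1::complex)" and "N > 0"
  obtains f where "lead_coeff f = (1::int)" and "ipoly f z = 0"
    and "\<And>F. ipoly F z = 0 \<Longrightarrow> f dvd F"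
proof -
  let ?U = "Polynomial.monom 1 N - 1 :: int poly"
  have U: "ipoly ?U z = 0" using assms by simp
  have degU: "degree ?U = N"
    using assms(2) degree_add_eq_left[of "-1" "Polynomial.monom (1::int) N"] by (simp add: degree_monom_eq)
  have lU: "lead_coeff ?U = 1" unfolding degU using assms(2) by simp
  have U0: "?U \<noteq> 0" using lU by force
  let ?P = "\<lambda>F. F \<noteq> 0 \<and> ipoly F z = 0"
  define f0 where "f0 = arg_min degree ?P"
  have f0: "f0 \<noteq> 0" "ipoly f0 z = 0" and min: "\<And>F. F \<noteq> 0 \<Longrightarrow> ipoly F z = 0 \<Longrightarrow> degree f0 \<le> degree F"
    using arg_min_nat_lemma[of ?P ?U degree] U U0 unfolding f0_def by auto
  define f where "f = primitive_part f0"
  have fc: "content f = 1" using f0 by (simp add: f_def)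
  have f_nz: "f \<noteq> 0" using f0 by (simp add: f_def)
  have "ipoly f0 z = of_int (content f0) * ipoly f z"
    by (metis content_times_primitive_part f_def ipoly_simps(10))
  then have fz: "ipoly f z = 0" using f0 by simp
  have degf: "degree f = degree f0" by (simp add: f_def)
  have dvd: "f dvd F" if F: "ipoly F z = 0" for F
  proof -
    obtain q r where qr: "pseudo_divmod F f = (q, r)" by force
    have e: "Polynomial.smult (Polynomial.coeff f (degree f) ^ (Suc (degree F) - degree f)) F = f * q + r"
      and d: "r = 0 \<or> degree r < degree f" using pseudo_divmod[OF f_nz qr] by auto
    have "ipoly r z = 0" using arg_cong[OF e, of "\<lambda>F. ipoly F z"] F fz by simp
    then have "r = 0" using d min[of r] degf by force
    then show ?thesis using e primitive_dvd_of_smult_dvd[OF fc] f_nz by (metis add.right_neutral dvd_triv_left leading_coeff_0_iff power_not_zero)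
  qed
  have "lead_coeff f dvd 1" using dvd[OF U] lU by (metis dvdE dvd_triv_left lead_coeff_mult)
  then have "lead_coeff f = 1 \<or> lead_coeff f = -1" by auto
  then show ?thesis
  proof
    assume "lead_coeff f = 1" then show ?thesis using that[of f] fz dvd by blast
  next
    assume "lead_coeff f = -1" then show ?thesis using that[of "-f"] fz dvd by (auto simp: lead_coeff_minus)
  qed
qed

text \<open>Division by the monic minimal polynomial writes \<open>x\<close> as r(z) with deg r <
  deg f. If x = a/b, then b r - a vanishes at \<open>z\<close> and has too small a degree, so it is
  zero and \<open>r\<close> is an integer constant.\<close>

lemma int_adj_rational_is_int:
  assumes "z ^ N = (1::complex)" and "N > 0" and "x \<in> int_adj z" and "x \<in> \<rat>"
  shows "x \<in> \<int>"
proof -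
  obtain f where f: "lead_coeff f = (1::int)" "ipoly f z = 0" "\<And>F. ipoly F z = 0 \<Longrightarrow> f dvd F"
    using root_of_unity_minpoly[OF assms(1,2)] by blast
  have f_nz: "f \<noteq> 0" using f(1) by auto
  obtain F where F: "x = ipoly F z" using assms(3) by (auto simp: int_adj_def)
  obtain q r where qr: "pseudo_divmod F f = (q, r)" by force
  have e: "F = f * q + r" and d: "r = 0 \<or> degree r < degree f" using pseudo_divmod[OF f_nz qr] f(1) by auto
  have xr: "x = ipoly r z" using F e f(2) by simp
  obtain a b where ab: "x = of_int a / of_int b" "b \<noteq> (0::int)" using assms(4) by (elim Rats_cases') auto
  have "ipoly (Polynomial.smult b r - [:a:]) z = 0" using ab xr by (simp add: field_simps)
  then have "f dvd (Polynomial.smult b r - [:a:])" by (rule f(3))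
  have df: "degree f > 0"
  proof (rule ccontr)
    assume "\<not> ?thesis"
    then obtain c where "f = [:c:]" using degree_eq_zeroE by blast
    then show False using f by auto
  qed
  have "degree (Polynomial.smult b r - [:a:]) < degree f" using d df by (intro degree_diff_less) auto
  then have "Polynomial.smult b r - [:a:] = 0" using \<open>f dvd _\<close> dvd_imp_degree_le not_less by blast
  then have "degree (Polynomial.smult b r) = 0" by simp
  then have "degree r = 0" using ab(2) by simp
  then obtain c where "r = [:c:]" using degree_eq_zeroE by blast
  then show ?thesis using xr by simp
qed

section \<open>Frobenius modulo a prime and Galois conjugation\<close>

lemma int_adj_prime_power_add:
  assumes "prime p" and "x \<in> int_adj z" and "y \<in> int_adj z"
  shows "\<exists>w\<in>int_adj z. (x + y) ^ p = x ^ p + y ^ p + of_nat p * w"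
proof -
  have p: "p > 0" using assms(1) prime_gt_0_nat by blast
  let ?t = "\<lambda>k. of_nat (p choose k) * x ^ k * y ^ (p - k)"
  have "(x + y) ^ p = (\<Sum>k\<le>p. ?t k)" by (rule binomial_ring)
  also have "{..p} = insert 0 (insert p {0<..<p})" using p by auto
  also have "sum ?t \<dots> = x ^ p + y ^ p + (\<Sum>k\<in>{0<..<p}. ?t k)" using p by (simp add: ac_simps)
  also have "(\<Sum>k\<in>{0<..<p}. ?t k) = (\<Sum>k\<in>{0<..<p}. of_nat p * (of_nat ((p choose k) div p) * x ^ k * y ^ (p - k)))"
  proof (rule sum.cong)
    fix k assume "k \<in> {0<..<p}"
    then have "p dvd (p choose k)" using assms(1) p by (intro dvd_choose_prime) auto
    then have "(p choose k) = p * ((p choose k) div p)" by simp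
    then have "(of_nat (p choose k) :: complex) = of_nat p * of_nat ((p choose k) div p)"
      by (metis of_nat_mult)
    then show "?t k = of_nat p * (of_nat ((p choose k) div p) * x ^ k * y ^ (p - k))" by (simp add: ac_simps)
  qed simp
  also have "\<dots> = of_nat p * (\<Sum>k\<in>{0<..<p}. of_nat ((p choose k) div p) * x ^ k * y ^ (p - k))"
    by (simp add: sum_distrib_left)
  finally show ?thesis using assms(2,3) by (intro bexI[of _ "\<Sum>k\<in>{0<..<p}. of_nat ((p choose k) div p) * x ^ k * y ^ (p - k)"]) auto
qed

text \<open>Modulo p the p-th power is additive on \<int>[z], because p divides the inner binomial
  coefficients, and it fixes the integer coefficients by Fermat's theorem.\<close>

lemma ipoly_frobenius:
  assumes "prime p"
  shows "\<exists>w\<in>int_adj z. ipoly F z ^ p = ipoly F (z ^ p) + of_nat p * w"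
proof (induction F)
  case 0
  then show ?case using assms by (auto simp: prime_gt_0_nat power_0_left intro!: bexI[of _ 0])
next
  case (pCons a F)
  obtain w1 where w1: "w1 \<in> int_adj z" "ipoly F z ^ p = ipoly F (z ^ p) + of_nat p * w1" using pCons by blast
  have "ipoly F z \<in> int_adj z" by (auto simp: int_adj_def)
  then obtain w2 where w2: "w2 \<in> int_adj z"
      "(of_int a + z * ipoly F z) ^ p = of_int a ^ p + (z * ipoly F z) ^ p + of_nat p * w2"
    using int_adj_prime_power_add[OF assms, of "of_int a" z "z * ipoly F z"] by auto
  have fermat: "[b ^ p = b] (mod p)" for b
  proof (cases "p dvd b")
    case True
    then have "p dvd b ^ p" using prime_gt_0_nat[OF assms] by (meson dvd_power dvd_trans)
    then show ?thesis using True by (simp add: cong_def mod_eq_0_iff_dvd)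
  next
    case False
    then have "[b ^ (p - 1) * b = 1 * b] (mod p)" using fermat_theorem[OF assms] cong_scalar_right by blast
    then show ?thesis using power_minus_mult[OF prime_gt_0_nat[OF assms], of b] by simp
  qed
  have p0: "int p > 0" using prime_gt_0_nat[OF assms] by simp
  \<comment> \<open>The residue of \<open>a\<close> as a natural number, to which Fermat's theorem
    applies; negative coefficients are covered this way.\<close>
  define b where "b = nat (a mod int p)"
  have b: "int b = a mod int p" using p0 by (simp add: b_def)
  have "[a ^ p = int b ^ p] (mod int p)" by (intro cong_pow) (simp add: b cong_def)
  also have "[int b ^ p = int b] (mod int p)" using fermat[of b] by (metis cong_int_iff of_nat_power)
  also have "[int b = a] (mod int p)" by (simp add: b cong_def)
  finally have "[a ^ p = a] (mod int p)" .
  then obtain c where "a ^ p = a + int p * c" by (metis cong_iff_lin cong_sym mult.commute)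
  then have c: "(of_int a :: complex) ^ p = of_int a + of_nat p * of_int c"
    by (metis of_int_add of_int_mult of_int_of_nat_eq of_int_power)
  show ?case using w1 w2 c
    by (intro bexI[of _ "of_int c + z ^ p * w1 + w2"]) (auto simp: power_mult_distrib algebra_simps intro!: int_adj_add int_adj_mult int_adj_power)
qed

text \<open>Dedekind's argument. Let \<open>x^N - 1 = f g\<close> with \<open>f\<close> the minimal polynomial of \<open>z\<close>. If \<open>z^p\<close> were a root
  of \<open>g\<close>, then \<open>p\<close> would divide \<open>g(z)^p\<close>, and \<open>N z^(N - 1) = f'(z) g(z)\<close> would make \<open>N^p / p\<close> an
  algebraic integer.\<close>

lemma ipoly_root_of_unity_prime_power:
  assumes "z ^ N = (1::complex)" and "N > 0" and "prime p" and "\<not> p dvd N" and "ipoly F z = 0"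
  shows "ipoly F (z ^ p) = 0"
proof -
  obtain f where f: "lead_coeff f = (1::int)" "ipoly f z = 0" "\<And>F. ipoly F z = 0 \<Longrightarrow> f dvd F"
    using root_of_unity_minpoly[OF assms(1,2)] by blast
  let ?U = "Polynomial.monom 1 N - 1 :: int poly"
  have "f dvd ?U" using f(3) assms(1) by simp
  then obtain g where g: "?U = f * g" by blast
  have "ipoly f (z ^ p) = 0"
  proof (rule ccontr)
    assume nz: "ipoly f (z ^ p) \<noteq> 0"
    have "ipoly ?U (z ^ p) = 0" using assms(1) by (simp add: power_commutes flip: power_mult) (metis mult.commute power_mult power_one)
    then have "ipoly g (z ^ p) = 0" using g nz by simp
    then obtain w where w: "w \<in> int_adj z" "ipoly g z ^ p = of_nat p * w"
      using ipoly_frobenius[OF assms(3), of z g] by auto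
    have "pderiv ?U = f * pderiv g + g * pderiv f" unfolding g by (simp add: pderiv_mult)
    moreover have "pderiv ?U = Polynomial.monom (int N) (N - 1)" by (simp add: pderiv_diff pderiv_monom)
    ultimately have "ipoly (Polynomial.monom (int N) (N - 1)) z = ipoly (f * pderiv g + g * pderiv f) z" by simp
    then have "of_nat N * z ^ (N - 1) = ipoly g z * ipoly (pderiv f) z" using f(2) by simp
    \<comment> \<open>The extra factor \<open>z ^ p\<close> completes
      \<open>(z ^ (N - 1)) ^ p\<close> to a power of z^N = 1, so that the left side is the rational
      number N^p.\<close>
    then have "(of_nat N * z ^ (N - 1)) ^ p * z ^ p = of_nat p * (w * ipoly (pderiv f) z ^ p * z ^ p)"
      using w by (simp add: power_mult_distrib)
    moreover have "(of_nat N * z ^ (N - 1)) ^ p * z ^ p = of_nat N ^ p"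
      using assms(1,2) by (metis mult.assoc mult.right_neutral power_minus_mult power_mult_distrib)
    ultimately have "of_nat N ^ p = of_nat p * (w * ipoly (pderiv f) z ^ p * z ^ p)" by metis
    then have e: "of_nat N ^ p / of_nat p = w * ipoly (pderiv f) z ^ p * z ^ p"
      using prime_gt_0_nat[OF assms(3)] by simp
    have "ipoly (pderiv f) z \<in> int_adj z" by (auto simp: int_adj_def)
    then have "of_nat N ^ p / of_nat p \<in> int_adj z" unfolding e using w by blast
    then have "(of_nat N ^ p / of_nat p :: complex) \<in> \<int>"
      by (intro int_adj_rational_is_int[OF assms(1,2)]) auto
    then obtain c where "(of_nat N ^ p / of_nat p :: complex) = of_int c" by (auto elim: Ints_cases)
    then have "(of_nat N ^ p :: complex) = of_int c * of_nat p" using assms(3) by (simp add: field_simps prime_gt_0_nat)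
    then have "int N ^ p = c * int p" by (metis of_int_eq_iff of_int_mult of_int_of_nat_eq of_int_power)
    then have "p dvd N ^ p" by (metis dvd_triv_right int_dvd_int_iff of_nat_power)
    then show False using assms(3,4) prime_dvd_power by blast
  qed
  then show ?thesis using f(3)[OF assms(5)] by auto
qed

text \<open>One prime factor of \<open>k\<close> is split off at a time; the remaining power of
  \<open>z\<close> is again an \<open>N\<close>-th root of unity, so the prime case applies to
  it.\<close>

lemma ipoly_root_of_unity_coprime_power:
  assumes "z ^ N = (1::complex)" and "N > 0" and "coprime k N" and "ipoly F z = 0"
  shows "ipoly F (z ^ k) = 0"
  using assms(3)
proof (induction k rule: less_induct)
  case (less k)
  consider "k = 0" | "k = 1" | "k > 1" by linarith
  then show ?case
  proof cases
    \<comment> \<open>Coprimality of 0 and \<open>N\<close> means \<open>N = 1\<close>, so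
      \<open>z = 1\<close> as well.\<close>
    case 1 then show ?thesis using less assms by auto
  next
    case 2 then show ?thesis using assms by auto
  next
    case 3
    then obtain p where p: "prime p" "p dvd k" using prime_factor_nat[of k] by auto
    then obtain k' where k': "k = k' * p" by (auto simp: mult.commute elim: dvdE)
    have "k' < k" using k' prime_gt_1_nat[OF p(1)] 3 by (cases "k' = 0") auto
    moreover have "coprime k' N" using less.prems k' by simp
    ultimately have F: "ipoly F (z ^ k') = 0" using less.IH by blast
    have "\<not> p dvd N" using less.prems p coprime_common_divisor[of k N p] by (auto dest: not_prime_unit)
    moreover have "(z ^ k') ^ N = (z ^ N) ^ k'" by (simp add: mult.commute flip: power_mult)
    ultimately show ?thesis using ipoly_root_of_unity_prime_power[OF _ assms(2) p(1) _ F] k' assms(1) by (simp add: power_mult)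
  qed
qed

text \<open>The automorphism that inverts \<open>w\<close> and fixes \<open>u\<close>, applied to
  both sides of an equality. By the Chinese remainder theorem \<open>w\<close> and \<open>u\<close>
  are the powers \<open>z ^ a\<close> and \<open>z ^ b\<close> of z = w u, and replacing
  \<open>z\<close> by \<open>z ^ k\<close> with k = -1 modulo m and k = 1 modulo n has the required
  effect; \<open>w ^ (m - 1)\<close> is the inverse of \<open>w\<close>.\<close>

lemma ipoly_conjugate_coprime:
  assumes "w ^ m = (1::complex)" and "u ^ n = 1" and "m > 0" and "n > 0" and "coprime m n"
    and "ipoly F w = ipoly E u"
  shows "ipoly F (w ^ (m - 1)) = ipoly E u"
proof -
  have cong_pow: "a ^ i = a ^ j" if "a ^ k = 1" "[i = j] (mod k)" for a :: complex and i j k :: nat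
  proof -
    have "a ^ i = a ^ (i mod k)" for i
      by (metis that(1) mod_div_mult_eq mult.commute power_add power_mult power_one mult.right_neutral)
    then show ?thesis using that(2) by (metis cong_def)
  qed
  obtain a where a: "[a = 1] (mod m)" "[a = 0] (mod n)"
    using binary_chinese_remainder_nat[OF assms(5)] by blast
  obtain b where b: "[b = 0] (mod m)" "[b = 1] (mod n)"
    using binary_chinese_remainder_nat[OF assms(5)] by blast
  obtain k where k: "[k = m - 1] (mod m)" "[k = 1] (mod n)"
    using binary_chinese_remainder_nat[OF assms(5)] by blast
  define z where "z = w * u"
  have zN: "z ^ (m * n) = 1" using assms(1,2) unfolding z_def
    by (simp add: power_mult_distrib power_mult) (metis mult.commute power_mult power_one)
  have "coprime k m" using k(1) assms(3) cong_imp_coprime[OF cong_sym[OF k(1)] coprime_diff_one_left_nat] by simp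
  moreover have "coprime k n" using cong_imp_coprime[OF cong_sym[OF k(2)]] by simp
  ultimately have kc: "coprime k (m * n)" by simp
  have wz: "(z ^ i) ^ a = w ^ i" for i
  proof -
    have "(z ^ i) ^ a = (w ^ a) ^ i * (u ^ a) ^ i" by (simp add: z_def power_mult_distrib mult.commute flip: power_mult)
    also have "w ^ a = w" using cong_pow[OF assms(1) a(1)] by simp
    also have "u ^ a = 1" using cong_pow[OF assms(2) a(2)] by simp
    finally show ?thesis by simp
  qed
  have uz: "(z ^ i) ^ b = u ^ i" for i
  proof -
    have "(z ^ i) ^ b = (w ^ b) ^ i * (u ^ b) ^ i" by (simp add: z_def power_mult_distrib mult.commute flip: power_mult)
    also have "w ^ b = 1" using cong_pow[OF assms(1) b(1)] by simp
    also have "u ^ b = u" using cong_pow[OF assms(2) b(2)] by simp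
    finally show ?thesis by simp
  qed
  \<comment> \<open>Composition with x^c: both sides become values of integer polynomials at the
    same root of unity \<open>z\<close>.\<close>
  define inflate where "inflate c F = pcompose F (Polynomial.monom (1::int) c)" for c F
  have infl: "ipoly (inflate c F) x = ipoly F (x ^ c)" for c F x
    by (induction F) (auto simp: inflate_def pcompose_pCons)
  have "ipoly (inflate a F - inflate b E) z = 0" using assms(6) wz[of 1] uz[of 1] by (simp add: infl)
  then have "ipoly (inflate a F - inflate b E) (z ^ k) = 0"
    using ipoly_root_of_unity_coprime_power[OF zN _ kc] assms(3,4)
    by (simp only: nat_0_less_mult_iff simp_thms)
  then have "ipoly F (w ^ k) = ipoly E (u ^ k)" by (simp add: infl wz uz)
  moreover have "w ^ k = w ^ (m - 1)" using cong_pow[OF assms(1) k(1)] .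
  moreover have "u ^ k = u" using cong_pow[OF assms(2) k(2)] by simp
  ultimately show ?thesis by simp
qed

section \<open>Roots of unity and their power sums\<close>

lemma root_of_unity_eq_power:
  assumes "z ^ m = (1::complex)" and "m > 0"
  obtains e where "z = cis (2 * pi / real m) ^ e"
proof -
  have "z \<in> (\<lambda>k. cis (2 * pi * real k / real m)) ` {..<m}"
    using bij_betw_roots_unity[OF assms(2)] assms(1) by (auto simp: bij_betw_def)
  then obtain k where "z = cis (2 * pi * real k / real m)" by blast
  then have "z = cis (2 * pi / real m) ^ k" by (simp add: DeMoivre mult_ac)
  then show ?thesis by (rule that)
qed

lemma cis_power_eq_1: "m > 0 \<Longrightarrow> cis (2 * pi / real m) ^ m = 1"
  by (simp add: DeMoivre)

lemma root_of_unity_in_int_adj: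
  assumes "z ^ m = (1::complex)" and "m > 0"
  shows "z \<in> int_adj (cis (2 * pi / real m))"
proof -
  obtain e where "z = cis (2 * pi / real m) ^ e" using root_of_unity_eq_power[OF assms] .
  then show ?thesis using int_adj_power[OF int_adj_intros(5)] by simp
qed

lemma root_of_unity_nonzero: "z ^ m = (1::complex) \<Longrightarrow> m > 0 \<Longrightarrow> z \<noteq> 0"
  by (cases "z = 0") (auto simp: power_0_left)

lemma sum_powers_root_of_unity:
  assumes "z ^ m = (1::complex)"
  shows "(\<Sum>j\<in>{1..m}. z ^ j) = (if z = 1 then of_nat m else 0)"
proof (cases "z = 1")
  case False
  have "(\<Sum>j\<in>{1..m}. z ^ j) = z * (\<Sum>j<m. z ^ j)"
    by (simp add: sum_distrib_left sum.atLeast1_atMost_eq)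
  also have "(\<Sum>j<m. z ^ j) = 0" using geometric_sum[OF False, of m] assms by simp
  finally show ?thesis using False by simp
qed simp

text \<open>Discrete Fourier inversion: weighting the j-th power sum by z^(-j) and summing over a
  full period counts the entries equal to \<open>z\<close>, each of them \<open>m\<close>
  times.\<close>

lemma mset_eq_of_power_sums_eq:
  assumes "m > 0" and "\<And>x. x \<in> set xs \<Longrightarrow> x ^ m = (1::complex)" and "\<And>y. y \<in> set ys \<Longrightarrow> y ^ m = 1"
    and "\<And>j. j \<in> {1..m} \<Longrightarrow> (\<Sum>x\<leftarrow>xs. x ^ j) = (\<Sum>y\<leftarrow>ys. y ^ j)"
  shows "mset xs = mset ys"
proof (rule multiset_eqI)
  fix z :: complex
  have cnt: "of_nat m * of_nat (count (mset xs) z) = (\<Sum>j\<in>{1..m}. inverse z ^ j * (\<Sum>x\<leftarrow>xs. x ^ j))"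
    if "z ^ m = 1" "\<And>x. x \<in> set xs \<Longrightarrow> x ^ m = 1" for xs
    using that(2)
  proof (induction xs)
    case (Cons x xs)
    have z0: "z \<noteq> 0" using root_of_unity_nonzero[OF that(1) assms(1)] .
    have "(inverse z * x) ^ m = 1" using Cons.prems[of x] that(1) by (simp add: power_mult_distrib power_inverse)
    from sum_powers_root_of_unity[OF this]
    have "(\<Sum>j\<in>{1..m}. inverse z ^ j * x ^ j) = (if z = x then of_nat m else 0)"
      using z0 by (auto simp: power_mult_distrib field_simps)
    then show ?case using Cons by (auto simp: sum.distrib algebra_simps)
  qed simp
  show "count (mset xs) z = count (mset ys) z"
  proof (cases "z ^ m = 1")
    case True
    have "of_nat m * of_nat (count (mset xs) z) = (of_nat m * of_nat (count (mset ys) z) :: complex)"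
      using cnt[OF True] assms(2-4) by auto
    then show ?thesis using assms(1) by simp
  next
    case False
    then have "z \<notin> set xs" "z \<notin> set ys" using assms(2,3) by auto
    then show ?thesis by (metis count_greater_zero_iff gr0I set_mset_mset)
  qed
qed

lemma coprime_roots_of_unity_eq_1:
  assumes "(z::complex) ^ m = 1" and "z ^ n = 1" and "coprime m n"
  shows "z = 1"
proof (cases "m = 0")
  case True then show ?thesis using assms by auto
next
  case False
  obtain x y where "x * m = y * n + 1" using bezout_nat[OF False, of n] assms(3) by (auto simp: mult.commute)
  then have "z ^ (x * m) = z ^ (y * n) * z" by simp
  moreover have "z ^ (x * m) = (z ^ m) ^ x" "z ^ (y * n) = (z ^ n) ^ y" by (simp_all add: mult.commute flip: power_mult)
  ultimately show ?thesis using assms by simp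
qed

text \<open>Let \<open>s j\<close> be the power sums of \<open>xs\<close>. Fixing \<open>n\<close>-th and inverting \<open>m\<close>-th roots of unity turns the hypothesis into
  \<open>s(-j) = v^j s(j)\<close> for \<open>v = s(-1) / s(1)\<close>. So the inverses of \<open>xs\<close> are the multiples of \<open>xs\<close> by \<open>v\<close>,
  and comparing products gives \<open>v^n = 1\<close>.\<close>

lemma sum_list_eq_sum_list_inverse:
  fixes xs :: "complex list" and c :: nat
  assumes m: "m > 0" and n: "n > 0" and "coprime m n" and roots: "\<And>x. x \<in> set xs \<Longrightarrow> x ^ m = 1"
    and len: "length xs = n" and prd: "prod_list xs = 1" and nz: "sum_list xs \<noteq> 0" and c: "c \<noteq> 0"
    and fixed: "\<And>j. j \<ge> 1 \<Longrightarrow>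
      of_nat c ^ j * (\<Sum>x\<leftarrow>xs. x ^ (m - 1)) ^ j * (\<Sum>x\<leftarrow>xs. x ^ j) \<in> int_adj (cis (2 * pi / real n))"
  shows "(\<Sum>x\<leftarrow>xs. x ^ (m - 1)) = sum_list xs"
proof -
  define w where "w = cis (2 * pi / real m)"
  define u where "u = cis (2 * pi / real n)"
  have w: "w ^ m = 1" and u: "u ^ n = 1" unfolding w_def u_def using m n cis_power_eq_1 by auto
  define e where "e x = (SOME e. x = w ^ e)" for x
  have e: "x = w ^ e x" if "x \<in> set xs" for x
    unfolding e_def by (rule someI_ex) (use root_of_unity_eq_power[OF roots[OF that] m] w_def in blast)
  define s where "s j = (\<Sum>x\<leftarrow>xs. x ^ j)" for j
  define P where "P j = (\<Sum>x\<leftarrow>xs. Polynomial.monom (1::int) (e x * j))" for j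
  have P: "ipoly (P j) (w ^ i) = s (i * j)" for i j
  proof -
    have "ipoly (\<Sum>x\<leftarrow>ys. Polynomial.monom 1 (e x * j)) (w ^ i) = (\<Sum>x\<leftarrow>ys. x ^ (i * j))"
      if "set ys \<subseteq> set xs" for ys using that
    proof (induction ys)
      case (Cons y ys)
      have "(w ^ i) ^ (e y * j) = (w ^ e y) ^ (i * j)" by (simp add: mult_ac flip: power_mult)
      then show ?case using Cons e[of y] by simp
    qed simp
    then show ?thesis by (simp add: P_def s_def)
  qed
  have s_cong: "s i = s j" if "[i = j] (mod m)" for i j
  proof -
    have "x ^ i = x ^ j" if "x \<in> set xs" for x
    proof -
      have "x ^ i = x ^ (i mod m)" for i
        by (metis roots[OF that] mod_div_mult_eq mult.commute power_add power_mult power_one mult.right_neutral)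
      then show ?thesis using \<open>[i = j] (mod m)\<close> by (metis cong_def)
    qed
    then show ?thesis unfolding s_def by (metis (no_types, lifting) map_eq_conv)
  qed
  \<comment> \<open>Exponents matter only modulo \<open>m\<close>, and \<open>m - 1\<close> stands
    for -1.\<close>
  have sq: "[(m - 1) * (m - 1) = 1] (mod m)"
  proof -
    have "(m - 1) * (m - 1) = 1 + m * (m - 2)" if "m \<ge> 2"
      using that by (auto simp: algebra_simps nat_diff_split dest!: le_Suc_ex)
    then have "[(m - 1) * (m - 1) = 1] (mod m)" if "m \<ge> 2"
      using that mod_mult_self2[of 1 m "m - 2"] by (simp add: cong_def)
    then show ?thesis using m by (cases "m = 1") auto
  qed
  \<comment> \<open>Up to the factor c^j the left side lies in \<int>[u], so inverting
    \<open>w\<close> does not change it; but this exchanges \<open>s (m - 1)\<close> with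
    \<open>s 1\<close> and turns \<open>s j\<close> into \<open>s ((m - 1) * j)\<close>.\<close>
  have rel: "s (m - 1) ^ j * s j = s 1 ^ j * s ((m - 1) * j)" if j: "j \<ge> 1" for j
  proof -
    let ?F = "Polynomial.smult (int c ^ j) (P (m - 1) ^ j * P j)"
    have F: "ipoly ?F (w ^ i) = of_nat c ^ j * (s (i * (m - 1)) ^ j * s (i * j))" for i
      by (simp add: P)
    have "ipoly ?F w = of_nat c ^ j * s (m - 1) ^ j * s j"
      using F[of 1] by (simp only: power_one_right mult_1 mult.assoc)
    then have "ipoly ?F w \<in> int_adj u" using fixed[OF j] by (simp only: s_def u_def)
    then obtain E where E: "ipoly ?F w = ipoly E u" unfolding int_adj_def by blast
    have "of_nat c ^ j * (s 1 ^ j * s ((m - 1) * j)) = ipoly ?F (w ^ (m - 1))"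
      unfolding F s_cong[OF sq] ..
    also have "\<dots> = ipoly ?F (w ^ 1)"
      unfolding power_one_right using ipoly_conjugate_coprime[OF w u m n assms(3) E] E by (rule trans[OF _ sym])
    also have "\<dots> = of_nat c ^ j * (s (m - 1) ^ j * s j)" unfolding F mult_1 ..
    finally have "of_nat c ^ j * (s 1 ^ j * s ((m - 1) * j)) = of_nat c ^ j * (s (m - 1) ^ j * s j)" .
    then show ?thesis using c by simp
  qed
  define v where "v = s (m - 1) / s 1"
  have s1: "s 1 \<noteq> 0" using nz by (simp add: s_def)
  have rel': "s ((m - 1) * j) = v ^ j * s j" if "j \<ge> 1" for j
    using rel[OF that] s1 by (simp add: v_def field_simps power_divide)
  have s0: "s m = of_nat n" "s ((m - 1) * m) = of_nat n"
  proof -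
    have "s 0 = of_nat n" by (simp add: s_def len sum_list_triv)
    then show "s m = of_nat n" "s ((m - 1) * m) = of_nat n" using s_cong[of m 0] s_cong[of "(m - 1) * m" 0]
      by (auto simp: cong_def)
  qed
  \<comment> \<open>At \<open>j = m\<close> both power sums are the number \<open>n\<close> of
    entries, which is not zero.\<close>
  have vm: "v ^ m = 1" using rel'[of m] s0 m n by simp
  have "mset (map (\<lambda>x. x ^ (m - 1)) xs) = mset (map (\<lambda>x. v * x) xs)"
  proof (rule mset_eq_of_power_sums_eq[OF m])
    fix y assume "y \<in> set (map (\<lambda>x. x ^ (m - 1)) xs)"
    then show "y ^ m = 1" using roots by (auto simp flip: power_mult) (metis mult.commute power_mult power_one)
  next
    fix y assume "y \<in> set (map (\<lambda>x. v * x) xs)"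
    then show "y ^ m = 1" using roots vm by (auto simp: power_mult_distrib)
  next
    fix j assume "j \<in> {1..m}"
    then have "s ((m - 1) * j) = v ^ j * s j" using rel' by simp
    then show "(\<Sum>x\<leftarrow>map (\<lambda>x. x ^ (m - 1)) xs. x ^ j) = (\<Sum>y\<leftarrow>map (\<lambda>x. v * x) xs. y ^ j)"
      by (simp add: s_def o_def power_mult power_mult_distrib sum_list_const_mult)
  qed
  then have "prod_list (map (\<lambda>x. x ^ (m - 1)) xs) = prod_list (map (\<lambda>x. v * x) xs)"
    by (metis prod_mset_prod_list)
  moreover have "prod_list (map (\<lambda>x. x ^ k) ys) = prod_list ys ^ k" for k and ys :: "complex list"
    by (induction ys) (auto simp: power_mult_distrib)
  moreover have "prod_list (map (\<lambda>x. v * x) ys) = v ^ length ys * prod_list ys" for ys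
    by (induction ys) auto
  ultimately have "v ^ n = 1" using prd len by simp
  then have "v = 1" using coprime_roots_of_unity_eq_1[OF vm _ assms(3)] by simp
  then show ?thesis using s1 by (simp add: v_def s_def)
qed

lemma sum_list_square_mod_2:
  assumes "\<And>x. x \<in> set xs \<Longrightarrow> x \<in> int_adj z"
  shows "\<exists>y\<in>int_adj z. sum_list xs ^ 2 = (\<Sum>x\<leftarrow>xs. x ^ 2) + 2 * y"
  using assms
proof (induction xs)
  case Nil show ?case by (auto intro!: bexI[of _ 0])
next
  case (Cons x xs)
  then obtain y where y: "y \<in> int_adj z" "sum_list xs ^ 2 = (\<Sum>x\<leftarrow>xs. x ^ 2) + 2 * y" by auto
  have "sum_list xs \<in> int_adj z" using Cons.prems by (intro int_adj_sum_list) auto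
  then show ?case using y Cons.prems
    by (intro bexI[of _ "y + x * sum_list xs"]) (auto simp: power2_eq_square algebra_simps intro!: int_adj_add int_adj_mult)
qed

section \<open>Traces, Kronecker products and sums of matrices\<close>

lemma trace_mat_mult:
  assumes "A \<in> carrier_mat n m" and "B \<in> carrier_mat m n"
  shows "trace_mat (A * B) = (\<Sum>i<n. \<Sum>j<m. A $$ (i, j) * B $$ (j, i))"
  using assms unfolding trace_mat_def
  by (intro sum.cong) (auto simp: scalar_prod_def lessThan_atLeast0)

lemma trace_mat_comm:
  assumes "A \<in> carrier_mat n m" and "B \<in> carrier_mat m n"
  shows "trace_mat (A * B) = trace_mat (B * A)"
  unfolding trace_mat_mult[OF assms] trace_mat_mult[OF assms(2,1)]
  by (subst sum.swap) (simp add: mult.commute)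

lemma trace_mat_one [simp]: "trace_mat (1\<^sub>m n) = of_nat n"
  by (simp add: trace_mat_def)

lemma trace_mat_zero [simp]: "trace_mat (0\<^sub>m n n) = 0"
  by (simp add: trace_mat_def)

lemma trace_mat_smult [simp]: "A \<in> carrier_mat n n \<Longrightarrow> trace_mat (c \<cdot>\<^sub>m A) = c * trace_mat A"
  by (auto simp: trace_mat_def sum_distrib_left)

lemma trace_mat_add: "A \<in> carrier_mat n n \<Longrightarrow> B \<in> carrier_mat n n \<Longrightarrow> trace_mat (A + B) = trace_mat A + trace_mat B"
  by (auto simp: trace_mat_def sum.distrib)

lemma trace_mat_conj:
  assumes "A \<in> carrier_mat n n" "P \<in> carrier_mat n n" "Q \<in> carrier_mat n n" "Q * P = 1\<^sub>m n"
  shows "trace_mat (P * A * Q) = trace_mat A"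
proof -
  have "trace_mat (P * A * Q) = trace_mat (Q * (P * A))" using assms by (intro trace_mat_comm) auto
  also have "Q * (P * A) = (Q * P) * A" using assms by (intro assoc_mult_mat[symmetric]) auto
  finally show ?thesis using assms by simp
qed

lemma upper_triangular_pow:
  assumes "B \<in> carrier_mat n n" "upper_triangular (B :: complex mat)"
  shows "upper_triangular (B ^\<^sub>m k) \<and> (\<forall>i<n. (B ^\<^sub>m k) $$ (i, i) = (B $$ (i, i)) ^ k)"
proof (induction k)
  case 0
  then show ?case using assms(1) by auto
next
  case (Suc k)
  let ?C = "B ^\<^sub>m k"
  have C: "?C \<in> carrier_mat n n" using assms(1) by simp
  have ent: "(?C * B) $$ (i, j) = (\<Sum>l<n. ?C $$ (i, l) * B $$ (l, j))" if "i < n" "j < n" for i j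
    using that C assms(1) by (simp add: scalar_prod_def lessThan_atLeast0)
  have z: "?C $$ (i, j) = 0" "B $$ (i, j) = 0" if "j < i" "i < n" for i j
    using Suc C assms that by auto
  have 1: "(?C * B) $$ (i, j) = 0" if "j < i" "i < n" for i j
    unfolding ent[OF that(2) less_trans[OF that]]
  proof (rule sum.neutral, rule ballI)
    fix l assume "l \<in> {..<n}"
    then show "?C $$ (i, l) * B $$ (l, j) = 0" using z[of l i] z[of j l] that by (cases "l < i") auto
  qed
  have 2: "(?C * B) $$ (i, i) = (B $$ (i, i)) ^ Suc k" if "i < n" for i
  proof -
    have "(\<Sum>l<n. ?C $$ (i, l) * B $$ (l, i)) = (\<Sum>l\<in>{i}. ?C $$ (i, l) * B $$ (l, i))"
    proof (rule sum.mono_neutral_right)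
      show "\<forall>l\<in>{..<n} - {i}. ?C $$ (i, l) * B $$ (l, i) = 0"
      proof
        fix l assume "l \<in> {..<n} - {i}"
        then show "?C $$ (i, l) * B $$ (l, i) = 0" using z[of l i] z[of i l] that by (cases "l < i") auto
      qed
    qed (use that in auto)
    then show ?thesis using ent[OF that that] Suc that by simp
  qed
  show ?case using 1 2 C assms(1) by (auto simp: upper_triangular_def)
qed

lemma eigenvector_pow_mult:
  assumes "A \<in> carrier_mat n n" "v \<in> carrier_vec n" "A *\<^sub>v v = x \<cdot>\<^sub>v v"
  shows "(A ^\<^sub>m k) *\<^sub>v v = (x ^ k :: complex) \<cdot>\<^sub>v v"
proof (induction k)
  case 0
  then show ?case using assms by simp
next
  case (Suc k)
  have "(A ^\<^sub>m Suc k) *\<^sub>v v = (A ^\<^sub>m k) *\<^sub>v (A *\<^sub>v v)"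
    using assms by (simp add: assoc_mult_mat_vec[of _ n n _ n])
  also have "\<dots> = x \<cdot>\<^sub>v ((A ^\<^sub>m k) *\<^sub>v v)" using assms by (simp add: mult_mat_vec[of _ n n])
  finally show ?case using Suc by (simp add: smult_smult_assoc)
qed

text \<open>The diagonal of a Schur triangular form lists the eigenvalues with multiplicity, so
  traces of powers are power sums. The last clause transfers a relation between powers of
  \<open>A\<close> to each eigenvalue by means of an eigenvector; through it eigenvalues are
  recognized as roots of unity or zero.\<close>

lemma matrix_eigenvalue_list:
  assumes A: "(A :: complex mat) \<in> carrier_mat n n"
  obtains xs where "length xs = n" and "Determinant.det A = prod_list xs"
    and "\<And>k. trace_mat (A ^\<^sub>m k) = (\<Sum>x\<leftarrow>xs. x ^ k)"
    and "\<And>a b x. A ^\<^sub>m a = A ^\<^sub>m b \<Longrightarrow> x \<in> set xs \<Longrightarrow> x ^ a = x ^ b"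
proof -
  obtain xs where xs: "char_poly A = (\<Prod>a\<leftarrow>xs. [:- a, 1:])" "length xs = n"
    using char_poly_factorized[OF A] by blast
  obtain B P Q where BPQ: "schur_decomposition A xs = (B, P, Q)" by (cases "schur_decomposition A xs") auto
  have s: "similar_mat_wit A B P Q" "upper_triangular B" "diag_mat B = xs"
    using schur_decomposition[OF A xs(1) BPQ] by auto
  from similar_mat_witD2[OF A s(1)]
  have c: "P * Q = 1\<^sub>m n" "Q * P = 1\<^sub>m n" "A = P * B * Q" "B \<in> carrier_mat n n" "P \<in> carrier_mat n n" "Q \<in> carrier_mat n n"
    by auto
  have xs': "xs = map (\<lambda>i. B $$ (i, i)) [0..<n]" using s(3) c(4) by (auto simp: diag_mat_def)
  have tr: "trace_mat (A ^\<^sub>m k) = (\<Sum>x\<leftarrow>xs. x ^ k)" for k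
  proof -
    have "A ^\<^sub>m k = P * (B ^\<^sub>m k) * Q" using similar_mat_witD(3)[OF _ similar_mat_wit_pow[OF s(1)]] by blast
    then have "trace_mat (A ^\<^sub>m k) = trace_mat (B ^\<^sub>m k)"
      using trace_mat_conj[of "B ^\<^sub>m k" n P Q] c(2,4-6) by (metis pow_carrier_mat)
    also have "\<dots> = (\<Sum>i<n. (B $$ (i, i)) ^ k)"
      using upper_triangular_pow[OF c(4) s(2)] c(4) by (simp add: trace_mat_def)
    also have "\<dots> = (\<Sum>x\<leftarrow>xs. x ^ k)" by (simp add: xs' o_def interv_sum_list_conv_sum_set_nat lessThan_atLeast0)
    finally show ?thesis .
  qed
  have det: "Determinant.det A = prod_list xs"
    using det_similar[of A B] s(1) det_upper_triangular[OF s(2) c(4)] s(3) unfolding similar_mat_def by auto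
  have ev: "x ^ a = x ^ b" if "A ^\<^sub>m a = A ^\<^sub>m b" "x \<in> set xs" for a b x
  proof -
    have "poly (char_poly A) x = 0" using that(2) unfolding xs(1)
      by (auto simp: poly_prod_list prod_list_zero_iff)
    then have "eigenvalue A x" using eigenvalue_root_char_poly[OF A] by blast
    then obtain v where v: "v \<in> carrier_vec n" "v \<noteq> 0\<^sub>v n" "A *\<^sub>v v = x \<cdot>\<^sub>v v"
      using A unfolding eigenvalue_def eigenvector_def by auto
    obtain i where i: "i < n" "v $ i \<noteq> 0" using v(1,2) by (metis carrier_vecD eq_vecI index_zero_vec)
    have "(x ^ a) \<cdot>\<^sub>v v = (x ^ b) \<cdot>\<^sub>v v" using eigenvector_pow_mult[OF A v(1,3)] that(1) by metis
    then have "((x ^ a) \<cdot>\<^sub>v v) $ i = ((x ^ b) \<cdot>\<^sub>v v) $ i" by simp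
    then show ?thesis using i v(1) by simp
  qed
  show ?thesis by (rule that[OF xs(2) det tr ev])
qed

text \<open>All eigenvalues are 0 or 1.\<close>

lemma trace_idempotent_mat_nat:
  assumes "E \<in> carrier_mat n n" and "E * E = E"
  obtains r :: nat where "trace_mat E = of_nat r"
proof -
  obtain xs where xs: "\<And>k. trace_mat (E ^\<^sub>m k) = (\<Sum>x\<leftarrow>xs. x ^ k)"
    and e: "\<And>a b x. E ^\<^sub>m a = E ^\<^sub>m b \<Longrightarrow> x \<in> set xs \<Longrightarrow> x ^ a = x ^ b"
    using matrix_eigenvalue_list[OF assms(1)] by metis
  have E1: "E ^\<^sub>m 1 = E" using assms(1) by simp
  have E2: "E ^\<^sub>m 2 = E" using assms by (simp add: numeral_2_eq_2)
  have sq: "x ^ 2 = x" if "x \<in> set xs" for x using e[of 2 1 x] E1 E2 that by simp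
  have "\<exists>r::nat. sum_list ys = of_nat r" if "\<forall>y\<in>set ys. y ^ 2 = (y::complex)" for ys using that
  proof (induction ys)
    case Nil show ?case by (auto intro: exI[of _ 0])
  next
    case (Cons y ys)
    then obtain r where "sum_list ys = of_nat r" by auto
    moreover have "y = of_nat 0 \<or> y = of_nat 1" using Cons.prems by (auto simp: power2_eq_square)
    ultimately show ?case by (metis of_nat_add sum_list.Cons)
  qed
  then obtain r :: nat where "sum_list xs = of_nat r" using sq by blast
  then show ?thesis using that xs[of 1] E1 by simp
qed

section \<open>Kronecker products, for products of characters\<close>

definition kron :: "complex mat \<Rightarrow> complex mat \<Rightarrow> complex mat" where
  "kron A B = Matrix.mat (dim_row A * dim_row B) (dim_col A * dim_col B)
     (\<lambda>(i, j). A $$ (i div dim_row B, j div dim_col B) * B $$ (i mod dim_row B, j mod dim_col B))"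

lemma kron_carrier [simp]:
  "A \<in> carrier_mat n n \<Longrightarrow> B \<in> carrier_mat k k \<Longrightarrow> kron A B \<in> carrier_mat (n * k) (n * k)"
  by (auto simp: kron_def)

lemma sum_div_mod:
  fixes n k :: nat
  shows "(\<Sum>i<n * k. f (i div k) (i mod k)) = (\<Sum>a<n. \<Sum>b<k. f a b)"
proof -
  have "(\<Sum>i<n * k. f (i div k) (i mod k)) = (\<Sum>a<n. \<Sum>i\<in>{a * k..<a * k + k}. f (i div k) (i mod k))"
    by (rule sum.nat_group[symmetric])
  also have "\<dots> = (\<Sum>a<n. \<Sum>b<k. f a b)"
  proof (rule sum.cong[OF refl])
    fix a
    have "(\<Sum>i\<in>{a * k..<a * k + k}. f (i div k) (i mod k)) = (\<Sum>b\<in>{0..<k}. f ((b + a * k) div k) ((b + a * k) mod k))"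
      using sum.shift_bounds_nat_ivl[of "\<lambda>i. f (i div k) (i mod k)" 0 "a * k" k] by (simp add: add.commute)
    also have "\<dots> = (\<Sum>b<k. f a b)" unfolding lessThan_atLeast0 by (intro sum.cong) auto
    finally show "(\<Sum>i\<in>{a * k..<a * k + k}. f (i div k) (i mod k)) = (\<Sum>b<k. f a b)" .
  qed
  finally show ?thesis .
qed

lemma div_mod_less:
  assumes "i < n * (k::nat)" shows "i div k < n" "i mod k < k"
  using assms by (auto simp: less_mult_imp_div_less) (metis mod_less_divisor mult_0_right neq0_conv not_less_zero)

lemma kron_mult:
  assumes "A \<in> carrier_mat n n" "A' \<in> carrier_mat n n" "B \<in> carrier_mat k k" "B' \<in> carrier_mat k k"
  shows "kron A B * kron A' B' = kron (A * A') (B * B')"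
proof (rule eq_matI)
  have d: "dim_row A = n" "dim_col A = n" "dim_row A' = n" "dim_col A' = n"
    "dim_row B = k" "dim_col B = k" "dim_row B' = k" "dim_col B' = k" using assms by auto
  fix i j assume "i < dim_row (kron (A * A') (B * B'))" "j < dim_col (kron (A * A') (B * B'))"
  then have ij: "i < n * k" "j < n * k" by (auto simp: kron_def d)
  note dm = div_mod_less[OF ij(1)] div_mod_less[OF ij(2)]
  have "(kron A B * kron A' B') $$ (i, j)
      = (\<Sum>l<n * k. (A $$ (i div k, l div k) * B $$ (i mod k, l mod k)) * (A' $$ (l div k, j div k) * B' $$ (l mod k, j mod k)))"
    using ij by (auto simp: kron_def d scalar_prod_def lessThan_atLeast0 intro!: sum.cong)
  also have "\<dots> = (\<Sum>a<n. \<Sum>b<k. (A $$ (i div k, a) * B $$ (i mod k, b)) * (A' $$ (a, j div k) * B' $$ (b, j mod k)))"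
    by (rule sum_div_mod)
  also have "\<dots> = (\<Sum>a<n. A $$ (i div k, a) * A' $$ (a, j div k)) * (\<Sum>b<k. B $$ (i mod k, b) * B' $$ (b, j mod k))"
    by (simp add: sum_product mult_ac)
  also have "\<dots> = kron (A * A') (B * B') $$ (i, j)"
    using ij dm by (simp add: kron_def d scalar_prod_def lessThan_atLeast0)
  finally show "(kron A B * kron A' B') $$ (i, j) = kron (A * A') (B * B') $$ (i, j)" .
qed (use assms in \<open>auto simp: kron_def\<close>)

lemma trace_kron:
  assumes "A \<in> carrier_mat n n" "B \<in> carrier_mat k k"
  shows "trace_mat (kron A B) = trace_mat A * trace_mat B"
proof -
  have "trace_mat (kron A B) = (\<Sum>i<n * k. A $$ (i div k, i div k) * B $$ (i mod k, i mod k))"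
    using assms by (auto simp: trace_mat_def kron_def intro!: sum.cong)
  also have "\<dots> = (\<Sum>a<n. \<Sum>b<k. A $$ (a, a) * B $$ (b, b))" by (rule sum_div_mod)
  finally show ?thesis using assms by (simp add: trace_mat_def sum_product)
qed

lemma kron_one: "kron (1\<^sub>m n) (1\<^sub>m k) = 1\<^sub>m (n * k)"
proof (rule eq_matI)
  fix i j assume "i < dim_row (1\<^sub>m (n * k) :: complex mat)" "j < dim_col (1\<^sub>m (n * k) :: complex mat)"
  then have ij: "i < n * k" "j < n * k" by auto
  note dm = div_mod_less[OF ij(1)] div_mod_less[OF ij(2)]
  have "i = j \<longleftrightarrow> i div k = j div k \<and> i mod k = j mod k" by (metis div_mult_mod_eq)
  then show "kron (1\<^sub>m n) (1\<^sub>m k) $$ (i, j) = 1\<^sub>m (n * k) $$ (i, j)" using ij dm by (auto simp: kron_def)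
qed (auto simp: kron_def)

text \<open>The dimensions are parameters so that an empty sum is still a zero matrix of definite
  size.\<close>

definition msum :: "nat \<Rightarrow> nat \<Rightarrow> ('i \<Rightarrow> complex mat) \<Rightarrow> 'i set \<Rightarrow> complex mat" where
  "msum r c f I = Matrix.mat r c (\<lambda>ij. \<Sum>a\<in>I. f a $$ ij)"

lemma msum_carrier [simp]: "msum r c f I \<in> carrier_mat r c"
  by (simp add: msum_def)

lemma msum_dim [simp]: "dim_row (msum r c f I) = r" "dim_col (msum r c f I) = c"
  by (simp_all add: msum_def)

lemma msum_index: "i < r \<Longrightarrow> j < c \<Longrightarrow> msum r c f I $$ (i, j) = (\<Sum>a\<in>I. f a $$ (i, j))"
  by (simp add: msum_def)

lemma msum_cong: "I = J \<Longrightarrow> (\<And>a. a \<in> J \<Longrightarrow> f a = g a) \<Longrightarrow> msum r c f I = msum r c g J"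
  by (simp add: msum_def)

lemma msum_reindex: "bij_betw h I J \<Longrightarrow> msum r c f J = msum r c (\<lambda>a. f (h a)) I"
  by (intro eq_matI) (auto simp: msum_index intro!: sum.reindex_bij_betw[symmetric])

lemma mult_msum:
  assumes "X \<in> carrier_mat p r" "\<And>a. a \<in> I \<Longrightarrow> f a \<in> carrier_mat r c"
  shows "X * msum r c f I = msum p c (\<lambda>a. X * f a) I"
proof (rule eq_matI)
  fix i j assume "i < dim_row (msum p c (\<lambda>a. X * f a) I)" "j < dim_col (msum p c (\<lambda>a. X * f a) I)"
  then have ij: "i < p" "j < c" by auto
  have e: "(X * f a) $$ (i, j) = (\<Sum>l<r. X $$ (i, l) * f a $$ (l, j))" if "a \<in> I" for a
    using assms(1) assms(2)[OF that] ij by (auto simp: scalar_prod_def lessThan_atLeast0)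
  have "(X * msum r c f I) $$ (i, j) = (\<Sum>l<r. X $$ (i, l) * (\<Sum>a\<in>I. f a $$ (l, j)))"
    using ij assms(1) by (auto simp: scalar_prod_def lessThan_atLeast0 msum_index)
  also have "\<dots> = (\<Sum>a\<in>I. \<Sum>l<r. X $$ (i, l) * f a $$ (l, j))"
    unfolding sum_distrib_left by (rule sum.swap)
  finally show "(X * msum r c f I) $$ (i, j) = msum p c (\<lambda>a. X * f a) I $$ (i, j)"
    using ij e by (simp add: msum_index)
qed (use assms in auto)

lemma msum_mult:
  assumes "X \<in> carrier_mat c p" "\<And>a. a \<in> I \<Longrightarrow> f a \<in> carrier_mat r c"
  shows "msum r c f I * X = msum r p (\<lambda>a. f a * X) I"
proof (rule eq_matI)
  fix i j assume "i < dim_row (msum r p (\<lambda>a. f a * X) I)" "j < dim_col (msum r p (\<lambda>a. f a * X) I)"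
  then have ij: "i < r" "j < p" by auto
  have e: "(f a * X) $$ (i, j) = (\<Sum>l<c. f a $$ (i, l) * X $$ (l, j))" if "a \<in> I" for a
    using assms(1) assms(2)[OF that] ij by (auto simp: scalar_prod_def lessThan_atLeast0)
  have "(msum r c f I * X) $$ (i, j) = (\<Sum>l<c. (\<Sum>a\<in>I. f a $$ (i, l)) * X $$ (l, j))"
    using ij assms(1) by (auto simp: scalar_prod_def lessThan_atLeast0 msum_index)
  also have "\<dots> = (\<Sum>a\<in>I. \<Sum>l<c. f a $$ (i, l) * X $$ (l, j))"
    unfolding sum_distrib_right by (rule sum.swap)
  finally show "(msum r c f I * X) $$ (i, j) = msum r p (\<lambda>a. f a * X) I $$ (i, j)"
    using ij e by (simp add: msum_index)
qed (use assms in auto)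

lemma trace_msum:
  assumes "\<And>a. a \<in> I \<Longrightarrow> f a \<in> carrier_mat n n"
  shows "trace_mat (msum n n f I) = (\<Sum>a\<in>I. trace_mat (f a))"
proof -
  have "trace_mat (msum n n f I) = (\<Sum>i<n. \<Sum>a\<in>I. f a $$ (i, i))" by (simp add: trace_mat_def msum_index)
  also have "\<dots> = (\<Sum>a\<in>I. \<Sum>i<n. f a $$ (i, i))" by (rule sum.swap)
  also have "\<dots> = (\<Sum>a\<in>I. trace_mat (f a))" using assms by (intro sum.cong) (auto simp: trace_mat_def)
  finally show ?thesis .
qed

lemma msum_smult_const:
  assumes "X \<in> carrier_mat r c"
  shows "msum r c (\<lambda>a. f a \<cdot>\<^sub>m X) I = (\<Sum>a\<in>I. f a) \<cdot>\<^sub>m X"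
  using assms by (intro eq_matI) (auto simp: msum_index sum_distrib_right)

lemma smult_msum:
  assumes "\<And>a. a \<in> I \<Longrightarrow> f a \<in> carrier_mat r c"
  shows "k \<cdot>\<^sub>m msum r c f I = msum r c (\<lambda>a. k \<cdot>\<^sub>m f a) I"
proof (rule eq_matI)
  fix i j assume ij: "i < dim_row (msum r c (\<lambda>a. k \<cdot>\<^sub>m f a) I)" "j < dim_col (msum r c (\<lambda>a. k \<cdot>\<^sub>m f a) I)"
  have "(k \<cdot>\<^sub>m f a) $$ (i, j) = k * f a $$ (i, j)" if "a \<in> I" for a using assms[OF that] ij by auto
  then show "(k \<cdot>\<^sub>m msum r c f I) $$ (i, j) = msum r c (\<lambda>a. k \<cdot>\<^sub>m f a) I $$ (i, j)"
    using ij by (simp add: msum_index sum_distrib_left)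
qed auto

section \<open>Representations\<close>

lemma mult_mat_assoc_dim:
  "dim_col A = dim_row B \<Longrightarrow> dim_col B = dim_row C \<Longrightarrow> A * B * C = A * (B * (C :: complex mat))"
  by (rule assoc_mult_mat[of A "dim_row A" "dim_col A" B "dim_col B" C "dim_col C"]) auto

lemma mult_mat_one_dim:
  "dim_col A = n \<Longrightarrow> A * 1\<^sub>m n = (A :: complex mat)" "dim_row A = n \<Longrightarrow> 1\<^sub>m n * A = A"
  by auto

lemma mult_mat_index_sum:
  "A \<in> carrier_mat p r \<Longrightarrow> B \<in> carrier_mat r q \<Longrightarrow> i < p \<Longrightarrow> j < q \<Longrightarrow>
    (A * B) $$ (i, j) = (\<Sum>a<r. A $$ (i, a) * (B $$ (a, j) :: complex))"
  by (auto simp: scalar_prod_def lessThan_atLeast0)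

lemma smult_smult_mat: "a \<cdot>\<^sub>m (b \<cdot>\<^sub>m A) = (a * b :: complex) \<cdot>\<^sub>m A"
  by (rule eq_matI) auto

lemma one_smult_mat [simp]: "(1 :: complex) \<cdot>\<^sub>m A = A"
  by (rule eq_matI) auto

lemma trace_mat_smult_dim [simp]: "dim_row A = dim_col A \<Longrightarrow> trace_mat (c \<cdot>\<^sub>m A) = c * trace_mat A"
  by (rule trace_mat_smult[of A "dim_row A"]) auto

lemma (in group) inv_mult_cancel [simp]:
  "a \<in> carrier G \<Longrightarrow> b \<in> carrier G \<Longrightarrow> inv a \<otimes> (a \<otimes> b) = b"
  "a \<in> carrier G \<Longrightarrow> b \<in> carrier G \<Longrightarrow> a \<otimes> (inv a \<otimes> b) = b"
  by (simp_all flip: m_assoc)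

lemma mult_unit_vec_index:
  "A \<in> carrier_mat r c \<Longrightarrow> i < r \<Longrightarrow> k < c \<Longrightarrow> (A *\<^sub>v unit_vec c k) $ i = (A $$ (i, k) :: complex)"
  by auto

text \<open>Invertibility of the matrices follows from the values at the identity and on products,
  since the value at the inverse of g is an inverse of the value at g.\<close>

lemma representation_altdef:
  assumes "group G"
  shows "representation G n \<rho> \<longleftrightarrow> (\<forall>g\<in>carrier G. \<rho> g \<in> carrier_mat n n) \<and> \<rho> \<one>\<^bsub>G\<^esub> = 1\<^sub>m n \<and>
    (\<forall>g\<in>carrier G. \<forall>h\<in>carrier G. \<rho> (g \<otimes>\<^bsub>G\<^esub> h) = \<rho> g * \<rho> h)" (is "_ \<longleftrightarrow> ?R")
proof
  interpret group G by fact
  let ?M = "ring_mat TYPE(complex) n ()"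
  interpret M: ring ?M by (rule ring_mat)
  interpret U: group "units_of ?M" by (rule M.units_group)
  {
    assume "representation G n \<rho>"
    then have h: "\<rho> \<in> hom G (units_of ?M)" by (simp add: representation_def)
    then have c: "\<rho> g \<in> carrier_mat n n" if "g \<in> carrier G" for g
      using that by (auto simp: hom_def units_of_def Units_def ring_mat_simps)
    have "\<rho> \<one>\<^bsub>G\<^esub> = \<one>\<^bsub>units_of ?M\<^esub>" using h group_hom.hom_one[OF group_hom.intro, OF is_group U.is_group]
      by (simp add: group_hom_axioms_def)
    then have "\<rho> \<one>\<^bsub>G\<^esub> = 1\<^sub>m n" by (simp add: units_of_def ring_mat_simps)
    moreover have "\<rho> (g \<otimes>\<^bsub>G\<^esub> h) = \<rho> g * \<rho> h" if "g \<in> carrier G" "h \<in> carrier G" for g h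
      using hom_mult[OF h that] by (simp add: units_of_def ring_mat_simps)
    ultimately show ?R using c by blast
  }
  {
    assume R: ?R
    have "\<rho> g \<in> Units ?M" if "g \<in> carrier G" for g
    proof -
      have "\<rho> g * \<rho> (inv\<^bsub>G\<^esub> g) = 1\<^sub>m n" "\<rho> (inv\<^bsub>G\<^esub> g) * \<rho> g = 1\<^sub>m n"
        using R that l_inv[OF that] r_inv[OF that] inv_closed[OF that] by metis+
      then show ?thesis using R that unfolding Units_def by (auto simp: ring_mat_simps)
    qed
    then show "representation G n \<rho>" using R
      by (auto simp: representation_def hom_def units_of_def ring_mat_simps)
  }
qed

lemma subspace_module_vecI:
  assumes "W \<subseteq> carrier_vec n" "0\<^sub>v n \<in> W"
    and "\<And>v w. v \<in> W \<Longrightarrow> w \<in> W \<Longrightarrow> v + w \<in> W" "\<And>c v. v \<in> W \<Longrightarrow> (c::complex) \<cdot>\<^sub>v v \<in> W"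
  shows "VectorSpace.subspace class_ring W (module_vec TYPE(complex) n)"
proof -
  have vs: "vectorspace (class_ring :: complex ring) (module_vec TYPE(complex) n)" by (rule vec_vs)
  then have "submodule (class_ring :: complex ring) W (module_vec TYPE(complex) n)"
    using assms vec_module by (intro submodule.intro) (auto simp: module_vec_simps)
  then show ?thesis using vs by (simp add: VectorSpace.subspace_def)
qed

locale rep = group G for G :: "('a, 'b) monoid_scheme" (structure) +
  fixes n :: nat and \<rho> :: "'a \<Rightarrow> complex mat"
  assumes rep: "representation G n \<rho>" and finite_carrier: "finite (carrier G)"
begin

lemma carrier_rep [simp]: "g \<in> carrier G \<Longrightarrow> \<rho> g \<in> carrier_mat n n"
  and rep_one [simp]: "\<rho> \<one> = 1\<^sub>m n"
  and rep_mult: "g \<in> carrier G \<Longrightarrow> h \<in> carrier G \<Longrightarrow> \<rho> (g \<otimes> h) = \<rho> g * \<rho> h"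
  using rep by (auto simp: representation_altdef[OF is_group])

lemma dim_rep [simp]: "g \<in> carrier G \<Longrightarrow> dim_row (\<rho> g) = n" "g \<in> carrier G \<Longrightarrow> dim_col (\<rho> g) = n"
  using carrier_matD[OF carrier_rep] by auto

lemma rep_mult_vec_carrier [simp]: "g \<in> carrier G \<Longrightarrow> v \<in> carrier_vec n \<Longrightarrow> \<rho> g *\<^sub>v v \<in> carrier_vec n"
  by (rule mult_mat_vec_carrier[OF carrier_rep])

lemma rep_inv [simp]: "g \<in> carrier G \<Longrightarrow> \<rho> g * \<rho> (inv g) = 1\<^sub>m n" "g \<in> carrier G \<Longrightarrow> \<rho> (inv g) * \<rho> g = 1\<^sub>m n"
  using rep_mult[of g "inv g"] rep_mult[of "inv g" g] by auto

lemma rep_pow: "g \<in> carrier G \<Longrightarrow> \<rho> (g [^] k) = \<rho> g ^\<^sub>m k"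
  by (induction k) (auto simp: rep_mult dest: carrier_matD(1)[OF carrier_rep])

lemma rep_pow_order: "g \<in> carrier G \<Longrightarrow> \<rho> g ^\<^sub>m Coset.order G = 1\<^sub>m n"
  using rep_pow[of g "Coset.order G"] pow_order_eq_1[of g] by simp

lemma order_pos: "Coset.order G > 0"
  using finite_carrier by (simp add: order_gt_0_iff_finite)

text \<open>The eigenvalues are roots of unity, whose inverses are their conjugates, and
  \<open>inv g\<close> is a power of \<open>g\<close>.\<close>

lemma trace_inv:
  assumes g: "g \<in> carrier G"
  shows "trace_mat (\<rho> (inv g)) = cnj (trace_mat (\<rho> g))"
proof -
  let ?N = "Coset.order G"
  obtain xs where tr: "\<And>k. trace_mat (\<rho> g ^\<^sub>m k) = (\<Sum>x\<leftarrow>xs. x ^ k)"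
    and e: "\<And>a b x. \<rho> g ^\<^sub>m a = \<rho> g ^\<^sub>m b \<Longrightarrow> x \<in> set xs \<Longrightarrow> x ^ a = x ^ b"
    using matrix_eigenvalue_list[OF carrier_rep[OF g]] by metis
  have "inv g = g [^] (?N - 1)"
    using g order_pos pow_order_eq_1[OF g] by (metis Suc_diff_1 inv_equality nat_pow_Suc nat_pow_closed)
  then have "trace_mat (\<rho> (inv g)) = (\<Sum>x\<leftarrow>xs. x ^ (?N - 1))" using tr rep_pow[OF g] by simp
  also have "\<dots> = (\<Sum>x\<leftarrow>xs. cnj x)"
  proof (rule arg_cong[of _ _ sum_list], rule map_cong[OF refl])
    fix x assume x: "x \<in> set xs"
    have "x ^ ?N = 1" using e[of ?N 0 x] rep_pow_order[OF g] x carrier_rep[OF g] by simp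
    then have "x ^ (?N - 1) * x = 1" and nx: "cmod x = 1"
      using order_pos power_minus_mult[of ?N x] power_eq_1_iff[of x ?N] by auto
    moreover have "cnj x * x = 1" using nx by (simp add: complex_norm_square[symmetric] mult.commute)
    ultimately show "x ^ (?N - 1) = cnj x" by (metis mult_right_cancel mult_zero_right zero_neq_one)
  qed
  also have "\<dots> = cnj (\<Sum>x\<leftarrow>xs. x)" by (induction xs) auto
  also have "(\<Sum>x\<leftarrow>xs. x) = trace_mat (\<rho> g)" using tr[of 1] carrier_rep[OF g] by simp
  finally show ?thesis .
qed

text \<open>Left translation by \<open>g\<close> permutes the terms of the sum. Averages of this
  kind supply the intertwining maps used below.\<close>

lemma average_intertwines:
  assumes r': "representation G n' \<rho>'" and X: "X \<in> carrier_mat n n'" and g: "g \<in> carrier G"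
  shows "\<rho> g * msum n n' (\<lambda>h. \<rho> h * X * \<rho>' (inv h)) (carrier G) =
         msum n n' (\<lambda>h. \<rho> h * X * \<rho>' (inv h)) (carrier G) * \<rho>' g"
proof -
  interpret r': rep G n' \<rho>' by unfold_locales (use r' finite_carrier in auto)
  let ?f = "\<lambda>h. \<rho> h * X * \<rho>' (inv h)"
  have f: "?f h \<in> carrier_mat n n'" if "h \<in> carrier G" for h
    using that X by (intro mult_carrier_mat[of _ n n' _ n'] mult_carrier_mat[of _ n n _ n']) auto
  have "\<rho> g * msum n n' ?f (carrier G) = msum n n' (\<lambda>h. \<rho> g * ?f h) (carrier G)"
    using f g by (intro mult_msum) auto
  also have "\<dots> = msum n n' (\<lambda>h. ?f (g \<otimes> h) * \<rho>' g) (carrier G)"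
  proof (rule msum_cong[OF refl])
    fix h assume h: "h \<in> carrier G"
    have "\<rho>' (inv (g \<otimes> h)) * \<rho>' g = \<rho>' (inv h)"
      using g h by (simp add: inv_mult_group r'.rep_mult assoc_mult_mat[of _ n' n' _ n' _ n'] right_mult_one_mat[of _ n' n'])
    moreover have "?f (g \<otimes> h) * \<rho>' g = \<rho> (g \<otimes> h) * X * (\<rho>' (inv (g \<otimes> h)) * \<rho>' g)"
      using g h X by (intro assoc_mult_mat[of _ n n' _ n' _ n'] mult_carrier_mat[of _ n n _ n']) auto
    moreover have "\<rho> g * ?f h = \<rho> (g \<otimes> h) * X * \<rho>' (inv h)"
      using g h carrier_matD[OF X] by (simp add: rep_mult mult_mat_assoc_dim)
    ultimately show "\<rho> g * ?f h = ?f (g \<otimes> h) * \<rho>' g" by simp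
  qed
  also have "\<dots> = msum n n' (\<lambda>h. ?f h * \<rho>' g) (carrier G)"
  proof (rule msum_reindex[symmetric])
    show "bij_betw (\<lambda>h. g \<otimes> h) (carrier G) (carrier G)"
      using g by (simp add: bij_betw_def inj_on_cmult surj_const_mult)
  qed
  also have "\<dots> = msum n n' ?f (carrier G) * \<rho>' g"
    using f g by (intro msum_mult[symmetric]) auto
  finally show ?thesis .
qed

end

section \<open>Schur's lemma\<close>

locale irrep = group G for G :: "('a, 'b) monoid_scheme" (structure) +
  fixes n :: nat and \<rho> :: "'a \<Rightarrow> complex mat"
  assumes irrep: "irreducible_representation G n \<rho>" and finite_carrier': "finite (carrier G)"
begin

sublocale rep
  by unfold_locales (use irrep finite_carrier' in \<open>auto simp: irreducible_representation_def\<close>)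

lemma dim_pos: "n > 0"
  using irrep by (simp add: irreducible_representation_def)

lemma invariant_subspace:
  assumes "W \<subseteq> carrier_vec n" "0\<^sub>v n \<in> W"
    and "\<And>v w. v \<in> W \<Longrightarrow> w \<in> W \<Longrightarrow> v + w \<in> W" "\<And>c v. v \<in> W \<Longrightarrow> (c::complex) \<cdot>\<^sub>v v \<in> W"
    and "\<And>g w. g \<in> carrier G \<Longrightarrow> w \<in> W \<Longrightarrow> \<rho> g *\<^sub>v w \<in> W"
  shows "W = {0\<^sub>v n} \<or> W = carrier_vec n"
  using irrep subspace_module_vecI[OF assms(1-4)] assms(5) by (auto simp: irreducible_representation_def)

text \<open>An eigenspace of \<open>T\<close> is invariant and not zero, so it is the whole
  space.\<close>

lemma schur_scalar:
  assumes T: "T \<in> carrier_mat n n" and comm: "\<And>g. g \<in> carrier G \<Longrightarrow> \<rho> g * T = T * \<rho> g"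
  obtains c where "T = c \<cdot>\<^sub>m 1\<^sub>m n"
proof -
  have "degree (char_poly T) \<noteq> 0" using degree_monic_char_poly[OF T] dim_pos by simp
  then obtain c where "poly (char_poly T) c = 0"
    using fundamental_theorem_of_algebra[of "char_poly T"] by (auto simp: constant_degree)
  then have "eigenvalue T c" using eigenvalue_root_char_poly[OF T] by blast
  then obtain v where v: "v \<in> carrier_vec n" "v \<noteq> 0\<^sub>v n" "T *\<^sub>v v = c \<cdot>\<^sub>v v"
    using T unfolding eigenvalue_def eigenvector_def by auto
  define W where "W = {w \<in> carrier_vec n. T *\<^sub>v w = c \<cdot>\<^sub>v w}"
  have "W = {0\<^sub>v n} \<or> W = carrier_vec n"
  proof (rule invariant_subspace)
    fix g w assume g: "g \<in> carrier G" and "w \<in> W"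
    then have w: "w \<in> carrier_vec n" "T *\<^sub>v w = c \<cdot>\<^sub>v w" by (auto simp: W_def)
    have "T *\<^sub>v (\<rho> g *\<^sub>v w) = (T * \<rho> g) *\<^sub>v w" using T g w by (simp add: assoc_mult_mat_vec[of _ n n _ n])
    also have "\<dots> = \<rho> g *\<^sub>v (T *\<^sub>v w)" using T g w by (simp add: assoc_mult_mat_vec[of _ n n _ n] flip: comm)
    also have "\<dots> = c \<cdot>\<^sub>v (\<rho> g *\<^sub>v w)" using g w by (simp add: mult_mat_vec[of _ n n])
    finally show "\<rho> g *\<^sub>v w \<in> W" using g w mult_mat_vec_carrier[OF carrier_rep[OF g]] by (auto simp: W_def)
  qed (use T in \<open>auto simp: W_def mult_add_distrib_mat_vec[of _ n n] mult_mat_vec[of _ n n] smult_add_distrib_vec[of _ n] smult_smult_assoc mult.commute\<close>)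
  then have W: "W = carrier_vec n" using v by (auto simp: W_def)
  have "T = c \<cdot>\<^sub>m 1\<^sub>m n"
  proof (rule eq_matI)
    fix i j assume ij: "i < dim_row (c \<cdot>\<^sub>m 1\<^sub>m n)" "j < dim_col (c \<cdot>\<^sub>m 1\<^sub>m n)"
    then have ij': "i < n" "j < n" by auto
    have "unit_vec n j \<in> W" using W by simp
    then have "T *\<^sub>v unit_vec n j = c \<cdot>\<^sub>v unit_vec n j" by (simp add: W_def)
    then have "(T *\<^sub>v unit_vec n j) $ i = (c \<cdot>\<^sub>v unit_vec n j) $ i" by (rule arg_cong)
    moreover have "(T *\<^sub>v unit_vec n j) $ i = T $$ (i, j)" using ij' T by auto
    ultimately show "T $$ (i, j) = (c \<cdot>\<^sub>m 1\<^sub>m n) $$ (i, j)" using ij' by simp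
  qed (use T in auto)
  then show ?thesis by (rule that)
qed

text \<open>The kernel of \<open>T\<close> is a proper invariant subspace and the image is a nonzero
  one, so \<open>T\<close> is bijective.\<close>

lemma schur_invertible:
  assumes "irreducible_representation G n' \<rho>'" and T: "T \<in> carrier_mat n n'"
    and comm: "\<And>g. g \<in> carrier G \<Longrightarrow> \<rho> g * T = T * \<rho>' g" and nz: "T \<noteq> 0\<^sub>m n n'"
  obtains T' where "T' \<in> carrier_mat n' n" "T * T' = 1\<^sub>m n" "T' * T = 1\<^sub>m n'"
proof -
  interpret r': irrep G n' \<rho>' by unfold_locales (use assms finite_carrier in auto)
  obtain i j where ij: "i < n" "j < n'" "T $$ (i, j) \<noteq> 0"
    using nz T by (metis carrier_matD eq_matI index_zero_mat)
  define W where "W = {w \<in> carrier_vec n'. T *\<^sub>v w = 0\<^sub>v n}"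
  have "W = {0\<^sub>v n'} \<or> W = carrier_vec n'"
  proof (rule r'.invariant_subspace)
    fix g w assume g: "g \<in> carrier G" and "w \<in> W"
    then have w: "w \<in> carrier_vec n'" "T *\<^sub>v w = 0\<^sub>v n" by (auto simp: W_def)
    have "T *\<^sub>v (\<rho>' g *\<^sub>v w) = (T * \<rho>' g) *\<^sub>v w" using T g w by (simp add: assoc_mult_mat_vec[of _ n n' _ n'])
    also have "\<dots> = \<rho> g *\<^sub>v (T *\<^sub>v w)" using T g w by (simp add: assoc_mult_mat_vec[of _ n n _ n'] flip: comm)
    also have "\<dots> = 0\<^sub>v n" using w carrier_rep[OF g] by (intro eq_vecI) auto
    finally show "\<rho>' g *\<^sub>v w \<in> W" using g w mult_mat_vec_carrier[OF r'.carrier_rep[OF g]] by (auto simp: W_def)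
  qed (use T in \<open>auto simp: W_def mult_add_distrib_mat_vec[of _ n n'] mult_mat_vec[of _ n n']\<close>)
  moreover have "W \<noteq> carrier_vec n'"
  proof
    assume "W = carrier_vec n'"
    then have "unit_vec n' j \<in> W" by simp
    then have "T *\<^sub>v unit_vec n' j = 0\<^sub>v n" by (simp add: W_def)
    then have "(T *\<^sub>v unit_vec n' j) $ i = 0" using ij by simp
    then show False using ij T by auto
  qed
  ultimately have ker: "W = {0\<^sub>v n'}" by blast
  define V where "V = {T *\<^sub>v w |w. w \<in> carrier_vec n'}"
  have "V = {0\<^sub>v n} \<or> V = carrier_vec n"
  proof (rule invariant_subspace)
    fix g v assume g: "g \<in> carrier G" and "v \<in> V"
    then obtain w where w: "w \<in> carrier_vec n'" "v = T *\<^sub>v w" by (auto simp: V_def)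
    have "\<rho> g *\<^sub>v (T *\<^sub>v w) = (\<rho> g * T) *\<^sub>v w" using T g w by (simp add: assoc_mult_mat_vec[of _ n n _ n'])
    also have "\<dots> = T *\<^sub>v (\<rho>' g *\<^sub>v w)" using T g w by (simp add: assoc_mult_mat_vec[of _ n n' _ n'] comm)
    finally show "\<rho> g *\<^sub>v v \<in> V" using g w unfolding V_def by (auto intro!: exI[of _ "\<rho>' g *\<^sub>v w"])
  next
    show "0\<^sub>v n \<in> V" unfolding V_def using T by (auto intro!: exI[of _ "0\<^sub>v n'"])
  next
    fix v w assume "v \<in> V" "w \<in> V"
    then obtain a b where "v = T *\<^sub>v a" "w = T *\<^sub>v b" "a \<in> carrier_vec n'" "b \<in> carrier_vec n'" by (auto simp: V_def)
    then show "v + w \<in> V" unfolding V_def using T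
      by (auto intro!: exI[of _ "a + b"] simp: mult_add_distrib_mat_vec[of _ n n'])
  next
    fix c v assume "v \<in> V"
    then obtain a where "v = T *\<^sub>v a" "a \<in> carrier_vec n'" by (auto simp: V_def)
    then show "c \<cdot>\<^sub>v v \<in> V" unfolding V_def using T
      by (auto intro!: exI[of _ "c \<cdot>\<^sub>v a"] simp: mult_mat_vec[of _ n n'])
  qed (use T in \<open>auto simp: V_def\<close>)
  moreover have "T *\<^sub>v unit_vec n' j \<in> V"
    unfolding V_def by (intro CollectI exI[of _ "unit_vec n' j"]) simp
  moreover have "T *\<^sub>v unit_vec n' j \<noteq> 0\<^sub>v n"
  proof
    assume "T *\<^sub>v unit_vec n' j = 0\<^sub>v n"
    then have "(T *\<^sub>v unit_vec n' j) $ i = 0" using ij by simp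
    then show False using ij T by auto
  qed
  ultimately have im: "V = carrier_vec n" by blast
  have "\<exists>w. w \<in> carrier_vec n' \<and> T *\<^sub>v w = unit_vec n k" if "k < n" for k
  proof -
    have "unit_vec n k \<in> V" using im by simp
    then show ?thesis unfolding V_def by auto
  qed
  \<comment> \<open>Preimages of the unit vectors become the columns of a right inverse.\<close>
  then obtain w where w: "\<And>k. k < n \<Longrightarrow> w k \<in> carrier_vec n' \<and> T *\<^sub>v w k = unit_vec n k" by metis
  define T' where "T' = Matrix.mat n' n (\<lambda>(i, k). w k $ i)"
  have T': "T' \<in> carrier_mat n' n" by (simp add: T'_def)
  have TT': "T * T' = 1\<^sub>m n"
  proof (rule eq_matI)
    fix i k assume "i < dim_row (1\<^sub>m n :: complex mat)" "k < dim_col (1\<^sub>m n :: complex mat)"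
    then have ik: "i < n" "k < n" by auto
    have "col T' k = w k" using ik w[of k] by (intro eq_vecI) (auto simp: T'_def)
    then have "(T * T') $$ (i, k) = (T *\<^sub>v w k) $ i" using ik T T' by auto
    then show "(T * T') $$ (i, k) = 1\<^sub>m n $$ (i, k)" using ik w[of k] by (simp add: unit_vec_def)
  qed (use T T' in auto)
  have "T' * T = 1\<^sub>m n'"
  proof (rule eq_matI)
    fix i k assume "i < dim_row (1\<^sub>m n' :: complex mat)" "k < dim_col (1\<^sub>m n' :: complex mat)"
    then have ik: "i < n'" "k < n'" by auto
    \<comment> \<open>\<open>T\<close> kills this vector because of \<open>TT'\<close>; since the
      kernel is trivial, the right inverse is also a left inverse.\<close>
    let ?v = "T' *\<^sub>v (T *\<^sub>v unit_vec n' k) - unit_vec n' k"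
    have u: "unit_vec n' k \<in> carrier_vec n'" by simp
    have "T *\<^sub>v (T' *\<^sub>v (T *\<^sub>v unit_vec n' k)) = (T * T') *\<^sub>v (T *\<^sub>v unit_vec n' k)"
      using T T' by (intro assoc_mult_mat_vec[symmetric, of _ n n' _ n]) auto
    also have "\<dots> = T *\<^sub>v unit_vec n' k" using T unfolding TT' by (intro one_mult_mat_vec) auto
    finally have "T *\<^sub>v ?v = 0\<^sub>v n" using T T'
      by (subst mult_minus_distrib_mat_vec[of _ n n']) auto
    then have "?v \<in> W" using T T' by (auto simp: W_def)
    then have "?v = 0\<^sub>v n'" using ker by simp
    then have "?v $ i = 0" using ik by simp
    then have "(T' *\<^sub>v (T *\<^sub>v unit_vec n' k)) $ i = unit_vec n' k $ i" using ik T T' by auto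
    moreover have "T' *\<^sub>v (T *\<^sub>v unit_vec n' k) = (T' * T) *\<^sub>v unit_vec n' k"
      using T T' by (intro assoc_mult_mat_vec[symmetric, of _ n' n _ n']) auto
    moreover have "((T' * T) *\<^sub>v unit_vec n' k) $ i = (T' * T) $$ (i, k)"
      using ik T T' by (intro mult_unit_vec_index[of _ n' n']) auto
    ultimately show "(T' * T) $$ (i, k) = 1\<^sub>m n' $$ (i, k)" using ik by (simp add: unit_vec_def)
  qed (use T T' in auto)
  then show ?thesis using that T' TT' by blast
qed

end

section \<open>Orthogonality of matrix coefficients and Fourier inversion\<close>

definition elem_mat :: "nat \<Rightarrow> nat \<Rightarrow> nat \<Rightarrow> nat \<Rightarrow> complex mat" where
  "elem_mat r c j k = Matrix.mat r c (\<lambda>(a, b). if a = j \<and> b = k then 1 else 0)"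

lemma elem_mat_carrier [simp]: "elem_mat r c j k \<in> carrier_mat r c"
  by (simp add: elem_mat_def)

lemma mult_elem_mat_mult_index:
  assumes "A \<in> carrier_mat p r" "B \<in> carrier_mat c q" "j < r" "k < c" "i < p" "l < q"
  shows "(A * elem_mat r c j k * B) $$ (i, l) = A $$ (i, j) * B $$ (k, l)"
proof -
  have 1: "(A * elem_mat r c j k) $$ (i, b) = (if b = k then A $$ (i, j) else 0)" if "b < c" for b
  proof -
    have "(A * elem_mat r c j k) $$ (i, b) = (\<Sum>a<r. A $$ (i, a) * (if a = j \<and> b = k then 1 else 0))"
      using assms that by (auto simp: elem_mat_def scalar_prod_def lessThan_atLeast0 intro!: sum.cong)
    also have "\<dots> = (\<Sum>a<r. if a = j then (if b = k then A $$ (i, j) else 0) else 0)"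
      by (intro sum.cong) auto
    finally show ?thesis using assms by simp
  qed
  have c: "A * elem_mat r c j k \<in> carrier_mat p c" using assms by (intro mult_carrier_mat[of _ p r]) auto
  have "(A * elem_mat r c j k * B) $$ (i, l) = (\<Sum>b<c. (A * elem_mat r c j k) $$ (i, b) * B $$ (b, l))"
    using assms c by (intro mult_mat_index_sum)
  also have "\<dots> = (\<Sum>b<c. if b = k then A $$ (i, j) * B $$ (k, l) else 0)" using 1 by (intro sum.cong) auto
  finally show ?thesis using assms by simp
qed

context irrep
begin

text \<open>The average is scalar by Schur's lemma, and taking traces determines the scalar.\<close>

lemma average_eq_trace:
  assumes X: "X \<in> carrier_mat n n"
  shows "msum n n (\<lambda>h. \<rho> h * X * \<rho> (inv h)) (carrier G) =
         (of_nat (Coset.order G) * trace_mat X / of_nat n) \<cdot>\<^sub>m 1\<^sub>m n"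
proof -
  let ?f = "\<lambda>h. \<rho> h * X * \<rho> (inv h)"
  have f: "?f h \<in> carrier_mat n n" if "h \<in> carrier G" for h
    using that X by (intro mult_carrier_mat[of _ n n _ n]) auto
  obtain c where c: "msum n n ?f (carrier G) = c \<cdot>\<^sub>m 1\<^sub>m n"
    using schur_scalar[OF _ average_intertwines[OF rep X]] by auto
  have "c * of_nat n = trace_mat (msum n n ?f (carrier G))" unfolding c by simp
  also have "\<dots> = (\<Sum>h\<in>carrier G. trace_mat (?f h))" using f by (rule trace_msum)
  also have "\<dots> = (\<Sum>h\<in>carrier G. trace_mat X)"
    by (intro sum.cong trace_mat_conj[of _ n]) (auto simp: X)
  finally have "c = of_nat (Coset.order G) * trace_mat X / of_nat n"
    using dim_pos by (simp add: field_simps Coset.order_def)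
  then show ?thesis using c by simp
qed

text \<open>The sum is one entry of the average of an elementary matrix.\<close>

lemma matrix_coefficients_orthogonal:
  assumes "i < n" "j < n" "k < n" "l < n"
  shows "(\<Sum>h\<in>carrier G. \<rho> h $$ (i, j) * \<rho> (inv h) $$ (k, l)) =
         (if j = k \<and> i = l then of_nat (Coset.order G) / of_nat n else 0)"
proof -
  let ?X = "elem_mat n n j k"
  have tr: "trace_mat ?X = (if j = k then 1 else 0)"
  proof -
    have "trace_mat ?X = (\<Sum>i<n. if i = j then (if j = k then 1 else 0) else 0)"
      unfolding trace_mat_def by (intro sum.cong) (auto simp: elem_mat_def)
    then show ?thesis using assms by simp
  qed
  have "(\<Sum>h\<in>carrier G. \<rho> h $$ (i, j) * \<rho> (inv h) $$ (k, l)) = (\<Sum>h\<in>carrier G. (\<rho> h * ?X * \<rho> (inv h)) $$ (i, l))"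
    using assms by (intro sum.cong mult_elem_mat_mult_index[symmetric, of _ n n _ n n]) auto
  also have "\<dots> = msum n n (\<lambda>h. \<rho> h * ?X * \<rho> (inv h)) (carrier G) $$ (i, l)" using assms by (simp add: msum_index)
  also have "\<dots> = (if j = k \<and> i = l then of_nat (Coset.order G) / of_nat n else 0)"
    using assms by (subst average_eq_trace) (auto simp: tr)
  finally show ?thesis .
qed

text \<open>Expanding the trace reduces this to the orthogonality relations. Since a matrix can be
  recovered from such traces, \<open>lift\<close> can later turn matrices into elements of the group
  algebra.\<close>

lemma fourier_inversion:
  assumes T: "T \<in> carrier_mat n n"
  shows "msum n n (\<lambda>h. (of_nat n / of_nat (Coset.order G) * trace_mat (T * \<rho> (inv h))) \<cdot>\<^sub>m \<rho> h) (carrier G) = T"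
proof (rule eq_matI)
  fix i j assume "i < dim_row T" "j < dim_col T"
  then have ij: "i < n" "j < n" using T by auto
  let ?c = "of_nat n / of_nat (Coset.order G) :: complex"
  have "msum n n (\<lambda>h. (?c * trace_mat (T * \<rho> (inv h))) \<cdot>\<^sub>m \<rho> h) (carrier G) $$ (i, j) =
     (\<Sum>h\<in>carrier G. ?c * (\<Sum>p<n. \<Sum>q<n. T $$ (p, q) * \<rho> (inv h) $$ (q, p)) * \<rho> h $$ (i, j))"
    using ij T by (simp add: msum_index trace_mat_mult[of _ n n] cong: sum.cong)
  also have "\<dots> = (\<Sum>h\<in>carrier G. \<Sum>p<n. \<Sum>q<n. ?c * T $$ (p, q) * (\<rho> h $$ (i, j) * \<rho> (inv h) $$ (q, p)))"
    by (simp add: sum_distrib_left sum_distrib_right mult_ac)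
  also have "\<dots> = (\<Sum>p<n. \<Sum>h\<in>carrier G. \<Sum>q<n. ?c * T $$ (p, q) * (\<rho> h $$ (i, j) * \<rho> (inv h) $$ (q, p)))"
    by (rule sum.swap)
  also have "\<dots> = (\<Sum>p<n. \<Sum>q<n. \<Sum>h\<in>carrier G. ?c * T $$ (p, q) * (\<rho> h $$ (i, j) * \<rho> (inv h) $$ (q, p)))"
    by (intro sum.cong refl sum.swap)
  also have "\<dots> = (\<Sum>p<n. \<Sum>q<n. ?c * T $$ (p, q) * (if j = q \<and> i = p then of_nat (Coset.order G) / of_nat n else 0))"
    unfolding sum_distrib_left[symmetric]
    using ij by (intro sum.cong refl arg_cong2[of _ _ _ _ "(*)"] matrix_coefficients_orthogonal) auto
  also have "\<dots> = (\<Sum>p<n. \<Sum>q<n. if q = j then (if i = p then T $$ (p, q) else 0) else 0)"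
    using dim_pos order_pos by (intro sum.cong) auto
  also have "\<dots> = (\<Sum>p<n. if p = i then T $$ (i, j) else 0)"
    using ij by (intro sum.cong) (auto simp: sum.delta)
  also have "\<dots> = T $$ (i, j)" using ij by simp
  finally show "msum n n (\<lambda>h. (?c * trace_mat (T * \<rho> (inv h))) \<cdot>\<^sub>m \<rho> h) (carrier G) $$ (i, j) = T $$ (i, j)" .
qed (use T in auto)

text \<open>Fourier inversion of the identity matrix, after taking traces.\<close>

lemma trace_norm: "(\<Sum>h\<in>carrier G. trace_mat (\<rho> h) * trace_mat (\<rho> (inv h))) = of_nat (Coset.order G)"
proof -
  let ?c = "of_nat n / of_nat (Coset.order G) :: complex"
  have "of_nat n = trace_mat (msum n n (\<lambda>h. (?c * trace_mat (1\<^sub>m n * \<rho> (inv h))) \<cdot>\<^sub>m \<rho> h) (carrier G))"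
    by (subst fourier_inversion) auto
  also have "\<dots> = (\<Sum>h\<in>carrier G. trace_mat ((?c * trace_mat (1\<^sub>m n * \<rho> (inv h))) \<cdot>\<^sub>m \<rho> h))"
    by (rule trace_msum) auto
  also have "\<dots> = (\<Sum>h\<in>carrier G. ?c * (trace_mat (\<rho> h) * trace_mat (\<rho> (inv h))))"
    by (intro sum.cong refl) (simp add: left_mult_one_mat[of _ n n])
  finally have "of_nat n = ?c * (\<Sum>h\<in>carrier G. trace_mat (\<rho> h) * trace_mat (\<rho> (inv h)))"
    by (simp only: sum_distrib_left)
  then show ?thesis using dim_pos order_pos by (simp add: field_simps)
qed

text \<open>The sum of products of traces equals the sum over i and k of the (i, k) entry of the
  average of the elementary matrix with index (i, k). If it is not zero, one of these averages is a
  nonzero intertwining map, and Schur's lemma inverts it.\<close>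

lemma intertwiner_exists:
  assumes r': "irreducible_representation G n' \<rho>'"
    and nz: "(\<Sum>h\<in>carrier G. trace_mat (\<rho> h) * trace_mat (\<rho>' (inv h))) \<noteq> 0"
  shows "n = n' \<and> (\<exists>T\<in>carrier_mat n n. \<exists>T'\<in>carrier_mat n n. T * T' = 1\<^sub>m n \<and> T' * T = 1\<^sub>m n \<and>
    (\<forall>g\<in>carrier G. \<rho> g * T = T * \<rho>' g))"
proof -
  interpret r': irrep G n' \<rho>' by unfold_locales (use r' finite_carrier in auto)
  let ?A = "\<lambda>X. msum n n' (\<lambda>h. \<rho> h * X * \<rho>' (inv h)) (carrier G)"
  have "\<exists>i<n. \<exists>k<n'. ?A (elem_mat n n' i k) \<noteq> 0\<^sub>m n n'"
  proof (rule ccontr)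
    assume "\<not> ?thesis"
    then have z: "?A (elem_mat n n' i k) $$ (i, k) = 0" if "i < n" "k < n'" for i k using that by simp
    have "(\<Sum>h\<in>carrier G. trace_mat (\<rho> h) * trace_mat (\<rho>' (inv h)))
        = (\<Sum>h\<in>carrier G. \<Sum>i<n. \<Sum>k<n'. \<rho> h $$ (i, i) * \<rho>' (inv h) $$ (k, k))"
      by (intro sum.cong refl) (auto simp: trace_mat_def sum_product dest: carrier_matD[OF carrier_rep] carrier_matD[OF r'.carrier_rep])
    also have "\<dots> = (\<Sum>i<n. \<Sum>h\<in>carrier G. \<Sum>k<n'. \<rho> h $$ (i, i) * \<rho>' (inv h) $$ (k, k))" by (rule sum.swap)
    also have "\<dots> = (\<Sum>i<n. \<Sum>k<n'. \<Sum>h\<in>carrier G. \<rho> h $$ (i, i) * \<rho>' (inv h) $$ (k, k))"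
      by (intro sum.cong refl sum.swap)
    also have "\<dots> = (\<Sum>i<n. \<Sum>k<n'. ?A (elem_mat n n' i k) $$ (i, k))"
    proof (intro sum.cong refl)
      fix i k assume ik: "i \<in> {..<n}" "k \<in> {..<n'}"
      have "?A (elem_mat n n' i k) $$ (i, k) = (\<Sum>h\<in>carrier G. (\<rho> h * elem_mat n n' i k * \<rho>' (inv h)) $$ (i, k))"
        using ik by (simp add: msum_index)
      also have "\<dots> = (\<Sum>h\<in>carrier G. \<rho> h $$ (i, i) * \<rho>' (inv h) $$ (k, k))"
        using ik by (intro sum.cong mult_elem_mat_mult_index[of _ n n _ n' n']) auto
      finally show "(\<Sum>h\<in>carrier G. \<rho> h $$ (i, i) * \<rho>' (inv h) $$ (k, k)) = ?A (elem_mat n n' i k) $$ (i, k)" ..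
    qed
    also have "\<dots> = 0" using z by simp
    finally show False using nz by simp
  qed
  then obtain i k where "?A (elem_mat n n' i k) \<noteq> 0\<^sub>m n n'" by blast
  then obtain X where X: "X \<in> carrier_mat n n'" "?A X \<noteq> 0\<^sub>m n n'" using elem_mat_carrier by blast
  obtain T' where T': "T' \<in> carrier_mat n' n" "?A X * T' = 1\<^sub>m n" "T' * ?A X = 1\<^sub>m n'"
    using schur_invertible[OF r' _ average_intertwines[OF r'.rep X(1)] X(2)] by auto
  have "trace_mat (?A X * T') = trace_mat (T' * ?A X)" using T' by (intro trace_mat_comm) auto
  then have nn: "n = n'" using T' by simp
  show ?thesis
    using nn T' average_intertwines[OF r'.rep X(1)] by (intro conjI bexI[of _ "?A X"] bexI[of _ T'] ballI) auto
qed

end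

section \<open>Orthonormality of irreducible characters\<close>

lemma IrrE:
  assumes "\<chi> \<in> Irr G"
  obtains n \<rho> where "irreducible_representation G n \<rho>" "\<chi> = restrict (\<lambda>g. trace_mat (\<rho> g)) (carrier G)"
  using assms by (auto simp: Irr_def)

text \<open>A nonzero inner product produces an isomorphism, and isomorphic representations have the
  same character; so distinct characters are orthogonal.\<close>

lemma Irr_orthonormal:
  assumes "group G" "finite (carrier G)" "\<chi> \<in> Irr G" "\<xi> \<in> Irr G"
  shows "char_inner G \<chi> \<xi> = (if \<chi> = \<xi> then 1 else 0)"
proof -
  interpret group G by fact
  obtain n \<rho> where r: "irreducible_representation G n \<rho>" "\<chi> = restrict (\<lambda>g. trace_mat (\<rho> g)) (carrier G)"
    using assms(3) by (rule IrrE)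
  obtain n' \<rho>' where r': "irreducible_representation G n' \<rho>'" "\<xi> = restrict (\<lambda>g. trace_mat (\<rho>' g)) (carrier G)"
    using assms(4) by (rule IrrE)
  interpret r: irrep G n \<rho> by unfold_locales (use r assms in auto)
  interpret r': irrep G n' \<rho>' by unfold_locales (use r' assms in auto)
  have e: "char_inner G \<chi> \<xi> = (\<Sum>g\<in>carrier G. trace_mat (\<rho> g) * trace_mat (\<rho>' (inv\<^bsub>G\<^esub> g))) / of_nat (Coset.order G)"
    unfolding char_inner_def by (intro arg_cong2[of _ _ _ _ "(/)"] sum.cong) (auto simp: r r' r'.trace_inv)
  have eq: "char_inner G \<chi> \<chi> = 1"
  proof -
    have "char_inner G \<chi> \<chi> = (\<Sum>g\<in>carrier G. trace_mat (\<rho> g) * trace_mat (\<rho> (inv\<^bsub>G\<^esub> g))) / of_nat (Coset.order G)"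
      unfolding char_inner_def by (intro arg_cong2[of _ _ _ _ "(/)"] sum.cong) (auto simp: r r.trace_inv)
    then show ?thesis using r.trace_norm r.order_pos by simp
  qed
  show ?thesis
  proof (cases "(\<Sum>g\<in>carrier G. trace_mat (\<rho> g) * trace_mat (\<rho>' (inv\<^bsub>G\<^esub> g))) = 0")
    case True
    then show ?thesis using e eq by auto
  next
    case False
    obtain T T' where T: "n = n'" "T \<in> carrier_mat n n" "T' \<in> carrier_mat n n"
      "T * T' = 1\<^sub>m n" "T' * T = 1\<^sub>m n" "\<And>g. g \<in> carrier G \<Longrightarrow> \<rho> g * T = T * \<rho>' g"
      using r.intertwiner_exists[OF r'(1) False] by blast
    have "trace_mat (\<rho> g) = trace_mat (\<rho>' g)" if g: "g \<in> carrier G" for g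
    proof -
      have c: "\<rho> g \<in> carrier_mat n n" "\<rho>' g \<in> carrier_mat n n" using g T(1) by auto
      have "trace_mat (\<rho>' g) = trace_mat (T * \<rho>' g * T')" using T c by (intro trace_mat_conj[symmetric]) auto
      also have "T * \<rho>' g * T' = \<rho> g * (T * T')" 
        using T(2-5) c g by (simp add: mult_mat_assoc_dim flip: T(6))
      also have "\<dots> = \<rho> g" using T c by (simp add: right_mult_one_mat[of _ n n])
      finally show ?thesis ..
    qed
    then have "\<chi> = \<xi>" by (auto simp: r(2) r'(2) intro!: ext)
    then show ?thesis using eq by simp
  qed
qed

lemma representation_kron:
  assumes "group G" "representation G n \<rho>" "representation G k \<rho>'"
  shows "representation G (n * k) (\<lambda>g. kron (\<rho> g) (\<rho>' g))"
  using assms(2,3) unfolding representation_altdef[OF assms(1)]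
  by (auto simp: kron_one kron_mult[of _ n _ _ k])

lemma map_mat_cnj_mult:
  assumes "A \<in> carrier_mat n k" "B \<in> carrier_mat k m"
  shows "map_mat cnj (A * B) = map_mat cnj A * map_mat cnj B"
  by (rule eq_matI) (use assms in \<open>auto simp: scalar_prod_def\<close>)

lemma representation_cnj:
  assumes "group G" "representation G n \<rho>"
  shows "representation G n (\<lambda>g. map_mat cnj (\<rho> g))"
proof -
  have "map_mat cnj (1\<^sub>m n) = 1\<^sub>m n" by (rule eq_matI) auto
  then show ?thesis using assms(2) unfolding representation_altdef[OF assms(1)]
    by (auto simp: map_mat_cnj_mult[of _ n n _ n])
qed

lemma trace_map_mat_cnj: "A \<in> carrier_mat n n \<Longrightarrow> trace_mat (map_mat cnj A) = cnj (trace_mat A)"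
  by (simp add: trace_mat_def)

section \<open>Averages over subgroups\<close>

context rep
begin

text \<open>For a subgroup \<open>L\<close> this is the projection onto the vectors fixed by
  \<open>L\<close>.\<close>

definition mean :: "'a set \<Rightarrow> complex mat" where
  "mean L = (1 / of_nat (card L)) \<cdot>\<^sub>m msum n n \<rho> L"

lemma mean_carrier [simp]: "mean L \<in> carrier_mat n n" "dim_row (mean L) = n" "dim_col (mean L) = n"
  by (simp_all add: mean_def)

lemma mult_mean:
  assumes L: "subgroup L G" and l: "l \<in> L"
  shows "\<rho> l * mean L = mean L"
proof -
  have LG: "x \<in> carrier G" if "x \<in> L" for x using that subgroup.subset[OF L] by blast
  have "\<rho> l * msum n n \<rho> L = msum n n (\<lambda>x. \<rho> l * \<rho> x) L"
    using LG l by (intro mult_msum) auto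
  also have "\<dots> = msum n n (\<lambda>x. \<rho> (l \<otimes> x)) L" using LG l by (intro msum_cong) (auto simp: rep_mult)
  also have "\<dots> = msum n n \<rho> L"
  proof (rule msum_reindex[symmetric])
    show "bij_betw (\<lambda>x. l \<otimes> x) L L"
      using L l LG by (intro bij_betw_byWitness[of _ "\<lambda>x. inv l \<otimes> x"])
        (auto simp: subgroup.m_closed subgroup.m_inv_closed)
  qed
  finally show ?thesis using l LG unfolding mean_def
    by (subst mult_smult_distrib[of _ n n _ n]) auto
qed

lemma mean_idempotent:
  assumes L: "subgroup L G"
  shows "mean L * mean L = mean L"
proof -
  have LG: "x \<in> carrier G" if "x \<in> L" for x using that subgroup.subset[OF L] by blast
  have fin: "card L > 0" using finite_subset[OF subgroup.subset[OF L] finite_carrier] subgroup.one_closed[OF L]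
    by (auto simp: card_gt_0_iff)
  have "mean L * mean L = (1 / of_nat (card L)) \<cdot>\<^sub>m (msum n n \<rho> L * mean L)"
    unfolding mean_def[of L] by (subst mult_smult_assoc_mat[of _ n n _ n]) (auto simp flip: mean_def)
  also have "msum n n \<rho> L * mean L = msum n n (\<lambda>x. \<rho> x * mean L) L"
    using LG by (intro msum_mult) auto
  also have "\<dots> = msum n n (\<lambda>x. (1::complex) \<cdot>\<^sub>m mean L) L" using mult_mean[OF L] by (intro msum_cong) auto
  also have "\<dots> = (\<Sum>x\<in>L. 1) \<cdot>\<^sub>m mean L" by (rule msum_smult_const) simp
  finally show ?thesis using fin by (simp add: smult_smult_mat)
qed

lemma trace_mean_mult:
  assumes L: "subgroup L G" and g: "g \<in> carrier G"
  shows "trace_mat (mean L * \<rho> g) = (\<Sum>l\<in>L. trace_mat (\<rho> (l \<otimes> g))) / of_nat (card L)"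
proof -
  have LG: "x \<in> carrier G" if "x \<in> L" for x using that subgroup.subset[OF L] by blast
  have "mean L * \<rho> g = (1 / of_nat (card L)) \<cdot>\<^sub>m (msum n n \<rho> L * \<rho> g)"
    unfolding mean_def using g by (intro mult_smult_assoc_mat) auto
  also have "msum n n \<rho> L * \<rho> g = msum n n (\<lambda>l. \<rho> l * \<rho> g) L" using LG g by (intro msum_mult) auto
  also have "\<dots> = msum n n (\<lambda>l. \<rho> (l \<otimes> g)) L" using LG g by (intro msum_cong) (auto simp: rep_mult)
  finally have "trace_mat (mean L * \<rho> g) = 1 / of_nat (card L) * trace_mat (msum n n (\<lambda>l. \<rho> (l \<otimes> g)) L)"
    by simp
  then show ?thesis using LG g by (subst (asm) trace_msum) auto
qed

text \<open>The multiplicity of the trivial character is the trace of an idempotent.\<close>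

lemma mean_trace_nat:
  obtains r :: nat where "(\<Sum>g\<in>carrier G. trace_mat (\<rho> g)) / of_nat (Coset.order G) = of_nat r"
proof -
  obtain r where "trace_mat (mean (carrier G)) = of_nat r"
    using trace_idempotent_mat_nat[OF mean_carrier(1) mean_idempotent[OF subgroup_self]] .
  moreover have "mean (carrier G) * \<rho> \<one> = mean (carrier G)" by (simp add: right_mult_one_mat[of _ n n])
  ultimately have "(\<Sum>g\<in>carrier G. trace_mat (\<rho> g)) / of_nat (Coset.order G) = of_nat r"
    using trace_mean_mult[OF subgroup_self one_closed] by (simp add: Coset.order_def)
  then show ?thesis by (rule that)
qed

lemma mean_commutes:
  assumes L: "L \<lhd> G" and g: "g \<in> carrier G"
  shows "\<rho> g * mean L = mean L * \<rho> g"
proof -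
  interpret L: normal L G by fact
  have LG: "x \<in> carrier G" if "x \<in> L" for x using that L.subset by blast
  have "\<rho> g * msum n n \<rho> L = msum n n (\<lambda>x. \<rho> g * \<rho> x) L" using LG g by (intro mult_msum) auto
  also have "\<dots> = msum n n (\<lambda>x. \<rho> (g \<otimes> x \<otimes> inv g) * \<rho> g) L"
    using LG g by (intro msum_cong) (auto simp: m_assoc simp flip: rep_mult)
  also have "\<dots> = msum n n (\<lambda>x. \<rho> x * \<rho> g) L"
  proof (rule msum_reindex[symmetric])
    show "bij_betw (\<lambda>x. g \<otimes> x \<otimes> inv g) L L"
      using g LG by (intro bij_betw_byWitness[of _ "\<lambda>x. inv g \<otimes> x \<otimes> g"])
        (auto simp: L.inv_op_closed1 L.inv_op_closed2, auto simp: m_assoc)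
  qed
  also have "\<dots> = msum n n \<rho> L * \<rho> g" using LG g by (intro msum_mult[symmetric]) auto
  finally show ?thesis unfolding mean_def using g
    by (simp add: mult_smult_assoc_mat[of _ n n _ n] mult_smult_distrib[of _ n n _ n])
qed

text \<open>The coset average is the trace of \<open>mean L * \<rho> g\<close>. This matrix vanishes
  on a complement of the vectors fixed by \<open>L\<close> and has order dividing \<open>m\<close>
  on them, so its nonzero eigenvalues are \<open>m\<close>-th roots of unity. The point is that the
  sum stays integral after division by |L|.\<close>

lemma coset_mean_in_int_adj:
  assumes L: "L \<lhd> G" and g: "g \<in> carrier G" and gm: "g [^] (m::nat) \<in> L" and m: "m > 0"
  shows "(\<Sum>l\<in>L. trace_mat (\<rho> (l \<otimes> g))) / of_nat (card L) \<in> int_adj (cis (2 * pi / real m))"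
proof -
  interpret L: normal L G by fact
  define B where "B = mean L * \<rho> g"
  have B: "B \<in> carrier_mat n n" unfolding B_def using g by (intro mult_carrier_mat) auto
  have pw: "B ^\<^sub>m Suc k = mean L * \<rho> (g [^] Suc k)" for k
  proof (induction k)
    case 0 show ?case using B g by (simp add: B_def)
  next
    case (Suc k)
    have c: "\<rho> (g [^] Suc k) \<in> carrier_mat n n" "\<rho> g \<in> carrier_mat n n" using g by auto
    have "B ^\<^sub>m Suc (Suc k) = mean L * \<rho> (g [^] Suc k) * (mean L * \<rho> g)" using Suc B_def by simp
    also have "\<dots> = mean L * (\<rho> (g [^] Suc k) * mean L) * \<rho> g"
      using g by (simp add: mult_mat_assoc_dim)
    also have "\<dots> = mean L * mean L * (\<rho> (g [^] Suc k) * \<rho> g)"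
      unfolding mean_commutes[OF L nat_pow_closed[OF g]]
      using g by (simp add: mult_mat_assoc_dim)
    also have "\<dots> = mean L * \<rho> (g [^] Suc (Suc k))"
      unfolding mean_idempotent[OF L.subgroup_axioms] using g by (simp add: rep_mult)
    finally show ?case .
  qed
  have "B ^\<^sub>m Suc m = mean L * \<rho> (g [^] m \<otimes> g)" using pw by simp
  also have "\<dots> = \<rho> (g [^] m) * mean L * \<rho> g"
    using g by (simp add: rep_mult mean_commutes[OF L] mult_mat_assoc_dim)
  also have "\<dots> = B" unfolding mult_mean[OF L.subgroup_axioms gm] B_def ..
  \<comment> \<open>In place of a relation between a power of \<open>B\<close> and the identity:
    \<open>B\<close> may be singular, and this relation admits the eigenvalue 0.\<close>
  finally have Bm: "B ^\<^sub>m Suc m = B ^\<^sub>m 1" using B by simp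
  obtain xs where tr: "\<And>k. trace_mat (B ^\<^sub>m k) = (\<Sum>x\<leftarrow>xs. x ^ k)"
    and e: "\<And>a b x. B ^\<^sub>m a = B ^\<^sub>m b \<Longrightarrow> x \<in> set xs \<Longrightarrow> x ^ a = x ^ b"
    using matrix_eigenvalue_list[OF B] by metis
  have "x \<in> int_adj (cis (2 * pi / real m))" if "x \<in> set xs" for x
  proof -
    have "x ^ m * x = x" using e[OF Bm that] by (simp add: mult.commute)
    then show ?thesis using root_of_unity_in_int_adj[OF _ m, of x] by (cases "x = 0") auto
  qed
  moreover have "trace_mat B = sum_list xs" using tr[of 1] B by simp
  ultimately show ?thesis using trace_mean_mult[OF L.subgroup_axioms g] unfolding B_def by auto
qed

end

section \<open>Parity of multiplicities\<close>

lemma (in group) sum_rcoset: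
  assumes "L \<subseteq> carrier G" "r \<in> carrier G"
  shows "sum f (L #> r) = (\<Sum>l\<in>L. f (l \<otimes> r))"
proof -
  have "L #> r = (\<lambda>l. l \<otimes> r) ` L" by (auto simp: r_coset_def)
  moreover have "inj_on (\<lambda>l. l \<otimes> r) L" by (rule inj_on_subset[OF inj_on_multc[OF assms(2)] assms(1)])
  ultimately show ?thesis by (simp add: sum.reindex)
qed

lemma (in group) sum_rcosets:
  assumes "subgroup L G" "finite (carrier G)"
  shows "sum f (carrier G) = (\<Sum>C\<in>rcosets L. sum f C)"
proof -
  have fin: "\<forall>A\<in>rcosets L. finite A"
  proof
    fix A assume "A \<in> rcosets L"
    then have "A \<subseteq> carrier G" using rcosets_part_G[OF assms(1)] by (metis Sup_upper)
    then show "finite A" using assms(2) by (rule finite_subset)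
  qed
  have disj: "\<forall>A\<in>rcosets L. \<forall>B\<in>rcosets L. A \<noteq> B \<longrightarrow> A \<inter> B = {}"
    using rcos_disjoint[OF assms(1)] unfolding pairwise_def disjnt_def .
  have "sum f (\<Union>(rcosets L)) = (\<Sum>C\<in>rcosets L. sum f C)"
    using sum.Union_disjoint[OF fin disj, of f] unfolding comp_apply .
  then show ?thesis using rcosets_part_G[OF assms(1)] by simp
qed

lemma (in group) card_rcosets_pos:
  assumes "subgroup L G" "finite (carrier G)"
  shows "card L > 0" "card (rcosets L) * card L = Coset.order G"
proof -
  have "finite L" using assms subgroup.subset finite_subset by metis
  then show "card L > 0" using subgroup.one_closed[OF assms(1)] by (auto simp: card_gt_0_iff)
  show "card (rcosets L) * card L = Coset.order G" using lagrange[OF assms(1)] .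
qed

text \<open>The inner product is a natural number, being the multiplicity of the trivial character
  in a Kronecker product. Its difference from (\<xi>, \<xi>') is an average involving the trace of
  \<Psi> minus 1, and |G:L| times this difference is twice a sum of elements of \<int>[\<zeta>], one
  for each coset. Half of it is rational and therefore an integer, and |G:L| is odd.\<close>

lemma (in group) char_inner_mult_parity:
  assumes fin: "finite (carrier G)" and L: "L \<lhd> G" and \<Psi>: "representation G n \<Psi>"
    and \<xi>: "\<xi> \<in> Irr G" and \<xi>': "\<xi>' \<in> Irr G"
    and m: "m > 0" "\<And>h. h \<in> carrier G \<Longrightarrow> h [^] (m::nat) \<in> L"
    and odd: "odd (card (rcosets L))" and \<Psi>L: "\<And>l. l \<in> L \<Longrightarrow> \<Psi> l = 1\<^sub>m n"
    and mod2: "\<And>h. h \<in> carrier G \<Longrightarrow> \<exists>y\<in>int_adj (cis (2 * pi / real m)). trace_mat (\<Psi> h) = 1 + 2 * y"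
  obtains k :: nat where
    "char_inner G (restrict (\<lambda>h. trace_mat (\<Psi> h) * \<xi> h) (carrier G)) \<xi>' = of_nat k"
    and "odd k \<longleftrightarrow> \<xi> = \<xi>'"
proof -
  interpret L: normal L G by fact
  interpret P: rep G n \<Psi> by unfold_locales fact+
  obtain d \<rho> where r: "irreducible_representation G d \<rho>" "\<xi> = restrict (\<lambda>g. trace_mat (\<rho> g)) (carrier G)"
    using \<xi> by (rule IrrE)
  obtain d' \<rho>' where r': "irreducible_representation G d' \<rho>'" "\<xi>' = restrict (\<lambda>g. trace_mat (\<rho>' g)) (carrier G)"
    using \<xi>' by (rule IrrE)
  interpret r: irrep G d \<rho> by unfold_locales (use r fin in auto)
  interpret r': irrep G d' \<rho>' by unfold_locales (use r' fin in auto)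
  let ?R = "\<lambda>h. kron (\<rho> h) (map_mat cnj (\<rho>' h))"
  let ?Q = "\<lambda>h. kron (\<Psi> h) (?R h)"
  have R: "representation G (d * d') ?R"
    by (intro representation_kron representation_cnj is_group r.rep r'.rep)
  interpret R: rep G "d * d'" ?R by unfold_locales (use R fin in auto)
  interpret Q: rep G "n * (d * d')" ?Q
    by unfold_locales (use fin representation_kron[OF is_group \<Psi> R] in auto)
  have trR: "trace_mat (?R h) = \<xi> h * cnj (\<xi>' h)" if "h \<in> carrier G" for h
    using that trace_kron[of "\<rho> h" d "map_mat cnj (\<rho>' h)" d'] by (simp add: r(2) r'(2) trace_map_mat_cnj[of _ d'])
  have trQ: "trace_mat (?Q h) = trace_mat (\<Psi> h) * (\<xi> h * cnj (\<xi>' h))" if "h \<in> carrier G" for h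
    using that trace_kron[of "\<Psi> h" n "?R h" "d * d'"] trR by simp
  let ?A = "char_inner G (restrict (\<lambda>h. trace_mat (\<Psi> h) * \<xi> h) (carrier G)) \<xi>'"
  have "(\<Sum>h\<in>carrier G. trace_mat (?Q h)) = (\<Sum>h\<in>carrier G. restrict (\<lambda>h. trace_mat (\<Psi> h) * \<xi> h) (carrier G) h * cnj (\<xi>' h))"
    by (intro sum.cong refl) (simp add: trQ)
  then have A: "?A = (\<Sum>h\<in>carrier G. trace_mat (?Q h)) / of_nat (Coset.order G)" unfolding char_inner_def by simp
  obtain k :: nat where "(\<Sum>h\<in>carrier G. trace_mat (?Q h)) / of_nat (Coset.order G) = of_nat k"
    by (rule Q.mean_trace_nat)
  then have k: "?A = of_nat k" using A by simp
  define \<delta> :: complex where "\<delta> = (if \<xi> = \<xi>' then 1 else 0)"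
  have \<delta>: "char_inner G \<xi> \<xi>' = \<delta>" using Irr_orthonormal[OF is_group fin \<xi> \<xi>'] by (simp add: \<delta>_def)
  let ?Z = "int_adj (cis (2 * pi / real m))"
  define q where "q = card (rcosets L)"
  have N: "of_nat (Coset.order G) = (of_nat q * of_nat (card L) :: complex)" and Lpos: "card L > 0"
    using card_rcosets_pos[OF L.subgroup_axioms fin] by (simp_all add: q_def flip: of_nat_mult)
  define f where "f h = (trace_mat (\<Psi> h) - 1) * (\<xi> h * cnj (\<xi>' h))" for h
  have "(\<Sum>h\<in>carrier G. f h) = (\<Sum>h\<in>carrier G. restrict (\<lambda>h. trace_mat (\<Psi> h) * \<xi> h) (carrier G) h * cnj (\<xi>' h))
      - (\<Sum>h\<in>carrier G. \<xi> h * cnj (\<xi>' h))"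
    unfolding sum_subtractf[symmetric] by (intro sum.cong refl) (simp add: f_def algebra_simps)
  also have "\<dots> = of_nat (Coset.order G) * (of_nat k - \<delta>)"
    using k \<delta> r.order_pos unfolding char_inner_def by (simp add: field_simps)
  finally have total: "(\<Sum>h\<in>carrier G. f h) / of_nat (card L) = of_nat q * (of_nat k - \<delta>)"
    using Lpos by (simp add: N)
  have coset: "\<exists>y\<in>?Z. sum f C / of_nat (card L) = 2 * y" if C: "C \<in> rcosets L" for C
  proof -
    obtain h where h: "h \<in> carrier G" "C = L #> h" using C by (auto simp: RCOSETS_def)
    have "sum f C = (\<Sum>l\<in>L. f (l \<otimes> h))" unfolding h(2) by (rule sum_rcoset[OF L.subset h(1)])
    \<comment> \<open>\<Psi> is trivial on \<open>L\<close>, so its factor is constant on the coset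
      and only the product of \<xi> with the conjugate of \<xi>' is averaged.\<close>
    also have "\<dots> = (\<Sum>l\<in>L. (trace_mat (\<Psi> h) - 1) * trace_mat (?R (l \<otimes> h)))"
    proof (rule sum.cong[OF refl])
      fix l assume l: "l \<in> L"
      then have lG: "l \<in> carrier G" using L.subset by blast
      have "\<Psi> (l \<otimes> h) = \<Psi> h" using P.rep_mult[OF lG h(1)] \<Psi>L[OF l] h(1) by simp
      then show "f (l \<otimes> h) = (trace_mat (\<Psi> h) - 1) * trace_mat (?R (l \<otimes> h))"
        using trR[of "l \<otimes> h"] lG h(1) by (simp add: f_def)
    qed
    finally have e: "sum f C / of_nat (card L) = (trace_mat (\<Psi> h) - 1) * ((\<Sum>l\<in>L. trace_mat (?R (l \<otimes> h))) / of_nat (card L))"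
      by (simp add: sum_distrib_left)
    obtain y where y: "y \<in> ?Z" "trace_mat (\<Psi> h) = 1 + 2 * y" using mod2[OF h(1)] by blast
    have z: "(\<Sum>l\<in>L. trace_mat (?R (l \<otimes> h))) / of_nat (card L) \<in> ?Z"
      by (rule R.coset_mean_in_int_adj[OF L h(1) m(2)[OF h(1)] m(1)])
    show ?thesis unfolding e y(2) using y(1) z
      by (intro bexI[of _ "y * ((\<Sum>l\<in>L. trace_mat (?R (l \<otimes> h))) / of_nat (card L))"] int_adj_mult) auto
  qed
  define y where "y C = sum f C / of_nat (card L) / 2" for C
  have y: "y C \<in> ?Z" "sum f C / of_nat (card L) = 2 * y C" if "C \<in> rcosets L" for C
  proof -
    from coset[OF that] obtain v where "v \<in> ?Z" "sum f C / of_nat (card L) = 2 * v" by blast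
    then show "y C \<in> ?Z" "sum f C / of_nat (card L) = 2 * y C" unfolding y_def by simp_all
  qed
  have "(\<Sum>h\<in>carrier G. f h) / of_nat (card L) = (\<Sum>C\<in>rcosets L. sum f C / of_nat (card L))"
    unfolding sum_rcosets[OF L.subgroup_axioms fin, of f] by (rule sum_divide_distrib)
  also have "\<dots> = 2 * (\<Sum>C\<in>rcosets L. y C)" using y(2) by (simp add: sum_distrib_left)
  finally have e2: "of_nat q * (of_nat k - \<delta>) = 2 * (\<Sum>C\<in>rcosets L. y C)" using total by simp
  define Y where "Y = (\<Sum>C\<in>rcosets L. y C)"
  define D where "D = (if \<xi> = \<xi>' then 1 else 0 :: int)"
  have "Y \<in> ?Z" unfolding Y_def using y(1) by (rule int_adj_sum)
  moreover have Y: "Y = of_int (int q * (int k - D)) / of_int 2"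
    using e2 unfolding Y_def[symmetric] \<delta>_def D_def by (auto simp: field_simps)
  have "Y \<in> \<rat>" unfolding Y by (intro Rats_divide Rats_of_int)
  ultimately have "Y \<in> \<int>" using int_adj_rational_is_int[OF cis_power_eq_1[OF m(1)] m(1)] by blast
  then obtain c where "Y = of_int c" by (auto elim: Ints_cases)
  then have "of_int (int q * (int k - D)) = (of_int (2 * c) :: complex)" using Y by (simp add: field_simps)
  then have "int q * (int k - D) = 2 * c" by (simp only: of_int_eq_iff)
  then have "even (int q * (int k - D))" by simp
  then have "even (int k - D)" using odd by (simp add: q_def)
  then have "odd k \<longleftrightarrow> \<xi> = \<xi>'" by (auto simp: D_def split: if_splits)
  then show ?thesis using that k by blast
qed

section \<open>The group algebra\<close>

lemma mat_cancel_left: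
  "A * B = 1\<^sub>m n \<Longrightarrow> dim_col A = dim_row B \<Longrightarrow> dim_col B = dim_row C \<Longrightarrow> dim_row C = n \<Longrightarrow>
    A * (B * C) = (C :: complex mat)"
  by (simp flip: mult_mat_assoc_dim)

locale finite_group = group G for G :: "('a, 'b) monoid_scheme" (structure) +
  assumes finite_group: "finite (carrier G)"
begin

abbreviation conv :: "('a \<Rightarrow> complex) \<Rightarrow> ('a \<Rightarrow> complex) \<Rightarrow> 'a \<Rightarrow> complex" (infixl "\<star>" 70) where
  "f \<star> f' \<equiv> f \<otimes>\<^bsub>group_algebra G\<^esub> f'"

lemma conv_apply: "x \<in> carrier G \<Longrightarrow> (f \<star> f') x = (\<Sum>y\<in>carrier G. f y * f' (inv y \<otimes> x))"
  and conv_outside [simp]: "x \<notin> carrier G \<Longrightarrow> (f \<star> f') x = 0"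
  by (auto simp: group_algebra_def)

lemma bij_betw_mult_inv: "x \<in> carrier G \<Longrightarrow> bij_betw (\<lambda>y. x \<otimes> inv y) (carrier G) (carrier G)"
  by (rule bij_betw_byWitness[of _ "\<lambda>y. inv y \<otimes> x"]) (auto simp: inv_mult_group m_assoc)

lemma bij_betw_mult_left: "x \<in> carrier G \<Longrightarrow> bij_betw (\<lambda>y. x \<otimes> y) (carrier G) (carrier G)"
  by (rule bij_betw_byWitness[of _ "\<lambda>y. inv x \<otimes> y"]) auto

lemma conv_apply': "x \<in> carrier G \<Longrightarrow> (f \<star> f') x = (\<Sum>y\<in>carrier G. f (x \<otimes> inv y) * f' y)"
  unfolding conv_apply
  by (subst sum.reindex_bij_betw[OF bij_betw_mult_inv, of x, symmetric]) (auto simp: inv_mult_group m_assoc intro!: sum.cong)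

lemma conv_assoc: "(f \<star> f') \<star> f'' = f \<star> (f' \<star> f'')"
proof
  fix x
  show "((f \<star> f') \<star> f'') x = (f \<star> (f' \<star> f'')) x"
  proof (cases "x \<in> carrier G")
    case x: True
    have "((f \<star> f') \<star> f'') x = (\<Sum>y\<in>carrier G. \<Sum>z\<in>carrier G. f z * f' (inv z \<otimes> y) * f'' (inv y \<otimes> x))"
      using x by (simp add: conv_apply sum_distrib_right cong: sum.cong)
    also have "\<dots> = (\<Sum>z\<in>carrier G. \<Sum>y\<in>carrier G. f z * f' (inv z \<otimes> y) * f'' (inv y \<otimes> x))" by (rule sum.swap)
    also have "\<dots> = (\<Sum>z\<in>carrier G. \<Sum>y\<in>carrier G. f z * (f' y * f'' (inv y \<otimes> (inv z \<otimes> x))))"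
    proof (rule sum.cong[OF refl])
      fix z assume z: "z \<in> carrier G"
      show "(\<Sum>y\<in>carrier G. f z * f' (inv z \<otimes> y) * f'' (inv y \<otimes> x)) = (\<Sum>y\<in>carrier G. f z * (f' y * f'' (inv y \<otimes> (inv z \<otimes> x))))"
        using x z by (subst sum.reindex_bij_betw[OF bij_betw_mult_left[OF z], symmetric])
          (auto simp: inv_mult_group m_assoc mult.assoc intro!: sum.cong)
    qed
    also have "\<dots> = (f \<star> (f' \<star> f'')) x" using x by (simp add: conv_apply sum_distrib_left cong: sum.cong)
    finally show ?thesis .
  qed simp
qed

lemma group_elem_conv: "g \<in> carrier G \<Longrightarrow> x \<in> carrier G \<Longrightarrow> (group_elem g \<star> f) x = f (inv g \<otimes> x)"
proof -
  assume g: "g \<in> carrier G" and x: "x \<in> carrier G"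
  have "(group_elem g \<star> f) x = (\<Sum>y\<in>carrier G. if y = g then f (inv y \<otimes> x) else 0)"
    unfolding conv_apply[OF x] by (intro sum.cong) (auto simp: group_elem_def)
  then show ?thesis using g finite_group by simp
qed

lemma conv_group_elem: "g \<in> carrier G \<Longrightarrow> x \<in> carrier G \<Longrightarrow> (f \<star> group_elem g) x = f (x \<otimes> inv g)"
proof -
  assume g: "g \<in> carrier G" and x: "x \<in> carrier G"
  have "(f \<star> group_elem g) x = (\<Sum>y\<in>carrier G. if y = g then f (x \<otimes> inv y) else 0)"
    unfolding conv_apply'[OF x] by (intro sum.cong) (auto simp: group_elem_def)
  then show ?thesis using g finite_group by simp
qed

lemma conv_scale_left: "(\<lambda>x. c * f x) \<star> f' = (\<lambda>x. c * (f \<star> f') x)"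
  by (auto simp: group_algebra_def sum_distrib_left mult.assoc)

text \<open>The coefficient at the identity behaves like a trace; \<open>trace_\<tau>\<close>
  compares it with the matrix trace on S.\<close>

lemma conv_at_one_commute: "(f \<star> f') \<one> = (f' \<star> f) \<one>"
  using conv_apply[of \<one> f f'] conv_apply'[of \<one> f' f] by (simp add: mult.commute cong: sum.cong)

lemma conj_elem_apply: "g \<in> carrier G \<Longrightarrow> x \<in> carrier G \<Longrightarrow> conj_elem G s g x = s (g \<otimes> x \<otimes> inv g)"
  by (simp add: conj_elem_def conv_group_elem group_elem_conv m_assoc)

end

section \<open>The group algebra acting on a module\<close>

context rep
begin

sublocale finite_group
  by unfold_locales (rule finite_carrier)

definition ext :: "('a \<Rightarrow> complex) \<Rightarrow> complex mat" where
  "ext f = msum n n (\<lambda>g. f g \<cdot>\<^sub>m \<rho> g) (carrier G)"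

lemma ext_carrier [simp]: "ext f \<in> carrier_mat n n" "dim_row (ext f) = n" "dim_col (ext f) = n"
  by (simp_all add: ext_def)

lemma ext_conv: "ext (f \<star> f') = ext f * ext f'"
proof (rule eq_matI)
  fix i j assume "i < dim_row (ext f * ext f')" "j < dim_col (ext f * ext f')"
  then have ij: "i < n" "j < n" by auto
  have e: "ext f $$ (i, j) = (\<Sum>g\<in>carrier G. f g * \<rho> g $$ (i, j))" if "i < n" "j < n" for f i j
    using that by (simp add: ext_def msum_index)
  have "ext (f \<star> f') $$ (i, j) = (\<Sum>x\<in>carrier G. \<Sum>y\<in>carrier G. f y * f' (inv y \<otimes> x) * \<rho> x $$ (i, j))"
    using ij by (simp add: e conv_apply sum_distrib_right)
  also have "\<dots> = (\<Sum>y\<in>carrier G. \<Sum>x\<in>carrier G. f y * f' (inv y \<otimes> x) * \<rho> x $$ (i, j))" by (rule sum.swap)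
  also have "\<dots> = (\<Sum>y\<in>carrier G. \<Sum>x\<in>carrier G. f y * f' x * \<rho> (y \<otimes> x) $$ (i, j))"
  proof (rule sum.cong[OF refl])
    fix y assume y: "y \<in> carrier G"
    show "(\<Sum>x\<in>carrier G. f y * f' (inv y \<otimes> x) * \<rho> x $$ (i, j)) = (\<Sum>x\<in>carrier G. f y * f' x * \<rho> (y \<otimes> x) $$ (i, j))"
      using y by (subst sum.reindex_bij_betw[OF bij_betw_mult_left[OF y], symmetric]) (auto intro!: sum.cong)
  qed
  also have "\<dots> = (\<Sum>y\<in>carrier G. \<Sum>x\<in>carrier G. \<Sum>k<n. (f y * \<rho> y $$ (i, k)) * (f' x * \<rho> x $$ (k, j)))"
  proof (intro sum.cong refl)
    fix y x assume y: "y \<in> carrier G" and x: "x \<in> carrier G"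
    have "\<rho> (y \<otimes> x) $$ (i, j) = (\<Sum>k<n. \<rho> y $$ (i, k) * \<rho> x $$ (k, j))"
      unfolding rep_mult[OF y x] using ij x y by (intro mult_mat_index_sum) auto
    then show "f y * f' x * \<rho> (y \<otimes> x) $$ (i, j) = (\<Sum>k<n. (f y * \<rho> y $$ (i, k)) * (f' x * \<rho> x $$ (k, j)))"
      by (simp add: sum_distrib_left mult_ac)
  qed
  also have "\<dots> = (\<Sum>y\<in>carrier G. \<Sum>k<n. \<Sum>x\<in>carrier G. (f y * \<rho> y $$ (i, k)) * (f' x * \<rho> x $$ (k, j)))"
    by (intro sum.cong refl sum.swap)
  also have "\<dots> = (\<Sum>k<n. \<Sum>y\<in>carrier G. \<Sum>x\<in>carrier G. (f y * \<rho> y $$ (i, k)) * (f' x * \<rho> x $$ (k, j)))"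
    by (rule sum.swap)
  also have "\<dots> = (\<Sum>k<n. ext f $$ (i, k) * ext f' $$ (k, j))"
    using ij by (intro sum.cong refl) (simp add: e sum_product)
  also have "\<dots> = (ext f * ext f') $$ (i, j)"
    using ij by (intro mult_mat_index_sum[symmetric]) auto
  finally show "ext (f \<star> f') $$ (i, j) = (ext f * ext f') $$ (i, j)" .
qed auto

lemma ext_group_elem: "g \<in> carrier G \<Longrightarrow> ext (group_elem g) = \<rho> g"
proof (rule eq_matI)
  fix i j assume g: "g \<in> carrier G" and "i < dim_row (\<rho> g)" "j < dim_col (\<rho> g)"
  then have ij: "i < n" "j < n" by auto
  have "ext (group_elem g) $$ (i, j) = (\<Sum>h\<in>carrier G. if h = g then \<rho> h $$ (i, j) else 0)"
    using ij unfolding ext_def by (subst msum_index) (auto simp: group_elem_def intro!: sum.cong)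
  then show "ext (group_elem g) $$ (i, j) = \<rho> g $$ (i, j)" using g finite_carrier by simp
qed auto

lemma ext_scale: "ext (\<lambda>x. c * f x) = c \<cdot>\<^sub>m ext f"
  unfolding ext_def by (subst smult_msum) (auto simp: smult_smult_mat intro!: msum_cong)

lemma ext_add: "ext (\<lambda>x. f x + f' x) = ext f + ext f'"
  by (rule eq_matI) (auto simp: ext_def msum_index sum.distrib algebra_simps)

lemma trace_ext: "trace_mat (ext f) = (\<Sum>g\<in>carrier G. f g * trace_mat (\<rho> g))"
  unfolding ext_def by (subst trace_msum) auto

lemma ext_restrict:
  assumes "A \<subseteq> carrier G" "\<And>x. x \<in> carrier G \<Longrightarrow> x \<notin> A \<Longrightarrow> f x = 0"
  shows "ext f = msum n n (\<lambda>g. f g \<cdot>\<^sub>m \<rho> g) A"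
proof (rule eq_matI)
  fix i j assume "i < dim_row (msum n n (\<lambda>g. f g \<cdot>\<^sub>m \<rho> g) A)" "j < dim_col (msum n n (\<lambda>g. f g \<cdot>\<^sub>m \<rho> g) A)"
  then have ij: "i < n" "j < n" by auto
  have "(\<Sum>g\<in>carrier G. (f g \<cdot>\<^sub>m \<rho> g) $$ (i, j)) = (\<Sum>g\<in>A. (f g \<cdot>\<^sub>m \<rho> g) $$ (i, j))"
    using assms ij by (intro sum.mono_neutral_right finite_carrier) auto
  then show "ext f $$ (i, j) = msum n n (\<lambda>g. f g \<cdot>\<^sub>m \<rho> g) A $$ (i, j)" using ij by (simp add: ext_def msum_index)
qed auto

end

section \<open>Elements of the group algebra supported on one coset of L\<close>

locale invariant_irrep = finite_group G for G :: "('a, 'b) monoid_scheme" (structure) +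
  fixes L :: "'a set" and d :: nat and \<Phi> :: "'a \<Rightarrow> complex mat"
  assumes normal_L: "L \<lhd> G"
    and irred_\<Phi>: "irreducible_representation (G\<lparr>carrier := L\<rparr>) d \<Phi>"
    and invariant_\<Phi>: "\<And>g l. g \<in> carrier G \<Longrightarrow> l \<in> L \<Longrightarrow> trace_mat (\<Phi> (inv g \<otimes> l \<otimes> g)) = trace_mat (\<Phi> l)"
begin

sublocale L: normal L G by (rule normal_L)

sublocale P: irrep "G\<lparr>carrier := L\<rparr>" d \<Phi>
  using subgroup.subgroup_is_group[OF L.subgroup_axioms is_group] irred_\<Phi> finite_subset[OF L.subset finite_group]
  by (simp add: irrep_def irrep_axioms_def)

lemma L_carrier [simp]: "l \<in> L \<Longrightarrow> l \<in> carrier G"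
  using L.subset by blast

lemma L_closed [simp]: "l \<in> L \<Longrightarrow> l' \<in> L \<Longrightarrow> l \<otimes> l' \<in> L" "l \<in> L \<Longrightarrow> inv l \<in> L" "\<one> \<in> L"
  by auto

lemma inv_L [simp]: "l \<in> L \<Longrightarrow> inv\<^bsub>G\<lparr>carrier := L\<rparr>\<^esub> l = inv l"
  by (rule m_inv_consistent[OF L.subgroup_axioms])

lemma \<Phi>_carrier [simp]: "l \<in> L \<Longrightarrow> \<Phi> l \<in> carrier_mat d d" "l \<in> L \<Longrightarrow> dim_row (\<Phi> l) = d" "l \<in> L \<Longrightarrow> dim_col (\<Phi> l) = d"
  using P.carrier_rep P.dim_rep by auto

lemma \<Phi>_mult: "l \<in> L \<Longrightarrow> l' \<in> L \<Longrightarrow> \<Phi> (l \<otimes> l') = \<Phi> l * \<Phi> l'"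
  using P.rep_mult by simp

lemma \<Phi>_one [simp]: "\<Phi> \<one> = 1\<^sub>m d"
  using P.rep_one by simp

lemma order_L [simp]: "Coset.order (G\<lparr>carrier := L\<rparr>) = card L"
  by (simp add: Coset.order_def)

lemma card_L_pos: "card L > 0"
  using P.order_pos by simp

lemma conj_closed [simp]: "g \<in> carrier G \<Longrightarrow> l \<in> L \<Longrightarrow> inv g \<otimes> l \<otimes> g \<in> L"
  "g \<in> carrier G \<Longrightarrow> l \<in> L \<Longrightarrow> g \<otimes> l \<otimes> inv g \<in> L"
  using L.inv_op_closed1 L.inv_op_closed2 by auto

text \<open>The factor of Fourier inversion on \<open>L\<close>.\<close>

definition wt :: complex where "wt = of_nat d / of_nat (card L)"

lemma wt_nonzero: "wt \<noteq> 0"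
  using P.dim_pos card_L_pos by (simp add: wt_def)

text \<open>The element of the coset \<open>k L\<close> obtained from the matrix \<open>T\<close> by Fourier inversion on \<open>L\<close>:
  formally it is \<open>k a\<close> where \<open>a\<close> is the element of \<open>\<complex>L e\<close> with image \<open>T\<close> under \<open>\<Phi>\<close>.\<close>

definition lift :: "complex mat \<Rightarrow> 'a \<Rightarrow> 'a \<Rightarrow> complex" where
  "lift T k x = (if x \<in> carrier G \<and> inv k \<otimes> x \<in> L then wt * trace_mat (T * \<Phi> (inv (inv k \<otimes> x))) else 0)"

text \<open>If \<open>a\<close> has the image \<open>T\<close> under \<Phi>, this says that k a
  commutes with every l in \<open>L\<close>: l k a = k (k^-1 l k) a has to agree with k a l.\<close>

definition intertwines :: "complex mat \<Rightarrow> 'a \<Rightarrow> bool" where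
  "intertwines T k \<longleftrightarrow> T \<in> carrier_mat d d \<and> (\<forall>l\<in>L. \<Phi> (inv k \<otimes> l \<otimes> k) * T = T * \<Phi> l)"

lemma intertwines_one: "intertwines (1\<^sub>m d) \<one>"
  by (simp add: intertwines_def)

lemma lift_support: "lift T k x \<noteq> 0 \<Longrightarrow> x \<in> carrier G \<and> inv k \<otimes> x \<in> L"
  by (auto simp: lift_def split: if_splits)

lemma lift_at: "k \<in> carrier G \<Longrightarrow> l \<in> L \<Longrightarrow> lift T k (k \<otimes> l) = wt * trace_mat (T * \<Phi> (inv l))"
  by (simp add: lift_def)

lemma inv_mult_mem_L_iff:
  assumes "k \<in> carrier G" "x \<in> carrier G"
  shows "inv k \<otimes> x \<in> L \<longleftrightarrow> (\<exists>l\<in>L. x = k \<otimes> l)"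
  using assms by (auto intro!: bexI[of _ "inv k \<otimes> x"])

lemma sum_coset:
  assumes "k \<in> carrier G" "\<And>x. x \<in> carrier G \<Longrightarrow> inv k \<otimes> x \<notin> L \<Longrightarrow> f x = 0"
  shows "sum f (carrier G) = (\<Sum>l\<in>L. f (k \<otimes> l))"
proof -
  have "sum f (carrier G) = sum f ((\<lambda>l. k \<otimes> l) ` L)"
    using assms finite_group by (intro sum.mono_neutral_right) (auto simp: inv_mult_mem_L_iff)
  also have "\<dots> = (\<Sum>l\<in>L. f (k \<otimes> l))" using assms(1) by (subst sum.reindex) (auto simp: inj_on_def)
  finally show ?thesis .
qed

lemma fourier_inversion_L:
  "T \<in> carrier_mat d d \<Longrightarrow> msum d d (\<lambda>l. (wt * trace_mat (T * \<Phi> (inv l))) \<cdot>\<^sub>m \<Phi> l) L = T"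
  using P.fourier_inversion[of T] by (simp add: wt_def cong: msum_cong)

text \<open>Formally (k a)(k' a') = k k' (k'^-1 a k') a'. The intertwining relation of
  \<open>T'\<close>, extended linearly from \<open>L\<close> to \<open>a\<close>, shows that (k'^-1
  a k') a' has the image \<open>T' * T\<close>; this is why the matrices multiply in the reverse
  order.\<close>

lemma lift_conv_lift:
  assumes T: "T \<in> carrier_mat d d" and T': "intertwines T' k'" and k: "k \<in> carrier G" "k' \<in> carrier G"
  shows "lift T k \<star> lift T' k' = lift (T' * T) (k \<otimes> k')"
proof
  fix x
  show "(lift T k \<star> lift T' k') x = lift (T' * T) (k \<otimes> k') x"
  proof (cases "x \<in> carrier G")
    case False then show ?thesis by (simp add: lift_def)
  next
    case x: True
    define z where "z = inv k' \<otimes> (inv k \<otimes> x)"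
    have z: "z \<in> carrier G" using x k by (simp add: z_def)
    have zz: "inv (k \<otimes> k') \<otimes> x = z" using x k by (simp add: z_def inv_mult_group m_assoc)
    have xz: "x = k \<otimes> (k' \<otimes> z)" using x k by (simp add: z_def m_assoc)
    have Tc: "T' \<in> carrier_mat d d" using T' by (simp add: intertwines_def)
    have "(lift T k \<star> lift T' k') x = (\<Sum>l\<in>L. lift T k (k \<otimes> l) * lift T' k' (inv (k \<otimes> l) \<otimes> x))"
      unfolding conv_apply[OF x] using k lift_support[of T k] by (intro sum_coset) auto
    also have "\<dots> = (\<Sum>l\<in>L. lift T k (k \<otimes> l) * lift T' k' (k' \<otimes> (inv k' \<otimes> inv l \<otimes> k' \<otimes> z)))"
      using x k by (intro sum.cong refl) (auto simp: z_def inv_mult_group m_assoc)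
    also have "\<dots> = lift (T' * T) (k \<otimes> k') x"
    proof (cases "z \<in> L")
      case False
      have "lift T' k' (k' \<otimes> (inv k' \<otimes> inv l \<otimes> k' \<otimes> z)) = 0" if l: "l \<in> L" for l
      proof -
        have "inv k' \<otimes> inv l \<otimes> k' \<in> L" using l k by simp
        then have "inv k' \<otimes> inv l \<otimes> k' \<otimes> z \<notin> L" using False z k(2) l
          by (metis L_carrier L_closed(1,2) inv_mult_cancel(1) m_closed)
        then show ?thesis using k z l by (simp add: lift_def)
      qed
      then show ?thesis using False zz by (simp add: lift_def)
    next
      case True
      have "lift T' k' (k' \<otimes> (inv k' \<otimes> inv l \<otimes> k' \<otimes> z)) = wt * trace_mat (T' * \<Phi> l * \<Phi> (inv z))" if l: "l \<in> L" for l
      proof -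
        have m: "inv k' \<otimes> inv l \<otimes> k' \<in> L" "inv k' \<otimes> l \<otimes> k' \<in> L" using l k by auto
        have i: "inv (inv k' \<otimes> inv l \<otimes> k' \<otimes> z) = inv z \<otimes> (inv k' \<otimes> l \<otimes> k')"
          using l k z by (simp add: inv_mult_group m_assoc)
        have "lift T' k' (k' \<otimes> (inv k' \<otimes> inv l \<otimes> k' \<otimes> z)) = wt * trace_mat (T' * (\<Phi> (inv z) * \<Phi> (inv k' \<otimes> l \<otimes> k')))"
          using lift_at[OF k(2) L_closed(1)[OF m(1) True], of T'] unfolding i using m True by (simp add: \<Phi>_mult)
        also have "T' * (\<Phi> (inv z) * \<Phi> (inv k' \<otimes> l \<otimes> k')) = (T' * \<Phi> (inv z)) * \<Phi> (inv k' \<otimes> l \<otimes> k')"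
          using Tc True m(2) by (simp add: mult_mat_assoc_dim)
        also have "trace_mat \<dots> = trace_mat (\<Phi> (inv k' \<otimes> l \<otimes> k') * (T' * \<Phi> (inv z)))"
          using Tc True m(2) by (intro trace_mat_comm[of _ d d]) auto
        also have "\<Phi> (inv k' \<otimes> l \<otimes> k') * (T' * \<Phi> (inv z)) = \<Phi> (inv k' \<otimes> l \<otimes> k') * T' * \<Phi> (inv z)"
          using Tc True m(2) by (simp add: mult_mat_assoc_dim)
        also have "\<Phi> (inv k' \<otimes> l \<otimes> k') * T' = T' * \<Phi> l" using T' l by (simp add: intertwines_def)
        finally show ?thesis .
      qed
      then have "(\<Sum>l\<in>L. lift T k (k \<otimes> l) * lift T' k' (k' \<otimes> (inv k' \<otimes> inv l \<otimes> k' \<otimes> z))) =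
          (\<Sum>l\<in>L. wt * (wt * trace_mat (T * \<Phi> (inv l)) * trace_mat (T' * \<Phi> l * \<Phi> (inv z))))"
        using k by (intro sum.cong refl) (simp add: lift_at)
      \<comment> \<open>The scalars go into the matrix so that the sum over \<open>l\<close> becomes
        the Fourier expansion of \<open>T\<close>.\<close>
      also have "\<dots> = wt * (\<Sum>l\<in>L. trace_mat (T' * ((wt * trace_mat (T * \<Phi> (inv l))) \<cdot>\<^sub>m \<Phi> l) * \<Phi> (inv z)))"
      proof -
        have "trace_mat (T' * ((wt * trace_mat (T * \<Phi> (inv l))) \<cdot>\<^sub>m \<Phi> l) * \<Phi> (inv z)) =
           wt * trace_mat (T * \<Phi> (inv l)) * trace_mat (T' * \<Phi> l * \<Phi> (inv z))" if l: "l \<in> L" for l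
        proof -
          have "T' * (c \<cdot>\<^sub>m \<Phi> l) * \<Phi> (inv z) = c \<cdot>\<^sub>m (T' * \<Phi> l * \<Phi> (inv z))" for c
            using l Tc True by (simp add: mult_smult_distrib[of _ d d _ d] mult_smult_assoc_mat[of _ d d _ d] mult_mat_assoc_dim)
          then show ?thesis using l Tc True by simp
        qed
        then show ?thesis by (simp add: sum_distrib_left cong: sum.cong)
      qed
      also have "(\<Sum>l\<in>L. trace_mat (T' * ((wt * trace_mat (T * \<Phi> (inv l))) \<cdot>\<^sub>m \<Phi> l) * \<Phi> (inv z)))
          = trace_mat (msum d d (\<lambda>l. T' * ((wt * trace_mat (T * \<Phi> (inv l))) \<cdot>\<^sub>m \<Phi> l) * \<Phi> (inv z)) L)"
        using Tc True by (intro trace_msum[symmetric]) (auto intro!: carrier_matI)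
      also have "msum d d (\<lambda>l. T' * ((wt * trace_mat (T * \<Phi> (inv l))) \<cdot>\<^sub>m \<Phi> l) * \<Phi> (inv z)) L
          = T' * msum d d (\<lambda>l. (wt * trace_mat (T * \<Phi> (inv l))) \<cdot>\<^sub>m \<Phi> l) L * \<Phi> (inv z)"
        using Tc True by (subst mult_msum[of _ d d]) (auto intro!: carrier_matI msum_mult[symmetric])
      also have "wt * trace_mat \<dots> = lift (T' * T) (k \<otimes> k') x"
        using True x zz T Tc by (simp add: fourier_inversion_L lift_def)
      finally show ?thesis .
    qed
    finally show ?thesis .
  qed
qed

text \<open>By invariance \<Phi> and its conjugate by \<open>k\<close> have the same character, so
  they are isomorphic.\<close>

lemma exists_intertwiner:
  assumes k: "k \<in> carrier G"
  obtains T T' where "intertwines T k" "T' \<in> carrier_mat d d" "T * T' = 1\<^sub>m d" "T' * T = 1\<^sub>m d"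
proof -
  let ?c = "\<lambda>l. inv k \<otimes> l \<otimes> k"
  have c: "?c l \<in> L" "k \<otimes> l \<otimes> inv k \<in> L" "?c (k \<otimes> l \<otimes> inv k) = l" if "l \<in> L" for l
    using that k conj_closed[OF k that] by (simp_all add: m_assoc)
  let ?\<rho> = "\<lambda>l. \<Phi> (?c l)"
  have gL: "group (G\<lparr>carrier := L\<rparr>)" by (rule P.is_group)
  have rep: "representation (G\<lparr>carrier := L\<rparr>) d ?\<rho>"
    unfolding representation_altdef[OF gL]
  proof (intro conjI ballI)
    fix g h assume gh: "g \<in> carrier (G\<lparr>carrier := L\<rparr>)" "h \<in> carrier (G\<lparr>carrier := L\<rparr>)"
    have "?c (g \<otimes> h) = ?c g \<otimes> ?c h" using gh k by (simp add: m_assoc)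
    then show "?\<rho> (g \<otimes>\<^bsub>G\<lparr>carrier := L\<rparr>\<^esub> h) = ?\<rho> g * ?\<rho> h" using gh c by (simp add: \<Phi>_mult)
  qed (use k c in auto)
  have irr: "irreducible_representation (G\<lparr>carrier := L\<rparr>) d ?\<rho>"
    unfolding irreducible_representation_def
  proof (intro conjI allI impI rep P.dim_pos)
    fix W assume W: "VectorSpace.subspace class_ring W (module_vec TYPE(complex) d)"
      and inv: "\<forall>g\<in>carrier (G\<lparr>carrier := L\<rparr>). \<forall>w\<in>W. ?\<rho> g *\<^sub>v w \<in> W"
    have "\<forall>g\<in>carrier (G\<lparr>carrier := L\<rparr>). \<forall>w\<in>W. \<Phi> g *\<^sub>v w \<in> W"
    proof (intro ballI)
      fix g w assume "g \<in> carrier (G\<lparr>carrier := L\<rparr>)" and w: "w \<in> W"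
      then have g: "g \<in> L" by simp
      have "?\<rho> (k \<otimes> g \<otimes> inv k) *\<^sub>v w \<in> W" using inv c(2)[OF g] w by simp
      then show "\<Phi> g *\<^sub>v w \<in> W" unfolding c(3)[OF g] .
    qed
    then show "W = {0\<^sub>v d} \<or> W = carrier_vec d" using irred_\<Phi> W by (simp add: irreducible_representation_def)
  qed
  interpret R: irrep "G\<lparr>carrier := L\<rparr>" d ?\<rho>
    using irr P.finite_carrier gL by (simp add: irrep_def irrep_axioms_def)
  have "(\<Sum>l\<in>carrier (G\<lparr>carrier := L\<rparr>). trace_mat (?\<rho> l) * trace_mat (\<Phi> (inv\<^bsub>G\<lparr>carrier := L\<rparr>\<^esub> l))) = of_nat (card L)"
    unfolding order_L[symmetric] P.trace_norm[symmetric] by (rule sum.cong) (use k invariant_\<Phi> in auto)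
  then have "(\<Sum>l\<in>carrier (G\<lparr>carrier := L\<rparr>). trace_mat (?\<rho> l) * trace_mat (\<Phi> (inv\<^bsub>G\<lparr>carrier := L\<rparr>\<^esub> l))) \<noteq> 0"
    using card_L_pos by simp
  from R.intertwiner_exists[OF irred_\<Phi> this] obtain T T' where
    "T \<in> carrier_mat d d" "T' \<in> carrier_mat d d" "T * T' = 1\<^sub>m d" "T' * T = 1\<^sub>m d"
    "\<forall>g\<in>L. ?\<rho> g * T = T * \<Phi> g" by auto
  then show ?thesis by (intro that[of T T']) (auto simp: intertwines_def)
qed

lemma intertwines_inverse:
  assumes k: "k \<in> carrier G" and T: "intertwines T k" and T': "T' \<in> carrier_mat d d" "T * T' = 1\<^sub>m d" "T' * T = 1\<^sub>m d"
  shows "intertwines T' (inv k)"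
  unfolding intertwines_def
proof (intro conjI ballI T'(1))
  fix l assume l: "l \<in> L"
  have Tc: "T \<in> carrier_mat d d" using T by (simp add: intertwines_def)
  let ?m = "k \<otimes> l \<otimes> inv k"
  have m: "?m \<in> L" "inv k \<otimes> ?m \<otimes> k = l" using l k conj_closed[OF k l] by (simp_all add: m_assoc)
  have e: "\<Phi> l * T = T * \<Phi> ?m" using T m by (metis intertwines_def)
  have "\<Phi> ?m * T' = T' * (T * \<Phi> ?m) * T'" using T' Tc m(1) by (simp add: mult_mat_assoc_dim mat_cancel_left[OF T'(3)])
  also have "\<dots> = T' * \<Phi> l * (T * T')" unfolding e[symmetric] using T'(1) Tc m(1) l by (simp add: mult_mat_assoc_dim)
  also have "\<dots> = T' * \<Phi> l" using T' l by (simp add: mult_mat_one_dim)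
  finally show "\<Phi> (inv (inv k) \<otimes> l \<otimes> inv k) * T' = T' * \<Phi> l" using k by simp
qed

end

section \<open>Matrix units and trace functionals\<close>

lemma msum_empty [simp]: "msum r c f {} = 0\<^sub>m r c"
  by (rule eq_matI) (auto simp: msum_index)

lemma msum_insert:
  "finite I \<Longrightarrow> a \<notin> I \<Longrightarrow> f a \<in> carrier_mat r c \<Longrightarrow> msum r c f (insert a I) = f a + msum r c f I"
  by (rule eq_matI) (auto simp: msum_index)

lemma linear_functional_msum:
  assumes add: "\<And>A B. A \<in> carrier_mat n n \<Longrightarrow> B \<in> carrier_mat n n \<Longrightarrow> f (A + B) = f A + (f B :: complex)"
    and smult: "\<And>c A. A \<in> carrier_mat n n \<Longrightarrow> f (c \<cdot>\<^sub>m A) = c * f A"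
    and "finite I" "\<And>a. a \<in> I \<Longrightarrow> X a \<in> carrier_mat n n"
  shows "f (msum n n X I) = (\<Sum>a\<in>I. f (X a))"
  using assms(3,4)
proof (induction I rule: finite_induct)
  case empty
  have "f (0 \<cdot>\<^sub>m 0\<^sub>m n n) = 0 * f (0\<^sub>m n n)" by (rule smult) simp
  moreover have "0 \<cdot>\<^sub>m 0\<^sub>m n n = (0\<^sub>m n n :: complex mat)" by (rule eq_matI) auto
  ultimately show ?case by simp
next
  case (insert a I)
  then show ?case by (simp add: msum_insert add)
qed

lemma elem_mat_mult:
  assumes "j < n" "k < n" "i < n" "l < n"
  shows "elem_mat n n i j * elem_mat n n k l = (if j = k then elem_mat n n i l else 0\<^sub>m n n)"
proof (rule eq_matI)
  fix a b assume "a < dim_row (if j = k then elem_mat n n i l else 0\<^sub>m n n)" "b < dim_col (if j = k then elem_mat n n i l else 0\<^sub>m n n)"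
  then have ab: "a < n" "b < n" by (auto simp: elem_mat_def split: if_splits)
  have "(elem_mat n n i j * elem_mat n n k l) $$ (a, b) = (\<Sum>c<n. elem_mat n n i j $$ (a, c) * elem_mat n n k l $$ (c, b))"
    using ab by (intro mult_mat_index_sum) auto
  also have "\<dots> = (\<Sum>c<n. if c = j then (if a = i \<and> j = k \<and> b = l then 1 else 0) else 0)"
    using ab by (intro sum.cong) (auto simp: elem_mat_def)
  also have "\<dots> = (if j = k then elem_mat n n i l else 0\<^sub>m n n) $$ (a, b)"
    using ab assms by (auto simp: elem_mat_def)
  finally show "(elem_mat n n i j * elem_mat n n k l) $$ (a, b) = (if j = k then elem_mat n n i l else 0\<^sub>m n n) $$ (a, b)" .
qed (auto simp: elem_mat_def)

lemma mat_eq_msum_elem_mat: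
  assumes "A \<in> carrier_mat n n"
  shows "A = msum n n (\<lambda>(i, j). A $$ (i, j) \<cdot>\<^sub>m elem_mat n n i j) ({..<n} \<times> {..<n})"
proof (rule eq_matI)
  fix a b assume "a < dim_row (msum n n (\<lambda>(i, j). A $$ (i, j) \<cdot>\<^sub>m elem_mat n n i j) ({..<n} \<times> {..<n}))"
    "b < dim_col (msum n n (\<lambda>(i, j). A $$ (i, j) \<cdot>\<^sub>m elem_mat n n i j) ({..<n} \<times> {..<n}))"
  then have ab: "a < n" "b < n" by auto
  have "msum n n (\<lambda>(i, j). A $$ (i, j) \<cdot>\<^sub>m elem_mat n n i j) ({..<n} \<times> {..<n}) $$ (a, b)
     = (\<Sum>p\<in>{..<n} \<times> {..<n}. if p = (a, b) then A $$ (a, b) else 0)"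
    unfolding msum_index[OF ab] using ab by (intro sum.cong) (auto simp: elem_mat_def split: if_splits)
  then show "A $$ (a, b) = msum n n (\<lambda>(i, j). A $$ (i, j) \<cdot>\<^sub>m elem_mat n n i j) ({..<n} \<times> {..<n}) $$ (a, b)"
    using ab by simp
qed (use assms in auto)

text \<open>The matrix unit with index (i, j) is the product of those with (i, 0) and (0, j).
  Interchanging the factors shows that \<open>f\<close> vanishes on matrix units off the diagonal
  and takes one value on all diagonal ones.\<close>

lemma trace_functional_unique:
  assumes add: "\<And>A B. A \<in> carrier_mat n n \<Longrightarrow> B \<in> carrier_mat n n \<Longrightarrow> f (A + B) = f A + (f B :: complex)"
    and smult: "\<And>c A. A \<in> carrier_mat n n \<Longrightarrow> f (c \<cdot>\<^sub>m A) = c * f A"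
    and comm: "\<And>A B. A \<in> carrier_mat n n \<Longrightarrow> B \<in> carrier_mat n n \<Longrightarrow> f (A * B) = f (B * A)"
    and A: "A \<in> carrier_mat n n"
  shows "f A = f (elem_mat n n 0 0) * trace_mat A"
proof -
  define z where "z = f (elem_mat n n 0 0)"
  have e: "f (elem_mat n n i j) = (if i = j then z else 0)" if "i < n" "j < n" for i j
  proof -
    have n: "0 < n" using that by simp
    have "f (elem_mat n n i j) = f (elem_mat n n i 0 * elem_mat n n 0 j)" using that n by (simp add: elem_mat_mult)
    also have "\<dots> = f (elem_mat n n 0 j * elem_mat n n i 0)" by (rule comm) auto
    also have "\<dots> = (if i = j then z else f (0\<^sub>m n n))" using that n by (simp add: elem_mat_mult z_def)
    also have "f (0\<^sub>m n n) = 0" using linear_functional_msum[OF add smult, where I = "{} :: nat set"] by simp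
    finally show ?thesis .
  qed
  have "f A = f (msum n n (\<lambda>(i, j). A $$ (i, j) \<cdot>\<^sub>m elem_mat n n i j) ({..<n} \<times> {..<n}))"
    using mat_eq_msum_elem_mat[OF A] by simp
  also have "\<dots> = (\<Sum>p\<in>{..<n} \<times> {..<n}. f (case p of (i, j) \<Rightarrow> A $$ (i, j) \<cdot>\<^sub>m elem_mat n n i j))"
    by (rule linear_functional_msum[OF add smult]) auto
  also have "\<dots> = (\<Sum>p\<in>{..<n} \<times> {..<n}. case p of (i, j) \<Rightarrow> if i = j then A $$ (i, j) * z else 0)"
    by (intro sum.cong refl) (auto simp: smult e)
  also have "\<dots> = (\<Sum>i<n. \<Sum>j<n. if i = j then A $$ (i, j) * z else 0)"
    by (rule sum.cartesian_product[symmetric])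
  also have "\<dots> = (\<Sum>i<n. A $$ (i, i) * z)" by (intro sum.cong) auto
  finally show ?thesis unfolding z_def[symmetric] using A by (simp add: trace_mat_def sum_distrib_left mult.commute)
qed

section \<open>The algebra S\<close>

locale five_algebra = invariant_irrep G L d \<Phi> for G :: "('a, 'b) monoid_scheme" (structure) and L d \<Phi> +
  fixes K :: "'a set" and \<phi> :: "'a \<Rightarrow> complex"
  assumes normal_K: "K \<lhd> G" and L_sub_K: "L \<subseteq> K" and \<phi>_eq: "\<phi> = restrict (\<lambda>l. trace_mat (\<Phi> l)) L"
begin

sublocale K: normal K G by (rule normal_K)

abbreviation S where "S \<equiv> S_alg G K L \<phi>"
abbreviation e where "e \<equiv> central_idem G L \<phi>"

lemma K_carrier [simp]: "k \<in> K \<Longrightarrow> k \<in> carrier G"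
  using K.subset by blast

lemma e_eq_lift: "e = lift (1\<^sub>m d) \<one>"
proof
  fix x
  show "e x = lift (1\<^sub>m d) \<one> x"
    by (cases "x \<in> L") (auto simp: central_idem_def lift_def \<phi>_eq wt_def mult_mat_one_dim)
qed

lemma S_simps [simp]: "f \<otimes>\<^bsub>S\<^esub> g = f \<star> g" "\<one>\<^bsub>S\<^esub> = e" "f \<oplus>\<^bsub>S\<^esub> g = (\<lambda>x. f x + g x)"
  by (simp_all add: S_alg_def) (simp add: group_algebra_def)

lemma lift_conv_e: "k \<in> carrier G \<Longrightarrow> T \<in> carrier_mat d d \<Longrightarrow> lift T k \<star> e = lift T k"
  unfolding e_eq_lift by (simp add: lift_conv_lift[OF _ intertwines_one] mult_mat_one_dim)

lemma e_idem: "e \<star> e = e"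
  using lift_conv_e[of \<one> "1\<^sub>m d"] by (simp flip: e_eq_lift)

lemma e_support: "e x \<noteq> 0 \<Longrightarrow> x \<in> L"
  by (auto simp: central_idem_def split: if_splits)

lemma conv_e_apply: "x \<in> carrier G \<Longrightarrow> (f \<star> e) x = (\<Sum>l\<in>L. f (x \<otimes> inv l) * e l)"
proof -
  assume x: "x \<in> carrier G"
  have "(\<Sum>y\<in>carrier G. f (x \<otimes> inv y) * e y) = (\<Sum>l\<in>L. f (x \<otimes> inv l) * e l)"
    using e_support L.subset finite_group by (intro sum.mono_neutral_right) auto
  then show ?thesis using conv_apply'[OF x] by simp
qed

text \<open>Being a multiple of the idempotent \<open>e\<close> is the same as being fixed by
  multiplication with it, and commuting with \<open>L\<close> becomes an identity between
  coefficients.\<close>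

lemma mem_S_iff:
  "s \<in> carrier S \<longleftrightarrow> (\<forall>x. x \<notin> K \<longrightarrow> s x = 0) \<and> s \<star> e = s \<and>
    (\<forall>l\<in>L. \<forall>x\<in>carrier G. s (inv l \<otimes> x) = s (x \<otimes> inv l))"
proof -
  have comm: "(\<forall>l\<in>L. group_elem l \<star> s = s \<star> group_elem l) \<longleftrightarrow>
      (\<forall>l\<in>L. \<forall>x\<in>carrier G. s (inv l \<otimes> x) = s (x \<otimes> inv l))"
  proof (intro ball_cong refl iffI ballI ext)
    fix l x assume "l \<in> L" "group_elem l \<star> s = s \<star> group_elem l" "x \<in> carrier G"
    then show "s (inv l \<otimes> x) = s (x \<otimes> inv l)" by (metis group_elem_conv conv_group_elem L_carrier)
  next
    fix l x assume l: "l \<in> L" and h: "\<forall>x\<in>carrier G. s (inv l \<otimes> x) = s (x \<otimes> inv l)"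
    show "(group_elem l \<star> s) x = (s \<star> group_elem l) x"
      by (cases "x \<in> carrier G") (use l h in \<open>auto simp: group_elem_conv conv_group_elem\<close>)
  qed
  have ex: "(\<exists>a\<in>carrier (group_algebra (G\<lparr>carrier := K\<rparr>)). s = a \<star> e) \<longleftrightarrow> (\<forall>x. x \<notin> K \<longrightarrow> s x = 0) \<and> s \<star> e = s"
  proof
    assume "\<exists>a\<in>carrier (group_algebra (G\<lparr>carrier := K\<rparr>)). s = a \<star> e"
    then obtain a where a: "\<And>x. x \<notin> K \<Longrightarrow> a x = 0" "s = a \<star> e" by (auto simp: group_algebra_def)
    have "s x = 0" if x: "x \<notin> K" for x
    proof (cases "x \<in> carrier G")
      case True
      have "x \<otimes> inv l \<notin> K" if l: "l \<in> L" for l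
      proof
        assume h: "x \<otimes> inv l \<in> K"
        have "x \<otimes> inv l \<otimes> l \<in> K" by (rule K.m_closed[OF h subsetD[OF L_sub_K l]])
        then show False using x True l by (simp add: m_assoc)
      qed
      then show ?thesis unfolding a(2) conv_e_apply[OF True] by (simp add: a(1))
    qed (simp add: a(2))
    moreover have "s \<star> e = s" unfolding a(2) by (simp add: conv_assoc e_idem)
    ultimately show "(\<forall>x. x \<notin> K \<longrightarrow> s x = 0) \<and> s \<star> e = s" by blast
  next
    assume "(\<forall>x. x \<notin> K \<longrightarrow> s x = 0) \<and> s \<star> e = s"
    then show "\<exists>a\<in>carrier (group_algebra (G\<lparr>carrier := K\<rparr>)). s = a \<star> e"
      by (intro bexI[of _ s]) (auto simp: group_algebra_def)
  qed
  show ?thesis using comm ex by (simp add: S_alg_def)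
qed

lemma S_group_elem_commute: "s \<in> carrier S \<Longrightarrow> l \<in> L \<Longrightarrow> group_elem l \<star> s = s \<star> group_elem l"
  by (simp add: S_alg_def)

lemma S_conv_e: "s \<in> carrier S \<Longrightarrow> s \<star> e = s"
  by (simp add: mem_S_iff)

lemma S_support: "s \<in> carrier S \<Longrightarrow> s x \<noteq> 0 \<Longrightarrow> x \<in> K"
  by (auto simp: mem_S_iff)

lemma S_comm: "s \<in> carrier S \<Longrightarrow> l \<in> L \<Longrightarrow> x \<in> carrier G \<Longrightarrow> s (inv l \<otimes> x) = s (x \<otimes> inv l)"
  by (auto simp: mem_S_iff)

lemma S_closed [simp]: assumes "s \<in> carrier S" "t \<in> carrier S" shows "s \<star> t \<in> carrier S"
proof -
  have "(s \<star> t) x = 0" if x: "x \<notin> K" for x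
  proof (cases "x \<in> carrier G")
    case True
    have "s y * t (inv y \<otimes> x) = 0" if y: "y \<in> carrier G" for y
    proof (rule ccontr)
      assume "s y * t (inv y \<otimes> x) \<noteq> 0"
      then have "y \<in> K" "inv y \<otimes> x \<in> K" using assms S_support by auto
      then have "y \<otimes> (inv y \<otimes> x) \<in> K" by (rule K.m_closed)
      then show False using x y True by simp
    qed
    then show ?thesis using True by (simp add: conv_apply)
  qed simp
  moreover have "s \<star> t \<star> e = s \<star> t" using S_conv_e[OF assms(2)] by (simp add: conv_assoc)
  moreover have "group_elem l \<star> (s \<star> t) = s \<star> t \<star> group_elem l" if "l \<in> L" for l
    using S_group_elem_commute[OF assms(1) that] S_group_elem_commute[OF assms(2) that] by (metis conv_assoc)
  then have "\<forall>l\<in>L. \<forall>x\<in>carrier G. (s \<star> t) (inv l \<otimes> x) = (s \<star> t) (x \<otimes> inv l)"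
    using group_elem_conv conv_group_elem L_carrier by metis
  ultimately show ?thesis unfolding mem_S_iff by blast
qed

text \<open>Commuting with \<open>L\<close> is the intertwining relation of \<open>T\<close>, read
  under the trace.\<close>

lemma lift_in_S:
  assumes k: "k \<in> K" and T: "intertwines T k"
  shows "lift T k \<in> carrier S"
  unfolding mem_S_iff
proof (intro conjI allI impI ballI)
  have Tc: "T \<in> carrier_mat d d" using T by (simp add: intertwines_def)
  show "lift T k \<star> e = lift T k" using k Tc by (intro lift_conv_e) auto
  fix x
  show "lift T k x = 0" if "x \<notin> K"
  proof (rule ccontr)
    assume "lift T k x \<noteq> 0"
    then have x: "x \<in> carrier G" "inv k \<otimes> x \<in> L" using lift_support by auto
    have "k \<otimes> (inv k \<otimes> x) \<in> K" by (rule K.m_closed[OF k subsetD[OF L_sub_K x(2)]])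
    then show False using that x k by simp
  qed
next
  fix l x assume l: "l \<in> L" and x: "x \<in> carrier G"
  have Tc: "T \<in> carrier_mat d d" using T by (simp add: intertwines_def)
  have kG: "k \<in> carrier G" using k by simp
  let ?z = "inv k \<otimes> x"
  have m: "inv k \<otimes> l \<otimes> k \<in> L" "inv k \<otimes> inv l \<otimes> k \<in> L" using kG l by auto
  have z1: "inv k \<otimes> (inv l \<otimes> x) = (inv k \<otimes> inv l \<otimes> k) \<otimes> ?z" using kG l x by (simp add: m_assoc)
  have z2: "inv k \<otimes> (x \<otimes> inv l) = ?z \<otimes> inv l" using kG l x by (simp add: m_assoc)
  show "lift T k (inv l \<otimes> x) = lift T k (x \<otimes> inv l)"
  proof (cases "?z \<in> L")
    case True
    have i1: "inv ((inv k \<otimes> inv l \<otimes> k) \<otimes> ?z) = inv ?z \<otimes> (inv k \<otimes> l \<otimes> k)"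
      using kG l x by (simp add: inv_mult_group m_assoc)
    have i2: "inv (?z \<otimes> inv l) = l \<otimes> inv ?z" using kG l x by (simp add: inv_mult_group m_assoc)
    have "trace_mat (T * \<Phi> (inv ?z \<otimes> (inv k \<otimes> l \<otimes> k))) = trace_mat ((T * \<Phi> (inv ?z)) * \<Phi> (inv k \<otimes> l \<otimes> k))"
      using True m Tc by (simp add: \<Phi>_mult mult_mat_assoc_dim)
    also have "\<dots> = trace_mat (\<Phi> (inv k \<otimes> l \<otimes> k) * (T * \<Phi> (inv ?z)))"
      using Tc True m by (intro trace_mat_comm[of _ d d]) auto
    also have "\<Phi> (inv k \<otimes> l \<otimes> k) * (T * \<Phi> (inv ?z)) = \<Phi> (inv k \<otimes> l \<otimes> k) * T * \<Phi> (inv ?z)"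
      using Tc True m by (simp add: mult_mat_assoc_dim)
    also have "\<Phi> (inv k \<otimes> l \<otimes> k) * T = T * \<Phi> l" using T l by (simp add: intertwines_def)
    also have "T * \<Phi> l * \<Phi> (inv ?z) = T * \<Phi> (l \<otimes> inv ?z)"
      using Tc True l by (simp add: mult_mat_assoc_dim \<Phi>_mult)
    finally show ?thesis unfolding lift_def z1 z2 i1 i2 using True m l kG x by simp
  next
    case False
    have "(inv k \<otimes> inv l \<otimes> k) \<otimes> ?z \<notin> L"
      using False m(2) kG l x by (metis L_carrier L_closed(1,2) inv_closed inv_mult_cancel(1) m_closed)
    moreover have "?z \<otimes> inv l \<notin> L"
    proof
      assume h: "?z \<otimes> inv l \<in> L"
      have "?z \<otimes> inv l \<otimes> l \<in> L" by (rule L_closed(1)[OF h l])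
      then show False using False kG x l by (simp add: m_assoc)
    qed
    ultimately show ?thesis unfolding lift_def z1 z2 by simp
  qed
qed

lemma e_in_S: "e \<in> carrier S"
  unfolding e_eq_lift using lift_in_S[OF K.one_closed intertwines_one] .

lemma e_conv_S: "s \<in> carrier S \<Longrightarrow> e \<star> s = s"
proof -
  assume s: "s \<in> carrier S"
  have "e \<star> s = s \<star> e"
  proof
    fix x
    show "(e \<star> s) x = (s \<star> e) x"
    proof (cases "x \<in> carrier G")
      case True
      have "(e \<star> s) x = (\<Sum>l\<in>L. e l * s (inv l \<otimes> x))"
        unfolding conv_apply[OF True] using e_support L.subset finite_group by (intro sum.mono_neutral_right) auto
      also have "\<dots> = (\<Sum>l\<in>L. s (x \<otimes> inv l) * e l)" using S_comm[OF s _ True] by (simp add: mult.commute)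
      finally show ?thesis using conv_e_apply[OF True] by simp
    qed simp
  qed
  then show ?thesis using S_conv_e[OF s] by simp
qed

text \<open>Support in the coset \<open>k L\<close>; this is the grading of S by K/L.\<close>

definition homogeneous :: "('a \<Rightarrow> complex) \<Rightarrow> 'a \<Rightarrow> bool" where
  "homogeneous s k \<longleftrightarrow> (\<forall>x. s x \<noteq> 0 \<longrightarrow> x \<in> carrier G \<and> inv k \<otimes> x \<in> L)"

lemma homogeneous_lift: "homogeneous (lift T k) k"
  using lift_support by (auto simp: homogeneous_def)

lemma homogeneous_conv:
  assumes s: "homogeneous s k" and t: "homogeneous t k'" and k: "k \<in> carrier G" "k' \<in> carrier G"
  shows "homogeneous (s \<star> t) (k \<otimes> k')"
  unfolding homogeneous_def
proof (intro allI impI)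
  fix x assume nz: "(s \<star> t) x \<noteq> 0"
  then have x: "x \<in> carrier G" by (metis conv_outside)
  have "\<exists>y\<in>carrier G. s y * t (inv y \<otimes> x) \<noteq> 0" using nz unfolding conv_apply[OF x] by (meson sum.neutral)
  then obtain y where y: "y \<in> carrier G" "inv k \<otimes> y \<in> L" "inv k' \<otimes> (inv y \<otimes> x) \<in> L"
    using s t by (auto simp: homogeneous_def)
  have "(inv k' \<otimes> (inv k \<otimes> y) \<otimes> k') \<otimes> (inv k' \<otimes> (inv y \<otimes> x)) \<in> L" using y k by simp
  then have "inv (k \<otimes> k') \<otimes> x \<in> L" using y k x by (simp add: inv_mult_group m_assoc)
  then show "x \<in> carrier G \<and> inv (k \<otimes> k') \<otimes> x \<in> L" using x by simp
qed

lemma homogeneous_conj: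
  assumes s: "homogeneous s k" and k: "k \<in> carrier G" "h \<in> carrier G"
  shows "homogeneous (conj_elem G s h) (inv h \<otimes> k \<otimes> h)"
  unfolding homogeneous_def
proof (intro allI impI)
  fix x assume nz: "conj_elem G s h x \<noteq> 0"
  then have x: "x \<in> carrier G" unfolding conj_elem_def by (metis conv_outside)
  have "inv k \<otimes> (h \<otimes> x \<otimes> inv h) \<in> L" using nz s k x by (simp add: conj_elem_apply homogeneous_def)
  then have "inv h \<otimes> (inv k \<otimes> (h \<otimes> x \<otimes> inv h)) \<otimes> h \<in> L" using k by simp
  then have "inv (inv h \<otimes> k \<otimes> h) \<otimes> x \<in> L" using k x by (simp add: inv_mult_group m_assoc)
  then show "x \<in> carrier G \<and> inv (inv h \<otimes> k \<otimes> h) \<otimes> x \<in> L" using x by simp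
qed

text \<open>Each component of S is at most one-dimensional. Let \<open>Q\<close> be the image of
  k^-1 s under \<Phi>. As \<open>s\<close> commutes with \<open>L\<close>, the matrix
  \<open>Q\<close> satisfies the same intertwining relation as \<open>T\<close>; so
  \<open>T' * Q\<close> commutes with \<Phi> and is a scalar by Schur's lemma.\<close>

lemma homogeneous_S_eq_lift:
  assumes s: "s \<in> carrier S" and h: "homogeneous s k" and k: "k \<in> carrier G"
    and T: "intertwines T k" "T' \<in> carrier_mat d d" "T * T' = 1\<^sub>m d" "T' * T = 1\<^sub>m d"
  shows "\<exists>c. s = (\<lambda>x. c * lift T k x)"
proof -
  have Tc: "T \<in> carrier_mat d d" using T by (simp add: intertwines_def)
  define Q where "Q = msum d d (\<lambda>l. s (k \<otimes> l) \<cdot>\<^sub>m \<Phi> l) L"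
  have Q: "Q \<in> carrier_mat d d" by (simp add: Q_def)
  \<comment> \<open>The identity \<open>s \<star> e = s\<close> expresses the values of
    \<open>s\<close> on the coset as traces against \<Phi>, that is, through
    \<open>Q\<close>.\<close>
  have sQ: "s (k \<otimes> l) = wt * trace_mat (Q * \<Phi> (inv l))" if l: "l \<in> L" for l
  proof -
    have bij: "bij_betw (\<lambda>y. inv y \<otimes> l) L L"
      by (rule bij_betw_byWitness[of _ "\<lambda>y. l \<otimes> inv y"]) (use l in \<open>auto simp: inv_mult_group m_assoc\<close>)
    have "s (k \<otimes> l) = (s \<star> e) (k \<otimes> l)" using S_conv_e[OF s] by simp
    also have "\<dots> = (\<Sum>m\<in>L. s (k \<otimes> l \<otimes> inv m) * e m)" using l k by (intro conv_e_apply) auto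
    also have "\<dots> = (\<Sum>y\<in>L. s (k \<otimes> l \<otimes> inv (inv y \<otimes> l)) * e (inv y \<otimes> l))"
      by (rule sum.reindex_bij_betw[OF bij, symmetric])
    also have "\<dots> = (\<Sum>y\<in>L. s (k \<otimes> y) * (wt * trace_mat (\<Phi> y * \<Phi> (inv l))))"
    proof (rule sum.cong[OF refl])
      fix y assume y: "y \<in> L"
      have "e (inv y \<otimes> l) = wt * trace_mat (\<Phi> (inv l \<otimes> y))"
        using y l by (simp add: e_eq_lift lift_def inv_mult_group mult_mat_one_dim)
      also have "trace_mat (\<Phi> (inv l \<otimes> y)) = trace_mat (\<Phi> y * \<Phi> (inv l))"
        using y l trace_mat_comm[of "\<Phi> y" d d "\<Phi> (inv l)"] by (simp add: \<Phi>_mult)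
      moreover have "k \<otimes> l \<otimes> inv (inv y \<otimes> l) = k \<otimes> y" using y l k by (simp add: inv_mult_group m_assoc)
      ultimately show "s (k \<otimes> l \<otimes> inv (inv y \<otimes> l)) * e (inv y \<otimes> l) = s (k \<otimes> y) * (wt * trace_mat (\<Phi> y * \<Phi> (inv l)))" by simp
    qed
    also have "\<dots> = wt * (\<Sum>y\<in>L. trace_mat ((s (k \<otimes> y) \<cdot>\<^sub>m \<Phi> y) * \<Phi> (inv l)))"
      using l by (simp add: sum_distrib_left mult_smult_assoc_mat[of _ d d _ d] mult_ac cong: sum.cong)
    also have "(\<Sum>y\<in>L. trace_mat ((s (k \<otimes> y) \<cdot>\<^sub>m \<Phi> y) * \<Phi> (inv l))) = trace_mat (msum d d (\<lambda>y. (s (k \<otimes> y) \<cdot>\<^sub>m \<Phi> y) * \<Phi> (inv l)) L)"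
      using l by (intro trace_msum[symmetric]) (auto intro!: carrier_matI)
    also have "msum d d (\<lambda>y. (s (k \<otimes> y) \<cdot>\<^sub>m \<Phi> y) * \<Phi> (inv l)) L = Q * \<Phi> (inv l)"
      unfolding Q_def using l by (intro msum_mult[symmetric]) auto
    finally show ?thesis .
  qed
  have s_lift: "s = lift Q k"
  proof
    fix x
    show "s x = lift Q k x"
    proof (cases "x \<in> carrier G \<and> inv k \<otimes> x \<in> L")
      case True
      then have "x = k \<otimes> (inv k \<otimes> x)" using k by simp
      then show ?thesis using sQ[of "inv k \<otimes> x"] True lift_at[OF k, of "inv k \<otimes> x" Q] by simp
    next
      case False then show ?thesis using h by (auto simp: lift_def homogeneous_def)
    qed
  qed
  have intQ: "\<Phi> (inv k \<otimes> l \<otimes> k) * Q = Q * \<Phi> l" if l: "l \<in> L" for l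
  proof -
    let ?m = "inv k \<otimes> l \<otimes> k"
    have m: "?m \<in> L" using l k by simp
    have "\<Phi> ?m * Q = msum d d (\<lambda>y. \<Phi> ?m * (s (k \<otimes> y) \<cdot>\<^sub>m \<Phi> y)) L"
      unfolding Q_def using m by (intro mult_msum[of _ d d]) auto
    also have "\<dots> = msum d d (\<lambda>y. s (k \<otimes> y) \<cdot>\<^sub>m \<Phi> (?m \<otimes> y)) L"
      using m by (intro msum_cong refl) (simp add: \<Phi>_mult mult_smult_distrib[of _ d d _ d])
    also have "\<dots> = msum d d (\<lambda>y. s (k \<otimes> y) \<cdot>\<^sub>m \<Phi> (y \<otimes> l)) L"
    proof -
      \<comment> \<open>The substitution trades left multiplication by \<open>?m\<close> for right
        multiplication by \<open>l\<close>; the coefficients of \<open>s\<close> stay the same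
        because \<open>s\<close> commutes with \<open>l\<close>.\<close>
      have bij: "bij_betw (\<lambda>y. inv ?m \<otimes> (y \<otimes> l)) L L"
        by (rule bij_betw_byWitness[of _ "\<lambda>y. ?m \<otimes> y \<otimes> inv l"]) (use l m in \<open>auto simp: m_assoc simp del: conj_closed\<close>)
      have "msum d d (\<lambda>y. s (k \<otimes> y) \<cdot>\<^sub>m \<Phi> (?m \<otimes> y)) L
         = msum d d (\<lambda>y. s (k \<otimes> (inv ?m \<otimes> (y \<otimes> l))) \<cdot>\<^sub>m \<Phi> (?m \<otimes> (inv ?m \<otimes> (y \<otimes> l)))) L"
        by (rule msum_reindex[OF bij])
      also have "\<dots> = msum d d (\<lambda>y. s (k \<otimes> y) \<cdot>\<^sub>m \<Phi> (y \<otimes> l)) L"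
      proof (rule msum_cong[OF refl])
        fix y assume y: "y \<in> L"
        have "k \<otimes> (inv ?m \<otimes> (y \<otimes> l)) = inv l \<otimes> (k \<otimes> y \<otimes> l)" using k l y by (simp add: inv_mult_group m_assoc)
        also have "s \<dots> = s (k \<otimes> y \<otimes> l \<otimes> inv l)" using S_comm[OF s l] k y l by simp
        also have "k \<otimes> y \<otimes> l \<otimes> inv l = k \<otimes> y" using k y l by (simp add: m_assoc)
        finally have "s (k \<otimes> (inv ?m \<otimes> (y \<otimes> l))) = s (k \<otimes> y)" .
        moreover have "?m \<otimes> (inv ?m \<otimes> (y \<otimes> l)) = y \<otimes> l" using m y l by (intro inv_mult_cancel(2)) auto
        ultimately show "s (k \<otimes> (inv ?m \<otimes> (y \<otimes> l))) \<cdot>\<^sub>m \<Phi> (?m \<otimes> (inv ?m \<otimes> (y \<otimes> l))) = s (k \<otimes> y) \<cdot>\<^sub>m \<Phi> (y \<otimes> l)" by simp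
      qed
      finally show ?thesis .
    qed
    also have "\<dots> = msum d d (\<lambda>y. (s (k \<otimes> y) \<cdot>\<^sub>m \<Phi> y) * \<Phi> l) L"
      using l by (intro msum_cong refl) (simp add: \<Phi>_mult mult_smult_assoc_mat[of _ d d _ d])
    also have "\<dots> = Q * \<Phi> l" unfolding Q_def using l by (intro msum_mult[symmetric]) auto
    finally show ?thesis .
  qed
  have T'int: "intertwines T' (inv k)" by (rule intertwines_inverse[OF k T])
  have "\<Phi> g * (T' * Q) = (T' * Q) * \<Phi> g" if g: "g \<in> L" for g
  proof -
    let ?m = "inv k \<otimes> g \<otimes> k"
    have m: "?m \<in> L" "inv (inv k) \<otimes> ?m \<otimes> inv k = g" using g k conj_closed(1)[OF k g] by (simp_all add: m_assoc)
    have "\<Phi> g * T' = T' * \<Phi> ?m" using T'int m by (metis intertwines_def)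
    then have "\<Phi> g * T' * Q = T' * (\<Phi> ?m * Q)" using T(2) Q m(1) g by (simp add: mult_mat_assoc_dim)
    then show ?thesis using intQ[OF g] T(2) Q g by (simp add: mult_mat_assoc_dim)
  qed
  then obtain c where c: "T' * Q = c \<cdot>\<^sub>m 1\<^sub>m d"
    using P.schur_scalar[of "T' * Q"] T(2) Q by auto
  have "Q = T * (T' * Q)" using mat_cancel_left[OF T(3), of Q] T(2) Tc Q by simp
  also have "\<dots> = c \<cdot>\<^sub>m T" unfolding c using Tc by (simp add: mult_smult_distrib[of _ d d _ d] mult_mat_one_dim)
  finally have "Q = c \<cdot>\<^sub>m T" .
  then have "s = (\<lambda>x. c * lift T k x)" unfolding s_lift
    using Tc k by (auto simp: lift_def mult_smult_assoc_mat[of _ d d _ d] intro!: ext)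
  then show ?thesis by blast
qed

text \<open>The coset \<open>k L\<close> is stable under multiplication by \<open>L\<close> on
  either side, so the conditions that define S survive the truncation.\<close>

lemma S_component:
  assumes s: "s \<in> carrier S" and k: "k \<in> carrier G"
  shows "(\<lambda>x. if x \<in> carrier G \<and> inv k \<otimes> x \<in> L then s x else 0) \<in> carrier S" (is "?t \<in> _")
  unfolding mem_S_iff
proof (intro conjI allI impI ballI)
  fix x show "?t x = 0" if "x \<notin> K" using that S_support[OF s] by auto
next
  fix l x assume l: "l \<in> L" and x: "x \<in> carrier G"
  let ?z = "inv k \<otimes> x"
  have z1: "inv k \<otimes> (inv l \<otimes> x) = (inv k \<otimes> inv l \<otimes> k) \<otimes> ?z" using k l x by (simp add: m_assoc)
  have z2: "inv k \<otimes> (x \<otimes> inv l) = ?z \<otimes> inv l" using k l x by (simp add: m_assoc)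
  have m: "inv k \<otimes> inv l \<otimes> k \<in> L" using k l by simp
  have "(inv k \<otimes> inv l \<otimes> k) \<otimes> ?z \<in> L \<longleftrightarrow> ?z \<in> L"
    using m k l x by (metis L_carrier L_closed(1,2) inv_closed inv_mult_cancel(1) m_closed)
  moreover have "?z \<otimes> inv l \<in> L \<longleftrightarrow> ?z \<in> L"
  proof
    assume h: "?z \<otimes> inv l \<in> L"
    have "?z \<otimes> inv l \<otimes> l \<in> L" by (rule L_closed(1)[OF h l])
    then show "?z \<in> L" using k x l by (simp add: m_assoc)
  qed (use l in auto)
  ultimately show "?t (inv l \<otimes> x) = ?t (x \<otimes> inv l)" unfolding z1 z2 using S_comm[OF s l x] x l by simp
next
  show "?t \<star> e = ?t"
  proof
    fix x
    show "(?t \<star> e) x = ?t x"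
    proof (cases "x \<in> carrier G")
      case x: True
      have "inv k \<otimes> (x \<otimes> inv l) \<in> L \<longleftrightarrow> inv k \<otimes> x \<in> L" if l: "l \<in> L" for l
      proof
        assume h: "inv k \<otimes> (x \<otimes> inv l) \<in> L"
        have "inv k \<otimes> (x \<otimes> inv l) \<otimes> l \<in> L" by (rule L_closed(1)[OF h l])
        then show "inv k \<otimes> x \<in> L" using k x l by (simp add: m_assoc)
      next
        assume h: "inv k \<otimes> x \<in> L"
        have "inv k \<otimes> x \<otimes> inv l \<in> L" by (rule L_closed(1)[OF h L_closed(2)[OF l]])
        then show "inv k \<otimes> (x \<otimes> inv l) \<in> L" using k x l by (simp add: m_assoc)
      qed
      then have "(?t \<star> e) x = (if inv k \<otimes> x \<in> L then (s \<star> e) x else 0)"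
        using x by (simp add: conv_e_apply cong: sum.cong)
      then show ?thesis using S_conv_e[OF s] x by simp
    qed simp
  qed
qed

text \<open>The sum runs over elements and not over cosets, so each \<open>x\<close> in
  \<open>K\<close> is met once for every \<open>k\<close> in \<open>x L\<close>, that is |L|
  times.\<close>

lemma S_eq_sum_components:
  assumes s: "s \<in> carrier S"
  shows "s = (\<lambda>x. 1 / of_nat (card L) * (\<Sum>k\<in>K. if x \<in> carrier G \<and> inv k \<otimes> x \<in> L then s x else 0))"
proof
  fix x
  have finK: "finite K" using finite_group K.subset finite_subset by blast
  show "s x = 1 / of_nat (card L) * (\<Sum>k\<in>K. if x \<in> carrier G \<and> inv k \<otimes> x \<in> L then s x else 0)"
  proof (cases "x \<in> K")
    case True
    have "bij_betw (\<lambda>l. x \<otimes> l) L {k \<in> K. inv k \<otimes> x \<in> L}"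
    proof (rule bij_betw_byWitness[of _ "\<lambda>k. inv x \<otimes> k"])
      show "(\<lambda>l. x \<otimes> l) ` L \<subseteq> {k \<in> K. inv k \<otimes> x \<in> L}"
        using True L_sub_K by (auto simp: inv_mult_group m_assoc)
      show "(\<lambda>k. inv x \<otimes> k) ` {k \<in> K. inv k \<otimes> x \<in> L} \<subseteq> L"
      proof safe
        fix k assume "k \<in> K" and h: "inv k \<otimes> x \<in> L"
        have "inv (inv k \<otimes> x) \<in> L" by (rule L_closed(2)[OF h])
        then show "inv x \<otimes> k \<in> L" using \<open>k \<in> K\<close> True by (simp add: inv_mult_group)
      qed
    qed (use True in auto)
    then have "card {k \<in> K. inv k \<otimes> x \<in> L} = card L" by (simp add: bij_betw_same_card)
    moreover have "(\<Sum>k\<in>K. if x \<in> carrier G \<and> inv k \<otimes> x \<in> L then s x else 0) = of_nat (card {k \<in> K. inv k \<otimes> x \<in> L}) * s x"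
      using True sum.inter_filter[OF finK, of "\<lambda>_. s x" "\<lambda>k. inv k \<otimes> x \<in> L"] by simp
    ultimately show ?thesis using card_L_pos by simp
  next
    case False
    then have "s x = 0" using S_support[OF s] by auto
    then show ?thesis by simp
  qed
qed

end

text \<open>Commuting with the matrix units already forces this, entry by entry.\<close>

lemma commutes_all_imp_scalar:
  assumes Z: "Z \<in> carrier_mat n n" and comm: "\<And>A. A \<in> carrier_mat n n \<Longrightarrow> Z * A = A * Z"
  obtains c where "Z = c \<cdot>\<^sub>m (1\<^sub>m n :: complex mat)"
proof -
  have e: "Z $$ (a, i) * 1\<^sub>m n $$ (j, b) = 1\<^sub>m n $$ (a, i) * Z $$ (j, b)" if "a < n" "i < n" "j < n" "b < n" for a i j b
  proof -
    have "Z * elem_mat n n i j * 1\<^sub>m n = 1\<^sub>m n * elem_mat n n i j * Z"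
      using comm[of "elem_mat n n i j"] Z by (simp add: mult_mat_one_dim elem_mat_def)
    then have "(Z * elem_mat n n i j * 1\<^sub>m n) $$ (a, b) = (1\<^sub>m n * elem_mat n n i j * Z) $$ (a, b)" by simp
    then show ?thesis using that Z by (simp only: mult_elem_mat_mult_index[of _ n n _ n n] one_carrier_mat)
  qed
  have "Z = Z $$ (0, 0) \<cdot>\<^sub>m 1\<^sub>m n"
  proof (rule eq_matI)
    fix i j assume "i < dim_row (Z $$ (0, 0) \<cdot>\<^sub>m 1\<^sub>m n)" "j < dim_col (Z $$ (0, 0) \<cdot>\<^sub>m 1\<^sub>m n)"
    then have ij: "i < n" "j < n" by auto
    then have n: "0 < n" by simp
    show "Z $$ (i, j) = (Z $$ (0, 0) \<cdot>\<^sub>m 1\<^sub>m n) $$ (i, j)"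
    proof (cases "i = j")
      case True
      then show ?thesis using e[OF ij(1) ij(1) n n] ij by simp
    next
      case False
      then show ?thesis using e[OF ij(1) ij(2) n n] ij n by simp
    qed
  qed (use Z in auto)
  then show ?thesis by (rule that)
qed

lemma complex_nth_root_exists: "n > 0 \<Longrightarrow> \<exists>a. a ^ n = (z::complex)"
proof -
  assume "n > 0"
  then have "rcis (root n (cmod z)) (Arg z / real n) ^ n = rcis (cmod z) (Arg z)" by (simp add: DeMoivre2)
  then show ?thesis using rcis_cmod_Arg by metis
qed

lemma mult_smult_dim: "dim_col A = dim_row B \<Longrightarrow> A * (c \<cdot>\<^sub>m B) = (c :: complex) \<cdot>\<^sub>m (A * B)"
  by (rule mult_smult_distrib[of A "dim_row A" "dim_col A" B "dim_col B"]) auto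

lemma smult_mult_dim: "dim_col A = dim_row B \<Longrightarrow> (c \<cdot>\<^sub>m A) * B = (c :: complex) \<cdot>\<^sub>m (A * B)"
  by (rule mult_smult_assoc_mat[of A "dim_row A" "dim_col A" B "dim_col B"]) auto

section \<open>S as a full matrix algebra\<close>

locale five_matrix = five_algebra G L d \<Phi> K \<phi>
  for G :: "('a, 'b) monoid_scheme" (structure) and L d \<Phi> K \<phi> +
  fixes n :: nat and \<tau> :: "('a \<Rightarrow> complex) \<Rightarrow> complex mat"
  assumes n_square: "n\<^sup>2 * card L = card K"
    and \<tau>_iso: "\<tau> \<in> ring_iso (S_alg G K L \<phi>) (ring_mat TYPE(complex) n ())"
    and \<tau>_scale: "\<And>c s. s \<in> carrier (S_alg G K L \<phi>) \<Longrightarrow> \<tau> (\<lambda>x. c * s x) = c \<cdot>\<^sub>m \<tau> s"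
begin

lemma finite_K: "finite K"
  using finite_group K.subset finite_subset by blast

lemma n_pos: "n > 0"
proof -
  have "K \<noteq> {}" using K.one_closed by blast
  then have "card K > 0" using finite_K by (simp add: card_gt_0_iff)
  then show ?thesis using n_square by (cases "n = 0") auto
qed

lemma \<tau>_carrier [simp]: "s \<in> carrier S \<Longrightarrow> \<tau> s \<in> carrier_mat n n" "s \<in> carrier S \<Longrightarrow> dim_row (\<tau> s) = n" "s \<in> carrier S \<Longrightarrow> dim_col (\<tau> s) = n"
proof -
  show c: "s \<in> carrier S \<Longrightarrow> \<tau> s \<in> carrier_mat n n"
    using \<tau>_iso by (auto simp: ring_iso_def Ring.ring_hom_def ring_mat_simps)
  show "s \<in> carrier S \<Longrightarrow> dim_row (\<tau> s) = n" "s \<in> carrier S \<Longrightarrow> dim_col (\<tau> s) = n" using c by auto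
qed

lemma \<tau>_conv: "s \<in> carrier S \<Longrightarrow> t \<in> carrier S \<Longrightarrow> \<tau> (s \<star> t) = \<tau> s * \<tau> t"
  using \<tau>_iso by (auto simp: ring_iso_def Ring.ring_hom_def ring_mat_simps)

lemma \<tau>_add: "s \<in> carrier S \<Longrightarrow> t \<in> carrier S \<Longrightarrow> \<tau> (\<lambda>x. s x + t x) = \<tau> s + \<tau> t"
  using \<tau>_iso by (auto simp: ring_iso_def Ring.ring_hom_def ring_mat_simps)

lemma \<tau>_e: "\<tau> e = 1\<^sub>m n"
  using \<tau>_iso by (auto simp: ring_iso_def Ring.ring_hom_def ring_mat_simps)

lemma \<tau>_bij: "bij_betw \<tau> (carrier S) (carrier_mat n n)"
  using \<tau>_iso by (auto simp: ring_iso_def ring_mat_simps)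

lemma S_scale [simp]: "s \<in> carrier S \<Longrightarrow> (\<lambda>x. c * s x) \<in> carrier S"
  unfolding mem_S_iff by (auto simp: conv_scale_left)

lemma S_add [simp]: "s \<in> carrier S \<Longrightarrow> t \<in> carrier S \<Longrightarrow> (\<lambda>x. s x + t x) \<in> carrier S"
  unfolding mem_S_iff
proof (elim conjE, intro conjI allI impI ballI)
  assume "s \<star> e = s" "t \<star> e = t"
  moreover have "(\<lambda>x. s x + t x) \<star> e = (\<lambda>x. (s \<star> e) x + (t \<star> e) x)"
    by (auto simp: group_algebra_def sum.distrib algebra_simps)
  ultimately show "(\<lambda>x. s x + t x) \<star> e = (\<lambda>x. s x + t x)" by simp
qed auto

lemma \<tau>_sum:
  assumes "finite A" "\<And>a. a \<in> A \<Longrightarrow> s a \<in> carrier S"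
  shows "(\<lambda>x. \<Sum>a\<in>A. s a x) \<in> carrier S \<and> \<tau> (\<lambda>x. \<Sum>a\<in>A. s a x) = msum n n (\<lambda>a. \<tau> (s a)) A"
  using assms
proof (induction A rule: finite_induct)
  case empty
  have z: "(\<lambda>x. 0) = (\<lambda>x. 0 * e x)" by simp
  have "\<tau> (\<lambda>x. 0) = 0 \<cdot>\<^sub>m \<tau> e" unfolding z by (rule \<tau>_scale) (rule e_in_S)
  also have "\<dots> = 0\<^sub>m n n" unfolding \<tau>_e by (rule eq_matI) auto
  finally show ?case using S_scale[OF e_in_S, of 0] by simp
next
  case (insert a A)
  then show ?case using \<tau>_add[of "s a" "\<lambda>x. \<Sum>a\<in>A. s a x"] S_add[of "s a" "\<lambda>x. \<Sum>a\<in>A. s a x"]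
    by (simp add: msum_insert)
qed

text \<open>Transported to the matrix algebra, the coefficient at the identity is a linear
  functional that vanishes on commutators, so it is a multiple of the trace. The multiple is not
  zero because \<open>e\<close> has a nonzero coefficient there.\<close>

lemma trace_\<tau>:
  "\<exists>z. z \<noteq> 0 \<and> (\<forall>s\<in>carrier S. s \<one> = z * trace_mat (\<tau> s))"
proof -
  define \<kappa> where "\<kappa> = inv_into (carrier S) \<tau>"
  have \<kappa>: "\<kappa> A \<in> carrier S" "\<tau> (\<kappa> A) = A" if "A \<in> carrier_mat n n" for A
    using \<tau>_bij that unfolding \<kappa>_def by (auto simp: bij_betw_def inv_into_into f_inv_into_f)
  have \<kappa>': "\<kappa> (\<tau> s) = s" if "s \<in> carrier S" for s
    using \<tau>_bij that unfolding \<kappa>_def by (auto simp: bij_betw_def)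
  define f where "f A = \<kappa> A \<one>" for A
  have add: "f (A + B) = f A + f B" if "A \<in> carrier_mat n n" "B \<in> carrier_mat n n" for A B
  proof -
    have "\<kappa> (A + B) = (\<lambda>x. \<kappa> A x + \<kappa> B x)"
      using \<kappa>'[OF S_add[OF \<kappa>(1)[OF that(1)] \<kappa>(1)[OF that(2)]]] \<tau>_add[OF \<kappa>(1)[OF that(1)] \<kappa>(1)[OF that(2)]] \<kappa>(2)[OF that(1)] \<kappa>(2)[OF that(2)]
      by simp
    then show ?thesis by (simp add: f_def)
  qed
  have sm: "f (c \<cdot>\<^sub>m A) = c * f A" if "A \<in> carrier_mat n n" for A c
  proof -
    have "\<kappa> (c \<cdot>\<^sub>m A) = (\<lambda>x. c * \<kappa> A x)"
      using \<kappa>'[OF S_scale[OF \<kappa>(1)[OF that]]] \<tau>_scale[OF \<kappa>(1)[OF that]] \<kappa>(2)[OF that] by simp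
    then show ?thesis by (simp add: f_def)
  qed
  have comm: "f (A * B) = f (B * A)" if "A \<in> carrier_mat n n" "B \<in> carrier_mat n n" for A B
  proof -
    have "\<kappa> (A * B) = \<kappa> A \<star> \<kappa> B" if "A \<in> carrier_mat n n" "B \<in> carrier_mat n n" for A B
      using \<kappa>'[OF S_closed[OF \<kappa>(1)[OF that(1)] \<kappa>(1)[OF that(2)]]] \<tau>_conv[OF \<kappa>(1)[OF that(1)] \<kappa>(1)[OF that(2)]] \<kappa>(2)[OF that(1)] \<kappa>(2)[OF that(2)]
      by simp
    then show ?thesis using that conv_at_one_commute by (simp add: f_def)
  qed
  define z where "z = f (elem_mat n n 0 0)"
  have tr: "s \<one> = z * trace_mat (\<tau> s)" if "s \<in> carrier S" for s
  proof -
    have "f (\<tau> s) = z * trace_mat (\<tau> s)" unfolding z_def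
      by (rule trace_functional_unique[OF add sm comm]) (use that in auto)
    then show ?thesis using that by (simp add: f_def \<kappa>')
  qed
  have "e \<one> = z * of_nat n" using tr[OF e_in_S] by (simp add: \<tau>_e)
  moreover have "e \<one> = wt * of_nat d" by (simp add: e_eq_lift lift_def mult_mat_one_dim)
  ultimately have "z \<noteq> 0" using wt_nonzero P.dim_pos by auto
  then show ?thesis using tr by blast
qed

text \<open>The coset \<open>k L\<close> does not contain the identity, whose coefficient computes
  the trace.\<close>

lemma trace_homogeneous_zero:
  assumes "s \<in> carrier S" "homogeneous s k" "k \<in> carrier G" "k \<notin> L"
  shows "trace_mat (\<tau> s) = 0"
proof -
  obtain z where z: "z \<noteq> 0" "\<forall>s\<in>carrier S. s \<one> = z * trace_mat (\<tau> s)" using trace_\<tau> by blast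
  have "inv k \<notin> L" using assms(3,4) L_closed(2)[of "inv k"] by auto
  then have "s \<one> = 0" using assms(2,3) by (auto simp: homogeneous_def)
  then show ?thesis using z assms(1) by auto
qed

text \<open>The sums below run over \<open>K\<close> instead of \<open>K/L\<close>, which multiplies them by \<open>|L|\<close> and avoids choosing
  coset representatives.\<close>

definition sl_part :: "'a \<Rightarrow> complex mat set" where
  "sl_part k = {A. \<exists>s\<in>carrier S. homogeneous s k \<and> A = \<tau> s \<and> Determinant.det A = 1}"

lemma sl_partI: "s \<in> carrier S \<Longrightarrow> homogeneous s k \<Longrightarrow> A = \<tau> s \<Longrightarrow> Determinant.det A = 1 \<Longrightarrow> A \<in> sl_part k"
  unfolding sl_part_def by blast

lemma sl_part_carrier [simp]: "A \<in> sl_part k \<Longrightarrow> A \<in> carrier_mat n n" "A \<in> sl_part k \<Longrightarrow> dim_row A = n" "A \<in> sl_part k \<Longrightarrow> dim_col A = n"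
  by (auto simp: sl_part_def)

lemma sl_part_mult:
  assumes "A \<in> sl_part k" "B \<in> sl_part k'" "k \<in> carrier G" "k' \<in> carrier G"
  shows "A * B \<in> sl_part (k \<otimes> k')"
proof -
  obtain s t where st: "s \<in> carrier S" "homogeneous s k" "A = \<tau> s" "t \<in> carrier S" "homogeneous t k'" "B = \<tau> t"
    "Determinant.det A = 1" "Determinant.det B = 1" using assms(1,2) by (auto simp: sl_part_def)
  have "A * B = \<tau> (s \<star> t)" using st by (simp add: \<tau>_conv)
  moreover have "Determinant.det (A * B) = 1" using st det_mult[of A n B] by simp
  ultimately show ?thesis
    by (intro sl_partI[OF S_closed[OF st(1,4)] homogeneous_conv[OF st(2,5) assms(3,4)]])
qed

text \<open>Both elements are multiples of the lift of one intertwining matrix.\<close>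

lemma homogeneous_proportional:
  assumes s: "s \<in> carrier S" "homogeneous s k" and t: "t \<in> carrier S" "homogeneous t k" and k: "k \<in> carrier G"
    and nz: "\<tau> t \<noteq> 0\<^sub>m n n"
  shows "\<exists>c. \<tau> s = c \<cdot>\<^sub>m \<tau> t"
proof -
  obtain T T' where T: "intertwines T k" "T' \<in> carrier_mat d d" "T * T' = 1\<^sub>m d" "T' * T = 1\<^sub>m d"
    using exists_intertwiner[OF k] .
  obtain a where a: "s = (\<lambda>x. a * lift T k x)" using homogeneous_S_eq_lift[OF s k T] by blast
  obtain b where b: "t = (\<lambda>x. b * lift T k x)" using homogeneous_S_eq_lift[OF t k T] by blast
  have "b \<noteq> 0"
  proof
    assume "b = 0"
    then have "t = (\<lambda>x. 0 * t x)" using b by simp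
    then have "\<tau> t = 0 \<cdot>\<^sub>m \<tau> t" using \<tau>_scale[OF t(1), of 0] by simp
    also have "\<dots> = 0\<^sub>m n n" using t(1) by (intro eq_matI) auto
    finally show False using nz by simp
  qed
  then have "s = (\<lambda>x. (a / b) * t x)" using a b by auto
  then have "\<tau> s = (a / b) \<cdot>\<^sub>m \<tau> t" using \<tau>_scale[OF t(1), of "a / b"] by simp
  then show ?thesis by blast
qed

lemma det_one_nonzero: "A \<in> carrier_mat n n \<Longrightarrow> Determinant.det A = (1::complex) \<Longrightarrow> A \<noteq> 0\<^sub>m n n"
  using n_pos by auto

text \<open>Proportional matrices of determinant 1 differ by an \<open>n\<close>-th root of unity.
  This is the origin of the ring \<int>[\<zeta>].\<close>

lemma sl_part_unique:
  assumes A: "A \<in> sl_part k" and B: "B \<in> sl_part k" and k: "k \<in> carrier G"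
  obtains c where "A = c \<cdot>\<^sub>m B" "c ^ n = 1"
proof -
  obtain s t where st: "s \<in> carrier S" "homogeneous s k" "A = \<tau> s" "t \<in> carrier S" "homogeneous t k" "B = \<tau> t"
    "Determinant.det A = 1" "Determinant.det B = 1" using A B by (auto simp: sl_part_def)
  obtain c where c: "A = c \<cdot>\<^sub>m B"
    using homogeneous_proportional[OF st(1,2,4,5) k] det_one_nonzero[of B] st by auto
  have "Determinant.det A = c ^ n * Determinant.det B" unfolding c using st by simp
  then have "c ^ n = 1" using st by simp
  then show ?thesis using c that by blast
qed

lemma one_in_sl_part: "l \<in> L \<Longrightarrow> 1\<^sub>m n \<in> sl_part l"
  using e_support by (intro sl_partI[OF e_in_S]) (auto simp: homogeneous_def \<tau>_e)

text \<open>The trace is zero for \<open>k\<close> outside \<open>L\<close>; for \<open>k\<close> in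
  \<open>L\<close> the matrix is an \<open>n\<close>-th root of unity times the identity.\<close>

lemma trace_sl_part:
  assumes A: "A \<in> sl_part k" and k: "k \<in> carrier G"
  shows "trace_mat A \<in> int_adj (cis (2 * pi / real n))"
proof (cases "k \<in> L")
  case True
  obtain c where c: "A = c \<cdot>\<^sub>m 1\<^sub>m n" "c ^ n = 1" using sl_part_unique[OF A one_in_sl_part[OF True] k] .
  have "trace_mat A = c * of_nat n" using c by simp
  then show ?thesis using root_of_unity_in_int_adj[OF c(2) n_pos] by auto
next
  case False
  have "trace_mat A = 0" using A trace_homogeneous_zero[OF _ _ k False] by (auto simp: sl_part_def)
  then show ?thesis by auto
qed

text \<open>An intertwining matrix and its inverse lift to mutually inverse units, which an
  \<open>n\<close>-th root of the inverse determinant scales to determinant 1.\<close>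

lemma sl_part_exists:
  assumes k: "k \<in> K"
  shows "\<exists>A\<in>sl_part k. \<exists>B\<in>sl_part (inv k). A * B = 1\<^sub>m n \<and> B * A = 1\<^sub>m n"
proof -
  have kG: "k \<in> carrier G" and ik: "inv k \<in> K" using k by auto
  obtain T T' where T: "intertwines T k" "T' \<in> carrier_mat d d" "T * T' = 1\<^sub>m d" "T' * T = 1\<^sub>m d"
    using exists_intertwiner[OF kG] .
  have T': "intertwines T' (inv k)" by (rule intertwines_inverse[OF kG T])
  have Tc: "T \<in> carrier_mat d d" using T(1) by (simp add: intertwines_def)
  let ?v = "lift T k" and ?w = "lift T' (inv k)"
  have v: "?v \<in> carrier S" by (rule lift_in_S[OF k T(1)])
  have w: "?w \<in> carrier S" by (rule lift_in_S[OF ik T'])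
  have "?v \<star> ?w = e" using lift_conv_lift[OF Tc T' kG] T kG by (simp add: e_eq_lift)
  then have vw: "\<tau> ?v * \<tau> ?w = 1\<^sub>m n" using \<tau>_conv[OF v w] \<tau>_e by simp
  have "?w \<star> ?v = e" using lift_conv_lift[OF T(2) T(1)] T kG by (simp add: e_eq_lift)
  then have wv: "\<tau> ?w * \<tau> ?v = 1\<^sub>m n" using \<tau>_conv[OF w v] \<tau>_e by simp
  define D where "D = Determinant.det (\<tau> ?v)"
  have Dw: "D * Determinant.det (\<tau> ?w) = 1"
    using det_mult[of "\<tau> ?v" n "\<tau> ?w"] v w vw by (simp add: D_def)
  then have "D \<noteq> 0" by auto
  obtain a where a: "a ^ n = inverse D" using complex_nth_root_exists[OF n_pos] by blast
  have a0: "a \<noteq> 0" using a \<open>D \<noteq> 0\<close> n_pos by (auto simp: power_0_left)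
  define A where "A = a \<cdot>\<^sub>m \<tau> ?v"
  define B where "B = inverse a \<cdot>\<^sub>m \<tau> ?w"
  have AB: "A * B = 1\<^sub>m n" "B * A = 1\<^sub>m n" unfolding A_def B_def using v w vw wv a0
    by (simp_all add: smult_mult_dim mult_smult_dim smult_smult_mat)
  have At: "A = \<tau> (\<lambda>x. a * ?v x)" "B = \<tau> (\<lambda>x. inverse a * ?w x)"
    unfolding A_def B_def using \<tau>_scale v w by simp_all
  have hom: "homogeneous (\<lambda>x. a * ?v x) k" "homogeneous (\<lambda>x. inverse a * ?w x) (inv k)"
    using homogeneous_lift[of T k] homogeneous_lift[of T' "inv k"] by (auto simp: homogeneous_def)
  have dA: "Determinant.det A = 1" unfolding A_def using a v \<open>D \<noteq> 0\<close> by (simp add: D_def)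
  have dB: "Determinant.det B = 1"
  proof -
    have "Determinant.det B = D * Determinant.det (\<tau> ?w)" unfolding B_def using a w by (simp add: power_inverse)
    then show ?thesis using Dw by simp
  qed
  have "A \<in> sl_part k" by (rule sl_partI[OF S_scale[OF v] hom(1) At(1) dA])
  moreover have "B \<in> sl_part (inv k)" by (rule sl_partI[OF S_scale[OF w] hom(2) At(2) dB])
  ultimately show ?thesis using AB by (intro bexI[of _ A] bexI[of _ B] conjI)
qed

text \<open>One unit for each element of \<open>K\<close>, not for each coset; on a coset of
  \<open>L\<close> the values agree up to \<open>n\<close>-th roots of unity.\<close>

definition M :: "'a \<Rightarrow> complex mat" where
  "M k = (SOME A. A \<in> sl_part k \<and> (\<exists>B\<in>sl_part (inv k). A * B = 1\<^sub>m n \<and> B * A = 1\<^sub>m n))"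

definition M' :: "'a \<Rightarrow> complex mat" where
  "M' k = (SOME B. B \<in> sl_part (inv k) \<and> M k * B = 1\<^sub>m n \<and> B * M k = 1\<^sub>m n)"

lemma M: "k \<in> K \<Longrightarrow> M k \<in> sl_part k"
  and M': "k \<in> K \<Longrightarrow> M' k \<in> sl_part (inv k)"
  and MM': "k \<in> K \<Longrightarrow> M k * M' k = 1\<^sub>m n" "k \<in> K \<Longrightarrow> M' k * M k = 1\<^sub>m n"
proof -
  have 1: "M k \<in> sl_part k \<and> (\<exists>B\<in>sl_part (inv k). M k * B = 1\<^sub>m n \<and> B * M k = 1\<^sub>m n)" if "k \<in> K" for k
    unfolding M_def by (rule someI_ex) (use sl_part_exists[OF that] in blast)
  have 2: "M' k \<in> sl_part (inv k) \<and> M k * M' k = 1\<^sub>m n \<and> M' k * M k = 1\<^sub>m n" if "k \<in> K" for k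
    unfolding M'_def by (rule someI_ex) (use 1[OF that] in blast)
  show "k \<in> K \<Longrightarrow> M k \<in> sl_part k" "k \<in> K \<Longrightarrow> M' k \<in> sl_part (inv k)"
    "k \<in> K \<Longrightarrow> M k * M' k = 1\<^sub>m n" "k \<in> K \<Longrightarrow> M' k * M k = 1\<^sub>m n" using 1 2 by blast+
qed

lemma M_carrier [simp]: "k \<in> K \<Longrightarrow> M k \<in> carrier_mat n n" "k \<in> K \<Longrightarrow> dim_row (M k) = n" "k \<in> K \<Longrightarrow> dim_col (M k) = n"
  "k \<in> K \<Longrightarrow> M' k \<in> carrier_mat n n" "k \<in> K \<Longrightarrow> dim_row (M' k) = n" "k \<in> K \<Longrightarrow> dim_col (M' k) = n"
  using M[of k] M'[of k] by auto

text \<open>The \<open>M k\<close> span the matrix algebra, because S is the sum of its components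
  and each of these is spanned by one \<open>M k\<close>. So \<open>Z\<close> is central.\<close>

lemma commutes_M_imp_scalar:
  assumes Z: "Z \<in> carrier_mat n n" and comm: "\<And>k. k \<in> K \<Longrightarrow> Z * M k = M k * Z"
  obtains c where "Z = c \<cdot>\<^sub>m 1\<^sub>m n"
proof (rule commutes_all_imp_scalar[OF Z])
  fix A :: "complex mat" assume "A \<in> carrier_mat n n"
  then obtain s where s: "s \<in> carrier S" "A = \<tau> s" using \<tau>_bij by (auto simp: bij_betw_def)
  define t where "t k = (\<lambda>x. if x \<in> carrier G \<and> inv k \<otimes> x \<in> L then s x else 0)" for k
  have t: "t k \<in> carrier S" "homogeneous (t k) k" if "k \<in> K" for k
    using S_component[OF s(1), of k] that by (auto simp: t_def homogeneous_def)
  have tS: "(\<lambda>x. \<Sum>k\<in>K. t k x) \<in> carrier S" "\<tau> (\<lambda>x. \<Sum>k\<in>K. t k x) = msum n n (\<lambda>k. \<tau> (t k)) K"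
    using \<tau>_sum[OF finite_K, of t] t by auto
  have "s = (\<lambda>x. 1 / of_nat (card L) * (\<Sum>k\<in>K. t k x))"
    using S_eq_sum_components[OF s(1)] unfolding t_def .
  then have A: "A = (1 / of_nat (card L)) \<cdot>\<^sub>m msum n n (\<lambda>k. \<tau> (t k)) K"
    using \<tau>_scale[OF tS(1)] tS(2) s(2) by metis
  have c: "Z * \<tau> (t k) = \<tau> (t k) * Z" if k: "k \<in> K" for k
  proof -
    obtain u where u: "u \<in> carrier S" "homogeneous u k" "M k = \<tau> u" "Determinant.det (M k) = 1"
      using M[OF k] by (auto simp: sl_part_def)
    obtain c where c: "\<tau> (t k) = c \<cdot>\<^sub>m M k"
      using homogeneous_proportional[OF t[OF k] u(1,2)] k u det_one_nonzero[of "M k"] by auto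
    show ?thesis unfolding c using comm[OF k] k Z
      by (simp add: smult_mult_dim mult_smult_dim)
  qed
  have "Z * msum n n (\<lambda>k. \<tau> (t k)) K = msum n n (\<lambda>k. Z * \<tau> (t k)) K"
    using Z t by (intro mult_msum) auto
  also have "\<dots> = msum n n (\<lambda>k. \<tau> (t k) * Z) K" by (intro msum_cong refl c)
  also have "\<dots> = msum n n (\<lambda>k. \<tau> (t k)) K * Z" using Z t by (intro msum_mult[symmetric]) auto
  finally show "Z * A = A * Z" unfolding A using Z
    by (simp add: smult_mult_dim mult_smult_dim)
qed (use that in blast)

text \<open>\<open>M\<close> is multiplicative up to \<open>n\<close>-th roots of unity, and these
  cancel in a conjugation.\<close>

lemma M_mult_M:
  assumes k: "k \<in> K" and y: "y \<in> K" and T: "T \<in> carrier_mat n n"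
  shows "M' y * (M' k * T * M k) * M y = M' (k \<otimes> y) * T * M (k \<otimes> y)"
proof -
  have ky: "k \<otimes> y \<in> K" using k y by simp
  obtain c where c: "M k * M y = c \<cdot>\<^sub>m M (k \<otimes> y)" "c ^ n = 1"
    using sl_part_unique[OF sl_part_mult[OF M[OF k] M[OF y]] M[OF ky]] k y by auto
  have c0: "c \<noteq> 0" using root_of_unity_nonzero[OF c(2) n_pos] .
  have "M' y * M' k * (M k * M y) = 1\<^sub>m n"
    using k y by (simp add: mult_mat_assoc_dim mat_cancel_left[OF MM'(2)] MM')
  then have "c \<cdot>\<^sub>m (M' y * M' k * M (k \<otimes> y)) = 1\<^sub>m n" unfolding c using k y ky
    by (simp add: mult_smult_dim mult_mat_assoc_dim)
  then have "c \<cdot>\<^sub>m (M' y * M' k * M (k \<otimes> y)) * M' (k \<otimes> y) = M' (k \<otimes> y)" using ky by (simp add: mult_mat_one_dim)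
  moreover have "c \<cdot>\<^sub>m (M' y * M' k * M (k \<otimes> y)) * M' (k \<otimes> y) = c \<cdot>\<^sub>m (M' y * M' k * (M (k \<otimes> y) * M' (k \<otimes> y)))"
    using k y ky by (simp add: smult_mult_dim mult_mat_assoc_dim)
  ultimately have i: "c \<cdot>\<^sub>m (M' y * M' k) = M' (k \<otimes> y)" using k y ky by (simp add: MM' mult_mat_one_dim)
  have "M' y * (M' k * T * M k) * M y = M' y * M' k * T * (M k * M y)"
    using k y T by (simp add: mult_mat_assoc_dim)
  also have "\<dots> = c \<cdot>\<^sub>m (M' y * M' k) * T * M (k \<otimes> y)" unfolding c using k y ky T
    by (simp add: mult_smult_dim smult_mult_dim mult_mat_assoc_dim)
  finally show ?thesis unfolding i .
qed

text \<open>The sum is invariant under conjugation by every \<open>M y\<close>, so it is scalar.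
  Comparing traces, with |K| = n^2 |L| equal terms on one side and the trace \<open>n\<close> of the
  identity on the other, gives the constant n |L|.\<close>

lemma average_M:
  assumes T: "T \<in> carrier_mat n n"
  shows "msum n n (\<lambda>k. M' k * T * M k) K = (of_nat n * of_nat (card L) * trace_mat T) \<cdot>\<^sub>m 1\<^sub>m n"
proof -
  let ?f = "\<lambda>k. M' k * T * M k"
  let ?X = "msum n n ?f K"
  have f: "?f k \<in> carrier_mat n n" if "k \<in> K" for k using that T by (auto intro!: carrier_matI)
  have X: "?X * M y = M y * ?X" if y: "y \<in> K" for y
  proof -
    have "M' y * ?X * M y = msum n n (\<lambda>k. M' y * ?f k) K * M y"
      using y f by (subst mult_msum[of _ n n]) auto
    also have "\<dots> = msum n n (\<lambda>k. M' y * ?f k * M y) K"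
      using y T by (intro msum_mult) (auto intro!: carrier_matI)
    also have "\<dots> = msum n n (\<lambda>k. ?f (k \<otimes> y)) K" by (intro msum_cong refl M_mult_M y T)
    also have "\<dots> = ?X"
    proof (rule msum_reindex[symmetric])
      show "bij_betw (\<lambda>k. k \<otimes> y) K K"
        by (rule bij_betw_byWitness[of _ "\<lambda>k. k \<otimes> inv y"]) (use y in \<open>auto simp: m_assoc\<close>)
    qed
    finally have "M y * (M' y * ?X * M y) = M y * ?X" by simp
    then show ?thesis using y by (simp add: mult_mat_assoc_dim mat_cancel_left[OF MM'(1)])
  qed
  obtain c where c: "?X = c \<cdot>\<^sub>m 1\<^sub>m n" using commutes_M_imp_scalar[OF _ X] by auto
  have "c * of_nat n = trace_mat ?X" unfolding c by simp
  also have "\<dots> = (\<Sum>k\<in>K. trace_mat (?f k))" using f by (rule trace_msum)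
  also have "\<dots> = (\<Sum>k\<in>K. trace_mat T)"
    by (intro sum.cong refl trace_mat_conj[of _ n]) (auto simp: T MM')
  also have "\<dots> = of_nat (n\<^sup>2 * card L) * trace_mat T" unfolding n_square by simp
  finally have "c = of_nat n * of_nat (card L) * trace_mat T"
    using n_pos by (simp add: power2_eq_square)
  then show ?thesis using c by simp
qed

text \<open>The preimage in \<open>K\<close> of the centralizer of \<open>h\<close> in K/L: the
  condition is [k, h] \<in> L, where [k, h] = k^-1 h^-1 k h. Closure under products comes from
  [x y, h] = y^-1 [x, h] y [y, h].\<close>

lemma subgroup_centralizer_mod:
  assumes h: "h \<in> carrier G"
  shows "subgroup {k \<in> K. inv k \<otimes> (inv h \<otimes> k \<otimes> h) \<in> L} G" (is "subgroup ?C G")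
proof
  show "?C \<subseteq> carrier G" by auto
  show "\<one> \<in> ?C" using h by simp
next
  fix x y assume "x \<in> ?C" "y \<in> ?C"
  then have x: "x \<in> K" "inv x \<otimes> (inv h \<otimes> x \<otimes> h) \<in> L" and y: "y \<in> K" "inv y \<otimes> (inv h \<otimes> y \<otimes> h) \<in> L" by auto
  have "(inv y \<otimes> (inv x \<otimes> (inv h \<otimes> x \<otimes> h)) \<otimes> y) \<otimes> (inv y \<otimes> (inv h \<otimes> y \<otimes> h)) \<in> L"
    by (rule L_closed(1)[OF conj_closed(1)[OF K_carrier[OF y(1)] x(2)] y(2)])
  also have "(inv y \<otimes> (inv x \<otimes> (inv h \<otimes> x \<otimes> h)) \<otimes> y) \<otimes> (inv y \<otimes> (inv h \<otimes> y \<otimes> h))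
     = inv (x \<otimes> y) \<otimes> (inv h \<otimes> (x \<otimes> y) \<otimes> h)"
    using x(1) y(1) h by (simp add: inv_mult_group m_assoc)
  finally show "x \<otimes> y \<in> ?C" using x y by simp
next
  fix x assume "x \<in> ?C"
  then have x: "x \<in> K" "inv x \<otimes> (inv h \<otimes> x \<otimes> h) \<in> L" by auto
  have "x \<otimes> inv (inv x \<otimes> (inv h \<otimes> x \<otimes> h)) \<otimes> inv x \<in> L"
    by (rule conj_closed(2)[OF K_carrier[OF x(1)] L_closed(2)[OF x(2)]])
  also have "x \<otimes> inv (inv x \<otimes> (inv h \<otimes> x \<otimes> h)) \<otimes> inv x = inv (inv x) \<otimes> (inv h \<otimes> inv x \<otimes> h)"
    using x(1) h by (simp add: inv_mult_group m_assoc)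
  finally show "inv x \<in> ?C" using x by simp
qed

text \<open>Lagrange's theorem for \<open>L\<close> in \<open>C\<close> and for \<open>C\<close> in
  \<open>K\<close>. It makes the order of the centralizer of an element in K/L odd when
  \<open>n\<close> is odd.\<close>

lemma card_subgroup_between:
  assumes C: "subgroup C G" "L \<subseteq> C" "C \<subseteq> K"
  obtains c where "card C = c * card L" "c dvd n\<^sup>2"
proof -
  have "subgroup L (G\<lparr>carrier := C\<rparr>)" using subgroup_incl[OF L.subgroup_axioms C(1,2)] .
  then have "card (rcosets\<^bsub>G\<lparr>carrier := C\<rparr>\<^esub> L) * card L = Coset.order (G\<lparr>carrier := C\<rparr>)"
    by (rule group.lagrange[OF subgroup.subgroup_is_group[OF C(1) is_group]])
  then have "card C = card (rcosets\<^bsub>G\<lparr>carrier := C\<rparr>\<^esub> L) * card L" by (simp add: Coset.order_def)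
  then obtain c where c: "card C = c * card L" by blast
  have "subgroup C (G\<lparr>carrier := K\<rparr>)" using subgroup_incl[OF C(1) K.subgroup_axioms C(3)] .
  then have "card (rcosets\<^bsub>G\<lparr>carrier := K\<rparr>\<^esub> C) * card C = Coset.order (G\<lparr>carrier := K\<rparr>)"
    by (rule group.lagrange[OF subgroup.subgroup_is_group[OF K.subgroup_axioms is_group]])
  then have "card K = card (rcosets\<^bsub>G\<lparr>carrier := K\<rparr>\<^esub> C) * card C" by (simp add: Coset.order_def)
  then obtain j where j: "card K = j * card C" by blast
  have "n\<^sup>2 * card L = j * c * card L" unfolding n_square j c by simp
  then have "n\<^sup>2 = j * c" using card_L_pos by simp
  then have "c dvd n\<^sup>2" by simp
  then show ?thesis by (rule that[OF c])
qed

end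

section \<open>Squares of values of the magic character\<close>

lemma nonzero_mat_entry:
  assumes "A \<in> carrier_mat r c" "A \<noteq> 0\<^sub>m r c"
  shows "\<exists>i<r. \<exists>j<c. A $$ (i, j) \<noteq> 0"
proof (rule ccontr)
  assume "\<not> ?thesis"
  then have "A = 0\<^sub>m r c" using assms(1) by (intro eq_matI) auto
  then show False using assms(2) by simp
qed

text \<open>The square of the trace is the sum of the squares of the eigenvalues plus twice the
  products of pairs, and the eigenvalues are \<open>m\<close>-th roots of unity.\<close>

lemma trace_square_mod_2:
  assumes U: "U \<in> carrier_mat n n" and Um: "U ^\<^sub>m m = 1\<^sub>m n" and m: "m > 0"
  shows "\<exists>y\<in>int_adj (cis (2 * pi / real m)). (trace_mat U)\<^sup>2 = trace_mat (U * U) + 2 * y"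
proof -
  obtain xs where tr: "\<And>k. trace_mat (U ^\<^sub>m k) = (\<Sum>x\<leftarrow>xs. x ^ k)"
    and ev: "\<And>a b x. U ^\<^sub>m a = U ^\<^sub>m b \<Longrightarrow> x \<in> set xs \<Longrightarrow> x ^ a = x ^ b"
    using matrix_eigenvalue_list[OF U] by metis
  have "x \<in> int_adj (cis (2 * pi / real m))" if "x \<in> set xs" for x
    using ev[of m 0 x] that Um U root_of_unity_in_int_adj[OF _ m] by simp
  then obtain y where "y \<in> int_adj (cis (2 * pi / real m))" "sum_list xs ^ 2 = (\<Sum>x\<leftarrow>xs. x ^ 2) + 2 * y"
    using sum_list_square_mod_2 by blast
  moreover have "trace_mat U = sum_list xs" using tr[of 1] U by simp
  moreover have "trace_mat (U * U) = (\<Sum>x\<leftarrow>xs. x ^ 2)" using tr[of 2] U by (simp add: numeral_2_eq_2)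
  ultimately show ?thesis by auto
qed

context five_matrix
begin

lemma sl_part_conj:
  assumes A: "A \<in> sl_part k" and k: "k \<in> carrier G" and h: "h \<in> carrier G"
    and U: "U \<in> carrier_mat n n" "U' \<in> carrier_mat n n" "U * U' = 1\<^sub>m n" "Determinant.det U = 1"
    and conj: "\<And>s. s \<in> carrier S \<Longrightarrow> conj_elem G s h \<in> carrier S \<and> \<tau> (conj_elem G s h) = U' * \<tau> s * U"
  shows "U' * A * U \<in> sl_part (inv h \<otimes> k \<otimes> h)"
proof -
  obtain s where s: "s \<in> carrier S" "homogeneous s k" "A = \<tau> s" "Determinant.det A = 1"
    using A by (auto simp: sl_part_def)
  have dU': "Determinant.det U' = 1" using det_mult[OF U(1,2)] U(3,4) by simp
  have "Determinant.det (U' * A * U) = Determinant.det (U' * A) * Determinant.det U"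
    using U s by (intro det_mult) auto
  also have "Determinant.det (U' * A) = Determinant.det U' * Determinant.det A"
    using U s by (intro det_mult) auto
  finally have "Determinant.det (U' * A * U) = 1" using dU' U(4) s(4) by simp
  then show ?thesis
    using conj[OF s(1)] s by (intro sl_partI[OF _ homogeneous_conj[OF s(2) k h]]) auto
qed

text \<open>\<open>U\<close> is \<sigma>(h) as a matrix and \<open>m\<close> is an exponent of it;
  the number \<open>c\<close> is the order of the centralizer of \<open>h\<close> in K/L.\<close>

lemma conj_trace_square:
  assumes h: "h \<in> carrier G" and U: "U \<in> carrier_mat n n" "U' \<in> carrier_mat n n" "U * U' = 1\<^sub>m n" "U' * U = 1\<^sub>m n"
    "Determinant.det U = 1" and Um: "U ^\<^sub>m m = 1\<^sub>m n" and m: "m > 0" "coprime m n" and oddn: "odd n"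
    and conj: "\<And>s. s \<in> carrier S \<Longrightarrow> conj_elem G s h \<in> carrier S \<and> \<tau> (conj_elem G s h) = U' * \<tau> s * U"
  shows "\<exists>c::nat. odd c \<and> (trace_mat U)\<^sup>2 = of_nat c"
proof -
  let ?hk = "\<lambda>k. inv h \<otimes> k \<otimes> h"
  let ?Z = "int_adj (cis (2 * pi / real n))"
  \<comment> \<open>The commutator of \<open>M k\<close> and \<open>U\<close>, a unit supported on
    the coset of [k, h].\<close>
  define N where "N k = M' k * (U' * M k * U)" for k
  have hkK: "?hk k \<in> K" if "k \<in> K" for k using K.inv_op_closed1[OF h that] .
  have N_sl: "N k \<in> sl_part (inv k \<otimes> ?hk k)" if k: "k \<in> K" for k
    unfolding N_def using k h
    by (intro sl_part_mult[OF M'[OF k] sl_part_conj[OF M[OF k] _ h U(1,2,3,5) conj]]) auto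
  have N_carrier: "N k \<in> carrier_mat n n" if "k \<in> K" for k using N_sl[OF that] by simp
  define C where "C = {k \<in> K. inv k \<otimes> ?hk k \<in> L}"
  have subC: "subgroup C G" unfolding C_def by (rule subgroup_centralizer_mod[OF h])
  have LC: "L \<subseteq> C" using L_sub_K h by (auto simp: C_def)
  obtain c where c: "card C = c * card L" "c dvd n\<^sup>2"
    using card_subgroup_between[OF subC LC] by (auto simp: C_def)
  have "odd c" using c(2) oddn dvd_trans[of 2 c "n\<^sup>2"] by auto
  define a where "a = of_nat (n * card L) * trace_mat U'"
  have sumN: "msum n n N K = a \<cdot>\<^sub>m U"
  proof -
    have "msum n n N K = msum n n (\<lambda>k. M' k * U' * M k * U) K"
      using U by (intro msum_cong refl) (simp add: N_def mult_mat_assoc_dim)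
    also have "\<dots> = msum n n (\<lambda>k. M' k * U' * M k) K * U"
      using U by (intro msum_mult[symmetric]) (auto intro!: carrier_matI)
    also have "\<dots> = a \<cdot>\<^sub>m U" using U by (simp add: average_M a_def smult_mult_dim mult_mat_one_dim)
    finally show ?thesis .
  qed
  \<comment> \<open>Only the \<open>k\<close> with [k, h] \<in> L contribute. There
    \<open>N k\<close> is a scalar z; determinant 1 gives z^n = 1 and the exponent of
    \<open>U\<close> gives z^m = 1, so z = 1.\<close>
  have trN: "trace_mat (N k) = (if k \<in> C then of_nat n else 0)" if k: "k \<in> K" for k
  proof (cases "k \<in> C")
    case False
    obtain s where s: "s \<in> carrier S" "homogeneous s (inv k \<otimes> ?hk k)" "N k = \<tau> s"
      using N_sl[OF k] by (auto simp: sl_part_def)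
    have "trace_mat (N k) = 0" unfolding s(3)
      by (rule trace_homogeneous_zero[OF s(1,2)]) (use False k h in \<open>auto simp: C_def\<close>)
    then show ?thesis using False by simp
  next
    case True
    then have l: "inv k \<otimes> ?hk k \<in> L" by (simp add: C_def)
    obtain z where z: "N k = z \<cdot>\<^sub>m 1\<^sub>m n" "z ^ n = 1"
      using sl_part_unique[OF N_sl[OF k] one_in_sl_part[OF l]] l by auto
    have "M k * N k = U' * M k * U" unfolding N_def using k U by (simp add: mat_cancel_left[OF MM'(1)])
    then have "U' * M k * U = z \<cdot>\<^sub>m M k" unfolding z(1) using k by (simp add: mult_smult_dim mult_mat_one_dim)
    then have "U * (U' * M k * U) = z \<cdot>\<^sub>m (U * M k)" using k U by (simp add: mult_smult_dim)
    then have MU: "M k * U = z \<cdot>\<^sub>m (U * M k)" using k U by (simp add: mult_mat_assoc_dim mat_cancel_left[OF U(3)])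
    have dimU [simp]: "dim_row (U ^\<^sub>m j) = n" "dim_col (U ^\<^sub>m j) = n" for j
      using pow_carrier_mat[OF U(1), of j] by auto
    have "M k * U ^\<^sub>m j = z ^ j \<cdot>\<^sub>m (U ^\<^sub>m j * M k)" for j
    proof (induction j)
      case 0 then show ?case using k U by (simp add: mult_mat_one_dim)
    next
      case (Suc j)
      have "M k * U ^\<^sub>m Suc j = (M k * U ^\<^sub>m j) * U" using k U by (simp add: mult_mat_assoc_dim)
      also have "\<dots> = z ^ j \<cdot>\<^sub>m (U ^\<^sub>m j * (M k * U))" unfolding Suc.IH using k U by (simp add: smult_mult_dim mult_mat_assoc_dim)
      also have "\<dots> = z ^ Suc j \<cdot>\<^sub>m (U ^\<^sub>m Suc j * M k)" unfolding MU using k U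
        by (simp add: mult_smult_dim mult_mat_assoc_dim smult_smult_mat mult.commute)
      finally show ?case .
    qed
    from this[of m] have e: "M k = z ^ m \<cdot>\<^sub>m M k" unfolding Um using k by (simp add: mult_mat_one_dim)
    have "M k \<noteq> 0\<^sub>m n n" using det_one_nonzero[of "M k"] M[OF k] k by (auto simp: sl_part_def)
    then obtain i j where ij: "i < n" "j < n" "M k $$ (i, j) \<noteq> 0"
      using nonzero_mat_entry[OF M_carrier(1)[OF k]] by blast
    have "M k $$ (i, j) = (z ^ m \<cdot>\<^sub>m M k) $$ (i, j)" using e by simp
    then have "M k $$ (i, j) = z ^ m * M k $$ (i, j)" using ij k by simp
    then have "z ^ m = 1" using ij by simp
    then have "z = 1" using coprime_roots_of_unity_eq_1[OF _ z(2) m(2)] by blast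
    then show ?thesis using True z(1) by simp
  qed
  have "a * trace_mat U = trace_mat (msum n n N K)" unfolding sumN using U by simp
  also have "\<dots> = (\<Sum>k\<in>K. if k \<in> C then of_nat n else 0)" using N_carrier trN by (subst trace_msum) auto
  also have "\<dots> = of_nat (card C) * of_nat n"
  proof -
    have "{k \<in> K. k \<in> C} = C" by (auto simp: C_def)
    then show ?thesis using sum.inter_filter[OF finite_K, of "\<lambda>_. of_nat n :: complex" "\<lambda>k. k \<in> C"] by simp
  qed
  finally have norm: "trace_mat U' * trace_mat U = of_nat c"
    using n_pos card_L_pos c(1) by (simp add: a_def field_simps)
  \<comment> \<open>One factor a U after the other is replaced by the sum of the \<open>N k\<close>,
    each of which is absorbed into \<open>B\<close>. For this induction \<open>B\<close> has to
    range over the units of determinant 1 in all components.\<close>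
  have integral: "a ^ j * trace_mat (U ^\<^sub>m j * B) \<in> ?Z" if "B \<in> sl_part k" "k \<in> K" for j k B
    using that
  proof (induction j arbitrary: k B)
    case 0
    then show ?case using U trace_sl_part[of B k] by (simp add: mult_mat_one_dim)
  next
    case (Suc j)
    have Uj: "U ^\<^sub>m j \<in> carrier_mat n n" using U by simp
    have B: "B \<in> carrier_mat n n" using Suc.prems by simp
    have "a * trace_mat (U ^\<^sub>m Suc j * B) = trace_mat (U ^\<^sub>m j * (a \<cdot>\<^sub>m U) * B)"
      using Uj U B carrier_matD[OF Uj] by (simp add: mult_smult_dim smult_mult_dim)
    also have "U ^\<^sub>m j * (a \<cdot>\<^sub>m U) * B = msum n n (\<lambda>k. U ^\<^sub>m j * (N k * B)) K"
    proof -
      have "U ^\<^sub>m j * (a \<cdot>\<^sub>m U) * B = U ^\<^sub>m j * (msum n n N K * B)"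
        unfolding sumN using U B carrier_matD[OF Uj] by (simp add: mult_mat_assoc_dim)
      also have "msum n n N K * B = msum n n (\<lambda>k. N k * B) K" using B N_carrier by (intro msum_mult) auto
      also have "U ^\<^sub>m j * \<dots> = msum n n (\<lambda>k. U ^\<^sub>m j * (N k * B)) K"
        using Uj B carrier_matD[OF N_carrier] by (intro mult_msum[of _ n n]) (auto intro!: carrier_matI)
      finally show ?thesis .
    qed
    also have "trace_mat \<dots> = (\<Sum>k\<in>K. trace_mat (U ^\<^sub>m j * (N k * B)))"
      using carrier_matD[OF Uj] B by (intro trace_msum) (auto intro!: carrier_matI)
    finally have e0: "a * trace_mat (U ^\<^sub>m Suc j * B) = (\<Sum>k\<in>K. trace_mat (U ^\<^sub>m j * (N k * B)))" .
    have "a ^ Suc j * trace_mat (U ^\<^sub>m Suc j * B) = a ^ j * (a * trace_mat (U ^\<^sub>m Suc j * B))" by simp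
    also have "\<dots> = (\<Sum>k\<in>K. a ^ j * trace_mat (U ^\<^sub>m j * (N k * B)))" unfolding e0 by (rule sum_distrib_left)
    finally have e: "a ^ Suc j * trace_mat (U ^\<^sub>m Suc j * B) = (\<Sum>k\<in>K. a ^ j * trace_mat (U ^\<^sub>m j * (N k * B)))" .
    have "a ^ j * trace_mat (U ^\<^sub>m j * (N i * B)) \<in> ?Z" if i: "i \<in> K" for i
    proof (rule Suc.IH)
      show "N i * B \<in> sl_part (inv i \<otimes> ?hk i \<otimes> k)"
        using i h Suc.prems by (intro sl_part_mult N_sl) auto
      show "inv i \<otimes> ?hk i \<otimes> k \<in> K" 
        by (rule K.m_closed[OF K.m_closed[OF K.m_inv_closed[OF i] hkK[OF i]] Suc.prems(2)])
    qed
    then show ?case unfolding e by (rule int_adj_sum)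
  qed
  obtain xs where xs: "length xs = n" "Determinant.det U = prod_list xs"
    and tr: "\<And>k. trace_mat (U ^\<^sub>m k) = (\<Sum>x\<leftarrow>xs. x ^ k)"
    and ev: "\<And>a b x. U ^\<^sub>m a = U ^\<^sub>m b \<Longrightarrow> x \<in> set xs \<Longrightarrow> x ^ a = x ^ b"
    using matrix_eigenvalue_list[OF U(1)] by metis
  have U'pow: "U' = U ^\<^sub>m (m - 1)"
  proof -
    have Ud: "dim_row (U ^\<^sub>m (m - 1)) = n" "dim_col (U ^\<^sub>m (m - 1)) = n" using pow_carrier_mat[OF U(1), of "m - 1"] by auto
    have "U ^\<^sub>m Suc (m - 1) = 1\<^sub>m n" using Um m by simp
    then have "U ^\<^sub>m (m - 1) * U * U' = U'" using U by (simp add: mult_mat_one_dim)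
    then show ?thesis using U Ud by (simp add: mult_mat_assoc_dim U(3) mult_mat_one_dim)
  qed
  have trU: "trace_mat U = sum_list xs" using tr[of 1] U by simp
  have trU': "trace_mat U' = (\<Sum>x\<leftarrow>xs. x ^ (m - 1))" using tr[of "m - 1"] U'pow by simp
  have c0: "c \<noteq> 0" using odd_pos[OF \<open>odd c\<close>] by simp
  have "(\<Sum>x\<leftarrow>xs. x ^ (m - 1)) = sum_list xs"
  proof (rule sum_list_eq_sum_list_inverse[of m n xs "n * card L"])
    show "x ^ m = 1" if "x \<in> set xs" for x using ev[of m 0 x] that Um U by simp
    show "prod_list xs = 1" using xs U by simp
    show "sum_list xs \<noteq> 0" using norm c0 trU by auto
    show "n * card L \<noteq> 0" using n_pos card_L_pos by simp
    fix j :: nat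
    have "a ^ j * trace_mat (U ^\<^sub>m j * 1\<^sub>m n) \<in> ?Z" using integral[OF one_in_sl_part[of \<one>]] by simp
    moreover have "U ^\<^sub>m j * 1\<^sub>m n = U ^\<^sub>m j" by (rule right_mult_one_mat[OF pow_carrier_mat[OF U(1)]])
    ultimately show "of_nat (n * card L) ^ j * (\<Sum>x\<leftarrow>xs. x ^ (m - 1)) ^ j * (\<Sum>x\<leftarrow>xs. x ^ j) \<in> ?Z"
      using tr[of j] trU' by (simp add: a_def power_mult_distrib)
  qed (use m n_pos xs in auto)
  then have "(trace_mat U)\<^sup>2 = of_nat c" using norm trU trU' by (simp add: power2_eq_square)
  then show ?thesis using \<open>odd c\<close> by blast
qed

end

section \<open>Factorization of idempotent matrices\<close>

lemma minus_zero_mat_right: "X \<in> carrier_mat r c \<Longrightarrow> X - 0\<^sub>m r c = (X :: complex mat)"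
  by (intro eq_matI) auto

text \<open>Take a partial factorization with \<open>r\<close> maximal; a nonzero entry of the idempotent \<open>E - B C\<close> would extend it.\<close>

lemma idempotent_factorization:
  assumes E: "E \<in> carrier_mat D D" "E * E = (E :: complex mat)"
  shows "\<exists>r. \<exists>B\<in>carrier_mat D r. \<exists>C\<in>carrier_mat r D. B * C = E \<and> C * B = 1\<^sub>m r"
proof -
  let ?P = "\<lambda>r. \<exists>B C. B \<in> carrier_mat D r \<and> C \<in> carrier_mat r D \<and> E * B = B \<and> C * E = C \<and> C * B = 1\<^sub>m r"
  have P0: "?P 0"
  proof (intro exI conjI)
    show "E * 0\<^sub>m D 0 = 0\<^sub>m D 0" "0\<^sub>m 0 D * E = 0\<^sub>m 0 D" using E by auto
    show "0\<^sub>m 0 D * 0\<^sub>m D 0 = (1\<^sub>m 0 :: complex mat)" by (rule eq_matI) auto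
  qed auto
  \<comment> \<open>The complementary idempotent 1 - B C has trace D - r, which must be a natural
    number.\<close>
  have bound: "r \<le> D" if P: "?P r" for r
  proof -
    from P obtain B C :: "complex mat" where BC: "B \<in> carrier_mat D r" "C \<in> carrier_mat r D" "C * B = 1\<^sub>m r"
      by blast
    have F: "B * C \<in> carrier_mat D D" using BC by auto
    have FF: "B * C * (B * C) = B * C" using BC by (simp add: mult_mat_assoc_dim mat_cancel_left[OF BC(3)])
    let ?F' = "1\<^sub>m D - B * C"
    have F': "?F' \<in> carrier_mat D D" by (rule minus_carrier_mat[OF F])
    have "?F' * ?F' = ?F' * 1\<^sub>m D - ?F' * (B * C)" using F F' by (intro mult_minus_distrib_mat[of _ D D _ D]) auto
    also have "?F' * (B * C) = 1\<^sub>m D * (B * C) - B * C * (B * C)" using F by (intro minus_mult_distrib_mat[of _ D D _ _ D]) auto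
    also have "\<dots> = 0\<^sub>m D D" unfolding FF left_mult_one_mat[OF F] by (rule minus_r_inv_mat[OF F])
    also have "?F' * 1\<^sub>m D - 0\<^sub>m D D = ?F'"
      unfolding right_mult_one_mat[OF F'] by (rule minus_zero_mat_right[OF F'])
    finally obtain q :: nat where "trace_mat ?F' = of_nat q" using trace_idempotent_mat_nat[OF F'] by blast
    moreover have "trace_mat ?F' = of_nat D - trace_mat (B * C)"
      using BC by (simp add: trace_mat_def sum_subtractf)
    moreover have "trace_mat (B * C) = of_nat r" using trace_mat_comm[OF BC(1,2)] BC(3) by simp
    ultimately have "(of_nat D :: complex) = of_nat (q + r)" by (simp add: diff_eq_eq)
    then have "D = q + r" by (simp only: of_nat_eq_iff)
    then show ?thesis by simp
  qed
  define r where "r = (GREATEST r. ?P r)"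
  have Pr: "?P r" unfolding r_def by (rule GreatestI_nat[of ?P 0 D]) (use P0 bound in auto)
  have max: "s \<le> r" if "?P s" for s unfolding r_def by (rule Greatest_le_nat[of ?P s D]) (use that bound in auto)
  obtain B C :: "complex mat" where BC: "B \<in> carrier_mat D r" "C \<in> carrier_mat r D" "E * B = B" "C * E = C" "C * B = 1\<^sub>m r"
    using Pr by blast
  have "B * C = E"
  proof (rule ccontr)
    assume ne: "B * C \<noteq> E"
    \<comment> \<open>An idempotent orthogonal to \<open>B * C\<close>, and nonzero by
      \<open>ne\<close>.\<close>
    define F where "F = E - B * C"
    have Fc: "F \<in> carrier_mat D D" unfolding F_def using E BC by (intro minus_carrier_mat mult_carrier_mat)
    have EF: "E * F = F"
    proof -
      have "E * F = E * E - E * (B * C)" unfolding F_def using E BC by (intro mult_minus_distrib_mat[of _ D D _ D]) auto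
      also have "E * (B * C) = B * C" using E BC by (simp flip: mult_mat_assoc_dim)
      finally show ?thesis using E by (simp add: F_def)
    qed
    have FE: "F * E = F"
    proof -
      have "F * E = E * E - B * C * E" unfolding F_def using E BC by (intro minus_mult_distrib_mat[of _ D D _ _ D]) auto
      also have "B * C * E = B * C" using E BC by (simp add: mult_mat_assoc_dim)
      finally show ?thesis using E by (simp add: F_def)
    qed
    have CF: "C * F = 0\<^sub>m r D"
    proof -
      have "C * F = C * E - C * (B * C)" unfolding F_def using E BC by (intro mult_minus_distrib_mat[of _ r D _ D]) auto
      also have "C * (B * C) = C" using BC by (simp add: mat_cancel_left[OF BC(5)])
      also have "C * E - C = 0\<^sub>m r D" unfolding BC(4) by (rule minus_r_inv_mat[OF BC(2)])
      finally show ?thesis .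
    qed
    have FB: "F * B = 0\<^sub>m D r"
    proof -
      have "F * B = E * B - B * C * B" unfolding F_def using E BC by (intro minus_mult_distrib_mat[of _ D D _ _ r]) auto
      also have "B * C * B = B" using BC by (simp add: mult_mat_assoc_dim mult_mat_one_dim)
      also have "E * B - B = 0\<^sub>m D r" unfolding BC(3) by (rule minus_r_inv_mat[OF BC(1)])
      finally show ?thesis .
    qed
    have FF: "F * F = F"
    proof -
      have "F * F = F * (E - B * C)" by (simp add: F_def)
      also have "\<dots> = F * E - F * (B * C)" using E BC Fc by (intro mult_minus_distrib_mat[of _ D D _ D]) auto
      also have "F * (B * C) = F * B * C" using Fc BC by (simp add: mult_mat_assoc_dim)
      also have "\<dots> = 0\<^sub>m D D" unfolding FB using BC by (simp add: left_mult_zero_mat)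
      finally have "F * F = F - 0\<^sub>m D D" unfolding FE .
      also have "\<dots> = F" by (rule minus_zero_mat_right[OF Fc])
      finally show ?thesis .
    qed
    obtain i j where ij: "i < D" "j < D" "F $$ (i, j) \<noteq> 0"
    proof -
      have "F \<noteq> 0\<^sub>m D D"
      proof
        assume z: "F = 0\<^sub>m D D"
        have "B * C = E"
        proof (rule eq_matI)
          fix a b assume "a < dim_row E" "b < dim_col E"
          then have ab: "a < D" "b < D" using E by auto
          have "F $$ (a, b) = E $$ (a, b) - (B * C) $$ (a, b)" unfolding F_def using ab E BC by (intro index_minus_mat) auto
          then show "(B * C) $$ (a, b) = E $$ (a, b)" using z ab by simp
        qed (use E BC in auto)
        then show False using ne by simp
      qed
      then show ?thesis using that nonzero_mat_entry[OF Fc] by blast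
    qed
    \<comment> \<open>Column \<open>j\<close> of \<open>F\<close> is appended to \<open>B\<close>,
      and row \<open>i\<close> of \<open>F\<close>, divided by its entry at \<open>j\<close>, is
      appended to \<open>C\<close>. As \<open>F * F = F\<close>, the new row times the new column is
      1.\<close>
    define B2 where "B2 = Matrix.mat D (Suc r) (\<lambda>(a, b). if b < r then B $$ (a, b) else F $$ (a, j))"
    define C2 where "C2 = Matrix.mat (Suc r) D (\<lambda>(a, b). if a < r then C $$ (a, b) else F $$ (i, b) / F $$ (i, j))"
    have B2: "B2 \<in> carrier_mat D (Suc r)" and C2: "C2 \<in> carrier_mat (Suc r) D" by (simp_all add: B2_def C2_def)
    have s: "(\<Sum>x<D. X $$ (a, x) * Y $$ (x, b)) = (X * Y) $$ (a, b)"
      if "X \<in> carrier_mat p D" "Y \<in> carrier_mat D q" "a < p" "b < q" for X Y :: "complex mat" and a b p q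
      using mult_mat_index_sum[OF that] by simp
    have 1: "E * B2 = B2"
    proof (rule eq_matI)
      fix a b assume "a < dim_row B2" "b < dim_col B2"
      then have ab: "a < D" "b < Suc r" using B2 by auto
      have "(E * B2) $$ (a, b) = (\<Sum>x<D. E $$ (a, x) * B2 $$ (x, b))" by (rule s[symmetric, OF E(1) B2 ab])
      also have "\<dots> = (if b < r then (\<Sum>x<D. E $$ (a, x) * B $$ (x, b)) else (\<Sum>x<D. E $$ (a, x) * F $$ (x, j)))"
        using ab by (simp add: B2_def)
      also have "\<dots> = B2 $$ (a, b)" using ab ij s[OF E(1) BC(1) ab(1), of b] s[OF E(1) Fc ab(1) ij(2)] BC(3) EF
        by (simp add: B2_def)
      finally show "(E * B2) $$ (a, b) = B2 $$ (a, b)" .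
    qed (use E B2 in auto)
    have 2: "C2 * E = C2"
    proof (rule eq_matI)
      fix a b assume "a < dim_row C2" "b < dim_col C2"
      then have ab: "a < Suc r" "b < D" using C2 by auto
      have "(C2 * E) $$ (a, b) = (\<Sum>x<D. C2 $$ (a, x) * E $$ (x, b))" by (rule s[symmetric, OF C2 E(1) ab])
      also have "\<dots> = (if a < r then (\<Sum>x<D. C $$ (a, x) * E $$ (x, b)) else (\<Sum>x<D. F $$ (i, x) * E $$ (x, b)) / F $$ (i, j))"
        using ab by (simp add: C2_def sum_divide_distrib)
      also have "\<dots> = C2 $$ (a, b)" using ab ij s[OF BC(2) E(1) _ ab(2), of a] s[OF Fc E(1) ij(1) ab(2)] BC(4) FE
        by (simp add: C2_def)
      finally show "(C2 * E) $$ (a, b) = C2 $$ (a, b)" .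
    qed (use E C2 in auto)
    have 3: "C2 * B2 = 1\<^sub>m (Suc r)"
    proof (rule eq_matI)
      fix a b assume "a < dim_row (1\<^sub>m (Suc r) :: complex mat)" "b < dim_col (1\<^sub>m (Suc r) :: complex mat)"
      then have ab: "a < Suc r" "b < Suc r" by auto
      have e: "(C2 * B2) $$ (a, b) = (\<Sum>x<D. C2 $$ (a, x) * B2 $$ (x, b))" by (rule s[symmetric, OF C2 B2 ab])
      show "(C2 * B2) $$ (a, b) = 1\<^sub>m (Suc r) $$ (a, b)"
      proof (cases "a < r"; cases "b < r")
        assume "a < r" "b < r"
        then show ?thesis using ab s[OF BC(2) BC(1), of a b] BC(5) unfolding e by (simp add: B2_def C2_def)
      next
        assume "a < r" "\<not> b < r"
        then show ?thesis using ab ij s[OF BC(2) Fc, of a j] CF unfolding e by (simp add: B2_def C2_def)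
      next
        assume "\<not> a < r" "b < r"
        then show ?thesis using ab ij s[OF Fc BC(1), of i b] FB unfolding e by (simp add: B2_def C2_def flip: sum_divide_distrib)
      next
        assume "\<not> a < r" "\<not> b < r"
        then show ?thesis using ab ij s[OF Fc Fc, of i j] FF unfolding e by (simp add: B2_def C2_def flip: sum_divide_distrib)
      qed
    qed (use B2 C2 in auto)
    have "?P (Suc r)" using B2 C2 1 2 3 by (intro exI[of _ B2] exI[of _ C2] conjI)
    then have "Suc r \<le> r" by (rule max)
    then show False by simp
  qed
  then show ?thesis using BC(1,2,5) by blast
qed

lemma linear_map_msum:
  assumes add: "\<And>A B. A \<in> carrier_mat n n \<Longrightarrow> B \<in> carrier_mat n n \<Longrightarrow> F (A + B) = F A + (F B :: complex mat)"
    and smult: "\<And>c A. A \<in> carrier_mat n n \<Longrightarrow> F (c \<cdot>\<^sub>m A) = c \<cdot>\<^sub>m F A"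
    and F: "\<And>A. A \<in> carrier_mat n n \<Longrightarrow> F A \<in> carrier_mat D D"
    and "finite I" "\<And>a. a \<in> I \<Longrightarrow> X a \<in> carrier_mat n n"
  shows "F (msum n n X I) = msum D D (\<lambda>a. F (X a)) I"
  using assms(4,5)
proof (induction I rule: finite_induct)
  case empty
  have z: "0 \<cdot>\<^sub>m 0\<^sub>m n n = (0\<^sub>m n n :: complex mat)" by (rule eq_matI) auto
  have "F (0\<^sub>m n n) = 0 \<cdot>\<^sub>m F (0\<^sub>m n n)" using smult[of "0\<^sub>m n n" 0] z by simp
  also have "\<dots> = 0\<^sub>m D D" using F[of "0\<^sub>m n n"] by (intro eq_matI) auto
  finally show ?case by simp
next
  case (insert a I)
  then show ?case by (simp add: msum_insert add F)
qed

lemma msum_mult_vec_mem: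
  assumes W: "0\<^sub>v D \<in> W" "\<And>v w. v \<in> W \<Longrightarrow> w \<in> W \<Longrightarrow> v + w \<in> W"
    and v: "v \<in> carrier_vec D" and I: "finite I" "\<And>a. a \<in> I \<Longrightarrow> X a \<in> carrier_mat D D" "\<And>a. a \<in> I \<Longrightarrow> X a *\<^sub>v v \<in> W"
  shows "msum D D X I *\<^sub>v v \<in> W"
  using I
proof (induction I rule: finite_induct)
  case empty
  have "0\<^sub>m D D *\<^sub>v v = 0\<^sub>v D" using v by (intro eq_vecI) auto
  then show ?case using W by simp
next
  case (insert a I)
  have "msum D D X (insert a I) *\<^sub>v v = X a *\<^sub>v v + msum D D X I *\<^sub>v v"
    using insert v by (simp add: msum_insert add_mult_distrib_mat_vec[of _ D D])
  then show ?case using insert W by simp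
qed

context five_matrix
begin

lemma monoid_S: "Group.monoid S"
  by (rule Group.monoidI) (auto simp: e_in_S e_conv_S S_conv_e conv_assoc)

text \<open>It yields e k = v (w k) with w k supported on \<open>L\<close>. So \<open>K\<close> acts
  through S and \<complex>L on every module where \<open>e\<close> acts as the identity.\<close>

lemma S_unit_pair:
  assumes k: "k \<in> K"
  shows "\<exists>v\<in>carrier S. \<exists>w\<in>carrier S. homogeneous w (inv k) \<and> v \<star> w = e"
proof -
  have kG: "k \<in> carrier G" and ik: "inv k \<in> K" using k by auto
  obtain T T' where T: "intertwines T k" "T' \<in> carrier_mat d d" "T * T' = 1\<^sub>m d" "T' * T = 1\<^sub>m d"
    using exists_intertwiner[OF kG] .
  have T': "intertwines T' (inv k)" by (rule intertwines_inverse[OF kG T])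
  have Tc: "T \<in> carrier_mat d d" using T(1) by (simp add: intertwines_def)
  have "lift T k \<star> lift T' (inv k) = e" using lift_conv_lift[OF Tc T' kG] T kG by (simp add: e_eq_lift)
  then show ?thesis using lift_in_S[OF k T(1)] lift_in_S[OF ik T'] homogeneous_lift[of T' "inv k"] by blast
qed

definition \<kappa> :: "complex mat \<Rightarrow> 'a \<Rightarrow> complex" where "\<kappa> = inv_into (carrier S) \<tau>"

lemma \<kappa>_S [simp]: "A \<in> carrier_mat n n \<Longrightarrow> \<kappa> A \<in> carrier S"
  and \<tau>_\<kappa> [simp]: "A \<in> carrier_mat n n \<Longrightarrow> \<tau> (\<kappa> A) = A"
  and \<kappa>_\<tau> [simp]: "s \<in> carrier S \<Longrightarrow> \<kappa> (\<tau> s) = s"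
  using \<tau>_bij unfolding \<kappa>_def by (auto simp: bij_betw_def inv_into_into f_inv_into_f)

lemma \<kappa>_eqI: "s \<in> carrier S \<Longrightarrow> \<tau> s = A \<Longrightarrow> \<kappa> A = s"
  using \<kappa>_\<tau> by blast

lemma \<kappa>_add: "A \<in> carrier_mat n n \<Longrightarrow> B \<in> carrier_mat n n \<Longrightarrow> \<kappa> (A + B) = (\<lambda>x. \<kappa> A x + \<kappa> B x)"
  by (intro \<kappa>_eqI) (simp_all add: \<tau>_add)

lemma \<kappa>_smult: "A \<in> carrier_mat n n \<Longrightarrow> \<kappa> (c \<cdot>\<^sub>m A) = (\<lambda>x. c * \<kappa> A x)"
  by (intro \<kappa>_eqI) (simp_all add: \<tau>_scale)

lemma \<kappa>_mult: "A \<in> carrier_mat n n \<Longrightarrow> B \<in> carrier_mat n n \<Longrightarrow> \<kappa> (A * B) = \<kappa> A \<star> \<kappa> B"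
  by (intro \<kappa>_eqI) (simp_all add: \<tau>_conv)

end

section \<open>The magic representation, inflated to H\<close>

locale five_magic = five_matrix G L d \<Phi> K \<phi> n \<tau>
  for G :: "('a, 'b) monoid_scheme" (structure) and L d \<Phi> K \<phi> n \<tau> +
  fixes H :: "'a set" and \<sigma> :: "'a set \<Rightarrow> 'a \<Rightarrow> complex"
  assumes subgroup_H: "subgroup H G" and L_sub_H: "L \<subseteq> H"
    and magic: "magic_representation G K L \<phi> H \<sigma>"
    and generated: "\<And>g. g \<in> carrier G \<Longrightarrow> \<exists>h\<in>H. \<exists>k\<in>K. g = h \<otimes> k"
begin

sublocale H: subgroup H G by (rule subgroup_H)

lemma group_H: "group (G\<lparr>carrier := H\<rparr>)"
  by (rule H.subgroup_is_group[OF is_group])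

lemma H_carrier [simp]: "h \<in> H \<Longrightarrow> h \<in> carrier G"
  using H.subset by blast

lemma inv_H [simp]: "h \<in> H \<Longrightarrow> inv\<^bsub>G\<lparr>carrier := H\<rparr>\<^esub> h = inv h"
  by (rule m_inv_consistent[OF subgroup_H])

lemma L_normal_H: "L \<lhd> G\<lparr>carrier := H\<rparr>"
  by (rule normal_restrict_supergroup[OF subgroup_H normal_L L_sub_H])

lemma r_coset_H: "L #>\<^bsub>G\<lparr>carrier := H\<rparr>\<^esub> h = L #> h"
  by (simp add: r_coset_def)

lemma coset_mem_Mod: "h \<in> H \<Longrightarrow> L #> h \<in> carrier (G\<lparr>carrier := H\<rparr> Mod L)"
  by (auto simp: FactGroup_def RCOSETS_def r_coset_def)

lemma coset_mult_H: "h \<in> H \<Longrightarrow> h' \<in> H \<Longrightarrow> (L #> h) \<otimes>\<^bsub>G\<lparr>carrier := H\<rparr> Mod L\<^esub> (L #> h') = L #> (h \<otimes> h')"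
  using normal.rcos_sum[OF L_normal_H, of h h'] by (simp add: FactGroup_def r_coset_H)

definition sg :: "'a \<Rightarrow> 'a \<Rightarrow> complex" where "sg h = \<sigma> (L #> h)"

lemma \<sigma>_hom: "\<sigma> \<in> hom (G\<lparr>carrier := H\<rparr> Mod L) (units_of S)"
  using magic by (simp add: magic_representation_def)

lemma sg_unit: "h \<in> H \<Longrightarrow> sg h \<in> Units S"
  using \<sigma>_hom coset_mem_Mod by (auto simp: hom_def units_of_def sg_def)

lemma sg_S [simp]: "h \<in> H \<Longrightarrow> sg h \<in> carrier S"
  using sg_unit by (auto simp: Units_def)

lemma sg_mult: "h \<in> H \<Longrightarrow> h' \<in> H \<Longrightarrow> sg (h \<otimes> h') = sg h \<star> sg h'"
  using hom_mult[OF \<sigma>_hom coset_mem_Mod coset_mem_Mod, of h h'] coset_mult_H[of h h']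
  by (simp only: sg_def units_of_def monoid.simps S_simps)

lemma sg_one: "sg \<one> = e"
proof -
  interpret S: Group.monoid S by (rule monoid_S)
  have "sg \<one> \<star> sg \<one> = sg \<one> \<star> e" using sg_mult[of \<one> \<one>] S_conv_e[of "sg \<one>"] by simp
  then show ?thesis using S.Units_l_cancel[OF sg_unit, of \<one> "sg \<one>" e] e_in_S by simp
qed

lemma sg_L: "l \<in> L \<Longrightarrow> sg l = e"
  using coset_join2[OF L_carrier L.subgroup_axioms, of l] coset_join2[OF one_closed L.subgroup_axioms] sg_one
  by (simp add: sg_def)

lemma sg_inv: "h \<in> H \<Longrightarrow> sg h \<star> sg (inv h) = e" "h \<in> H \<Longrightarrow> sg (inv h) \<star> sg h = e"
  using sg_mult[of h "inv h"] sg_mult[of "inv h" h] sg_one by auto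

lemma sg_m_inv: "h \<in> H \<Longrightarrow> inv\<^bsub>S\<^esub> (sg h) = sg (inv h)"
  using Group.monoid.inv_unique'[OF monoid_S, of "sg h" "sg (inv h)"] sg_inv by simp

lemma conj_sg: "h \<in> H \<Longrightarrow> s \<in> carrier S \<Longrightarrow> conj_elem G s h = sg (inv h) \<star> s \<star> sg h"
proof -
  assume h: "h \<in> H" and s: "s \<in> carrier S"
  have "h \<in> L #> h" using rcos_self[OF _ L.subgroup_axioms] h by simp
  then have "conj_elem G s h = inv\<^bsub>S\<^esub> (\<sigma> (L #> h)) \<otimes>\<^bsub>S\<^esub> s \<otimes>\<^bsub>S\<^esub> \<sigma> (L #> h)"
    using magic coset_mem_Mod[OF h] s unfolding magic_representation_def by blast
  then show ?thesis using sg_m_inv[OF h] by (simp add: sg_def)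
qed

lemma conj_S: "h \<in> H \<Longrightarrow> s \<in> carrier S \<Longrightarrow> conj_elem G s h \<in> carrier S \<and> \<tau> (conj_elem G s h) = \<tau> (sg (inv h)) * \<tau> s * \<tau> (sg h)"
  by (simp add: conj_sg \<tau>_conv)

definition \<Sigma> :: "'a \<Rightarrow> complex mat" where "\<Sigma> h = \<tau> (sg h)"

lemma \<Sigma>_carrier [simp]: "h \<in> H \<Longrightarrow> \<Sigma> h \<in> carrier_mat n n"
  by (simp add: \<Sigma>_def)

lemma \<Sigma>_mult: "h \<in> H \<Longrightarrow> h' \<in> H \<Longrightarrow> \<Sigma> (h \<otimes> h') = \<Sigma> h * \<Sigma> h'"
  by (simp add: \<Sigma>_def sg_mult \<tau>_conv)

lemma \<Sigma>_L: "l \<in> L \<Longrightarrow> \<Sigma> l = 1\<^sub>m n"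
  by (simp add: \<Sigma>_def sg_L \<tau>_e)

lemma representation_\<Sigma>: "representation (G\<lparr>carrier := H\<rparr>) n \<Sigma>"
  unfolding representation_altdef[OF group_H] by (auto simp: \<Sigma>_mult \<Sigma>_L)

lemma \<Sigma>_pow: "h \<in> H \<Longrightarrow> \<Sigma> (h [^] (j::nat)) = \<Sigma> h ^\<^sub>m j"
proof (induction j)
  case (Suc j)
  have "h [^] j \<in> H" using Suc.prems by (induction j) auto
  then show ?case using Suc by (simp add: \<Sigma>_mult)
next
  case 0
  then show ?case by (simp add: \<Sigma>_L carrier_matD(1)[OF \<Sigma>_carrier])
qed

lemma trace_\<Sigma>_mod_2:
  assumes h: "h \<in> H" and m: "m > 0" "odd m" "coprime m n" and oddn: "odd n"
    and hm: "\<And>x. x \<in> H \<Longrightarrow> x [^] (m::nat) \<in> L"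
    and det: "\<And>x. x \<in> H \<Longrightarrow> Determinant.det (\<Sigma> x) = 1"
  shows "\<exists>y\<in>int_adj (cis (2 * pi / real m)). trace_mat (\<Sigma> h) = 1 + 2 * y"
proof -
  let ?Z = "int_adj (cis (2 * pi / real m))"
  \<comment> \<open>A square root of \<open>h\<close> modulo \<open>L\<close>, because
    \<open>m\<close> is odd and \<open>h [^] m\<close> lies in \<open>L\<close>.\<close>
  define g where "g = h [^] ((m + 1) div 2)"
  have pow_H: "h [^] (j::nat) \<in> H" for j using h by (induction j) auto
  have g: "g \<in> H" unfolding g_def by (rule pow_H)
  have "g \<otimes> g = h [^] ((m + 1) div 2 + (m + 1) div 2)" unfolding g_def using h by (intro nat_pow_mult) auto
  also have "(m + 1) div 2 + (m + 1) div 2 = Suc m" using m(2) by presburger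
  finally have gg: "g \<otimes> g = h [^] m \<otimes> h" by simp
  have "\<Sigma> (g \<otimes> g) = \<Sigma> h" unfolding gg using \<Sigma>_mult[OF pow_H h, of m] \<Sigma>_L[OF hm[OF h]] h
    by (simp add: left_mult_one_mat[OF \<Sigma>_carrier])
  then have sq: "\<Sigma> g * \<Sigma> g = \<Sigma> h" using \<Sigma>_mult[OF g g] by simp
  have Um: "\<Sigma> g ^\<^sub>m m = 1\<^sub>m n" using \<Sigma>_pow[OF g, of m] \<Sigma>_L[OF hm[OF g]] by simp
  have gi: "inv g \<in> H" using g by simp
  have inv1: "\<Sigma> g * \<Sigma> (inv g) = 1\<^sub>m n" "\<Sigma> (inv g) * \<Sigma> g = 1\<^sub>m n"
    using \<Sigma>_mult[OF g gi] \<Sigma>_mult[OF gi g] \<Sigma>_L[of \<one>] g by simp_all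
  obtain c :: nat where c: "odd c" "(trace_mat (\<Sigma> g))\<^sup>2 = of_nat c"
    using conj_trace_square[OF H_carrier[OF g] \<Sigma>_carrier[OF g] \<Sigma>_carrier[OF gi] inv1 det[OF g] Um m(1,3) oddn]
      conj_S[OF g] unfolding \<Sigma>_def by blast
  obtain y where y: "y \<in> ?Z" "(trace_mat (\<Sigma> g))\<^sup>2 = trace_mat (\<Sigma> g * \<Sigma> g) + 2 * y"
    using trace_square_mod_2[OF \<Sigma>_carrier[OF g] Um m(1)] by blast
  obtain b where b: "c = 2 * b + 1" using c(1) by (auto elim: oddE)
  have "trace_mat (\<Sigma> h) = 1 + 2 * (of_nat b - y)" using y(2) c(2) unfolding sq b by (simp add: algebra_simps)
  moreover have "of_nat b - y \<in> ?Z" using y(1) by auto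
  ultimately show ?thesis by blast
qed

text \<open>Irreducibility: an \<open>H\<close>-invariant subspace \<open>W\<close> of \<open>E V\<close> yields the \<open>G\<close>-invariant subspace of all vectors
  whose images under the matrix units \<open>E 0 i\<close> lie in \<open>W\<close>. It is invariant under \<open>K\<close> because every element of
  \<open>K\<close> acts as a product of an element of \<open>S\<close> and an element of \<open>\<complex>L\<close>.\<close>

lemma exists_factor_character:
  assumes irr: "irreducible_representation G D \<rho>" and ext_e: "rep.ext G D \<rho> e = 1\<^sub>m D"
  shows "\<exists>\<xi>\<in>Irr (G\<lparr>carrier := H\<rparr>). \<forall>h\<in>H. trace_mat (\<rho> h) = trace_mat (\<Sigma> h) * \<xi> h"
proof -
  interpret R: irrep G D \<rho> by unfold_locales (use irr finite_group in auto)
  have extS: "R.ext (s \<star> t) = R.ext s * R.ext t" for s t by (rule R.ext_conv)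
  \<comment> \<open>The matrix algebra acts on the module of \<rho> through S; by
    \<open>ext_e\<close> its identity acts as the identity.\<close>
  define F where "F A = R.ext (\<kappa> A)" for A
  have F [simp]: "F A \<in> carrier_mat D D" "dim_row (F A) = D" "dim_col (F A) = D" for A by (simp_all add: F_def)
  have F_mult: "F (A * B) = F A * F B" if "A \<in> carrier_mat n n" "B \<in> carrier_mat n n" for A B
    using that by (simp add: F_def \<kappa>_mult extS)
  have F_add: "F (A + B) = F A + F B" if "A \<in> carrier_mat n n" "B \<in> carrier_mat n n" for A B
    using that by (simp add: F_def \<kappa>_add R.ext_add)
  have F_smult: "F (c \<cdot>\<^sub>m A) = c \<cdot>\<^sub>m F A" if "A \<in> carrier_mat n n" for A c
    using that by (simp add: F_def \<kappa>_smult R.ext_scale)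
  have F_\<tau>: "F (\<tau> s) = R.ext s" if "s \<in> carrier S" for s using that by (simp add: F_def)
  have F_zero: "F (0\<^sub>m n n) = 0\<^sub>m D D"
    using linear_map_msum[OF F_add F_smult F(1), where I = "{} :: nat set"] by simp
  define E where "E i j = F (elem_mat n n i j)" for i j
  have E [simp]: "E i j \<in> carrier_mat D D" "dim_row (E i j) = D" "dim_col (E i j) = D" for i j by (simp_all add: E_def)
  have EE: "E i j * E k l = (if j = k then E i l else 0\<^sub>m D D)" if "i < n" "j < n" "k < n" "l < n" for i j k l
    unfolding E_def using that by (simp add: F_mult[symmetric] elem_mat_mult F_zero)
  have F_expand: "F A = msum D D (\<lambda>p. A $$ p \<cdot>\<^sub>m E (fst p) (snd p)) ({..<n} \<times> {..<n})" if A: "A \<in> carrier_mat n n" for A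
  proof -
    have "F A = F (msum n n (\<lambda>(i, j). A $$ (i, j) \<cdot>\<^sub>m elem_mat n n i j) ({..<n} \<times> {..<n}))"
      using mat_eq_msum_elem_mat[OF A] by simp
    also have "\<dots> = msum D D (\<lambda>p. F (case p of (i, j) \<Rightarrow> A $$ (i, j) \<cdot>\<^sub>m elem_mat n n i j)) ({..<n} \<times> {..<n})"
      by (rule linear_map_msum[OF F_add F_smult F(1)]) auto
    also have "\<dots> = msum D D (\<lambda>p. A $$ p \<cdot>\<^sub>m E (fst p) (snd p)) ({..<n} \<times> {..<n})"
      by (intro msum_cong refl) (auto simp: F_smult E_def)
    finally show ?thesis .
  qed
  have n0: "0 < n" by (rule n_pos)
  have E00: "E 0 0 * E 0 0 = E 0 0" using EE n0 by simp
  \<comment> \<open>In coordinates, \<open>B\<close> is the inclusion of the image of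
    \<open>E 0 0\<close> and \<open>C\<close> is the projection onto it.\<close>
  obtain r B C where BC: "B \<in> carrier_mat D r" "C \<in> carrier_mat r D" "B * C = E 0 0" "C * B = 1\<^sub>m r"
    using idempotent_factorization[OF E(1) E00] by blast
  have dBC [simp]: "dim_row B = D" "dim_col B = r" "dim_row C = r" "dim_col C = D" using BC by auto
  have "B * C * B = B" by (simp add: mult_mat_assoc_dim BC(4) mult_mat_one_dim)
  then have EB: "E 0 0 * B = B" unfolding BC(3) .
  have CE: "C * E 0 0 = C" unfolding BC(3)[symmetric] by (simp add: mat_cancel_left[OF BC(4)])
  define R' where "R' h = R.ext (sg h)" for h
  have R' [simp]: "R' h \<in> carrier_mat D D" "dim_row (R' h) = D" "dim_col (R' h) = D" for h by (simp_all add: R'_def)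
  have R'_mult: "R' (h \<otimes> h') = R' h * R' h'" if "h \<in> H" "h' \<in> H" for h h' using that by (simp add: R'_def sg_mult extS)
  have R'_L: "R' l = 1\<^sub>m D" if "l \<in> L" for l using that ext_e by (simp add: R'_def sg_L)
  have R'_inv: "R' h * R' (inv h) = 1\<^sub>m D" "R' (inv h) * R' h = 1\<^sub>m D" if "h \<in> H" for h
    using that R'_mult[of h "inv h"] R'_mult[of "inv h" h] R'_L[of \<one>] by simp_all
  define \<rho>' where "\<rho>' h = \<rho> h * R' (inv h)" for h
  have \<rho>' [simp]: "h \<in> H \<Longrightarrow> \<rho>' h \<in> carrier_mat D D" "h \<in> H \<Longrightarrow> dim_row (\<rho>' h) = D" "h \<in> H \<Longrightarrow> dim_col (\<rho>' h) = D" for h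
    by (auto simp: \<rho>'_def intro!: carrier_matI)
  have \<rho>_eq: "\<rho> h = \<rho>' h * R' h" if h: "h \<in> H" for h
    unfolding \<rho>'_def using h by (simp add: mult_mat_assoc_dim R'_inv mult_mat_one_dim)
  have ext_\<rho>: "R.ext s * \<rho> h = \<rho> h * (R' (inv h) * R.ext s * R' h)" if h: "h \<in> H" and s: "s \<in> carrier S" for h s
  proof -
    have hG: "h \<in> carrier G" using h by simp
    \<comment> \<open>Conjugation by \<open>h\<close> is computed first with group elements and then
      by the magic relation.\<close>
    have "R.ext (conj_elem G s h) = \<rho> (inv h) * R.ext s * \<rho> h"
      unfolding conj_elem_def using hG by (simp add: extS R.ext_group_elem)
    moreover have "R.ext (conj_elem G s h) = R' (inv h) * R.ext s * R' h"
      unfolding conj_sg[OF h s] by (simp add: extS R'_def)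
    ultimately have "\<rho> h * (R' (inv h) * R.ext s * R' h) = \<rho> h * (\<rho> (inv h) * (R.ext s * \<rho> h))"
      using hG by (simp add: mult_mat_assoc_dim)
    also have "\<dots> = R.ext s * \<rho> h" using hG by (intro mat_cancel_left[of _ _ D]) auto
    finally show ?thesis ..
  qed
  have comm: "R.ext s * \<rho>' h = \<rho>' h * R.ext s" if h: "h \<in> H" and s: "s \<in> carrier S" for h s
  proof -
    have hG: "h \<in> carrier G" using h by simp
    have "R.ext s * \<rho>' h = (R.ext s * \<rho> h) * R' (inv h)" unfolding \<rho>'_def using hG by (simp add: mult_mat_assoc_dim)
    also have "\<dots> = \<rho> h * R' (inv h) * R.ext s * (R' h * R' (inv h))" unfolding ext_\<rho>[OF h s] using hG
      by (simp add: mult_mat_assoc_dim)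
    also have "\<dots> = \<rho>' h * R.ext s" unfolding R'_inv(1)[OF h] \<rho>'_def using hG by (simp add: mult_mat_one_dim)
    finally show ?thesis .
  qed
  have comm_F: "F A * \<rho>' h = \<rho>' h * F A" if "h \<in> H" "A \<in> carrier_mat n n" for h A
    unfolding F_def using comm[OF that(1)] that(2) by simp
  have \<rho>'_mult: "\<rho>' (h \<otimes> h') = \<rho>' h * \<rho>' h'" if h: "h \<in> H" "h' \<in> H" for h h'
  proof -
    have hG: "h \<in> carrier G" "h' \<in> carrier G" using h by auto
    have "\<rho>' (h \<otimes> h') = \<rho> h * (\<rho>' h' * R' (inv h))"
      unfolding \<rho>'_def using hG h by (simp add: R.rep_mult inv_mult_group R'_mult mult_mat_assoc_dim)
    also have "\<rho>' h' * R' (inv h) = R' (inv h) * \<rho>' h'"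
      using comm[OF h(2), of "sg (inv h)"] h by (simp add: R'_def)
    finally show ?thesis unfolding \<rho>'_def[of h] using hG h by (simp add: mult_mat_assoc_dim)
  qed
  define \<Xi> where "\<Xi> h = C * \<rho>' h * B" for h
  have \<Xi> [simp]: "h \<in> H \<Longrightarrow> \<Xi> h \<in> carrier_mat r r" for h by (auto simp: \<Xi>_def intro!: carrier_matI)
  have comm_E: "E i j * \<rho>' h = \<rho>' h * E i j" if "h \<in> H" for h i j
    unfolding E_def by (rule comm_F[OF that]) simp
  have rep\<Xi>: "representation (G\<lparr>carrier := H\<rparr>) r \<Xi>"
    unfolding representation_altdef[OF group_H]
  proof (intro conjI ballI)
    have "\<rho>' \<one> = 1\<^sub>m D" by (simp add: \<rho>'_def R'_L mult_mat_one_dim)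
    then show "\<Xi> \<one>\<^bsub>G\<lparr>carrier := H\<rparr>\<^esub> = 1\<^sub>m r" using BC by (simp add: \<Xi>_def mult_mat_one_dim)
    fix h h' assume "h \<in> carrier (G\<lparr>carrier := H\<rparr>)" "h' \<in> carrier (G\<lparr>carrier := H\<rparr>)"
    then have h: "h \<in> H" "h' \<in> H" by auto
    have "\<Xi> h * \<Xi> h' = C * (\<rho>' h * ((B * C) * (\<rho>' h' * B)))" unfolding \<Xi>_def using h by (simp add: mult_mat_assoc_dim)
    also have "(B * C) * (\<rho>' h' * B) = \<rho>' h' * (E 0 0 * B)"
      unfolding BC(3) using h comm_E[OF h(2), of 0 0] by (simp flip: mult_mat_assoc_dim)
    also have "C * (\<rho>' h * (\<rho>' h' * (E 0 0 * B))) = \<Xi> (h \<otimes> h')"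
      unfolding EB \<Xi>_def using h by (simp add: \<rho>'_mult mult_mat_assoc_dim)
    finally show "\<Xi> (h \<otimes>\<^bsub>G\<lparr>carrier := H\<rparr>\<^esub> h') = \<Xi> h * \<Xi> h'" by simp
  qed auto
  have char: "trace_mat (\<rho> h) = trace_mat (\<Sigma> h) * trace_mat (\<Xi> h)" if h: "h \<in> H" for h
  proof -
    \<comment> \<open>As \<open>\<rho>' h\<close> commutes with S, this functional vanishes on
      commutators and is a multiple of the trace. Its value at \<open>\<Sigma> h\<close> is the
      trace of \<open>\<rho> h\<close>, and the multiplier is the trace of
      \<open>\<Xi> h\<close>.\<close>
    define f where "f A = trace_mat (\<rho>' h * F A)" for A
    have "f (\<Sigma> h) = f (elem_mat n n 0 0) * trace_mat (\<Sigma> h)"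
    proof (rule trace_functional_unique)
      fix A B :: "complex mat" assume A: "A \<in> carrier_mat n n" and B: "B \<in> carrier_mat n n"
      have "\<rho>' h * (F A + F B) = \<rho>' h * F A + \<rho>' h * F B" using h by (intro mult_add_distrib_mat[of _ D D _ D]) auto
      then show "f (A + B) = f A + f B" using A B h
        by (simp add: f_def F_add trace_mat_add[of _ D] mult_carrier_mat[of _ D D])
      have "trace_mat ((\<rho>' h * F A) * F B) = trace_mat (F B * (\<rho>' h * F A))"
        using h by (intro trace_mat_comm[of _ D D]) (auto intro!: carrier_matI)
      also have "F B * (\<rho>' h * F A) = \<rho>' h * F B * F A" using comm_F[OF h B] h by (simp flip: mult_mat_assoc_dim)
      finally show "f (A * B) = f (B * A)" using A B h by (simp add: f_def F_mult mult_mat_assoc_dim)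
    next
      fix c and A :: "complex mat" assume A: "A \<in> carrier_mat n n"
      show "f (c \<cdot>\<^sub>m A) = c * f A" using A h by (simp add: f_def F_smult mult_smult_dim)
    qed (use h in auto)
    moreover have "f (\<Sigma> h) = trace_mat (\<rho> h)" unfolding f_def \<Sigma>_def using h by (simp add: F_\<tau> \<rho>_eq R'_def)
    moreover have "f (elem_mat n n 0 0) = trace_mat (\<Xi> h)"
    proof -
      have "f (elem_mat n n 0 0) = trace_mat ((\<rho>' h * B) * C)"
        unfolding f_def E_def[symmetric] BC(3)[symmetric] using h by (simp add: mult_mat_assoc_dim)
      also have "\<dots> = trace_mat (C * (\<rho>' h * B))" using h by (intro trace_mat_comm[of _ D r]) (auto intro!: carrier_matI)
      finally show ?thesis unfolding \<Xi>_def using h by (simp add: mult_mat_assoc_dim)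
    qed
    ultimately show ?thesis by (simp add: mult.commute)
  qed
  have r0: "0 < r"
  proof -
    \<comment> \<open>At the identity the factorization of characters reads D = n r, which excludes
      r = 0.\<close>
    have "of_nat D = (of_nat n * of_nat r :: complex)"
      using char[of \<one>] \<Sigma>_L[of \<one>] P.is_group rep\<Xi> unfolding representation_altdef[OF group_H] by simp
    then show ?thesis using R.dim_pos by (cases "r = 0") auto
  qed
  have irr\<Xi>: "irreducible_representation (G\<lparr>carrier := H\<rparr>) r \<Xi>"
    unfolding irreducible_representation_def
  proof (intro conjI allI impI rep\<Xi> r0)
    fix W assume sub: "VectorSpace.subspace class_ring W (module_vec TYPE(complex) r)"
      and inv: "\<forall>g\<in>carrier (G\<lparr>carrier := H\<rparr>). \<forall>w\<in>W. \<Xi> g *\<^sub>v w \<in> W"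
    from sub have sm: "submodule (class_ring :: complex ring) W (module_vec TYPE(complex) r)"
      by (simp add: VectorSpace.subspace_def)
    have Wc: "W \<subseteq> carrier_vec r" using submodule.subset[OF sm] by (simp add: module_vec_simps)
    have W0: "0\<^sub>v r \<in> W" using submodule.zero_closed[OF sm] by (simp add: module_vec_simps)
    have Wadd: "v + w \<in> W" if "v \<in> W" "w \<in> W" for v w using submodule.m_closed[OF sm that] by (simp add: module_vec_simps)
    have Wsm: "c \<cdot>\<^sub>v v \<in> W" if "v \<in> W" for c v using submodule.smult_closed[OF sm _ that, of c] by (simp add: module_vec_simps)
    define W2 where "W2 = {v \<in> carrier_vec D. \<forall>i<n. C *\<^sub>v (E 0 i *\<^sub>v v) \<in> W}"
    have Ev: "E i j *\<^sub>v v \<in> carrier_vec D" if "v \<in> carrier_vec D" for i j v using that by (intro mult_mat_vec_carrier[OF E(1)])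
    have C0: "C *\<^sub>v 0\<^sub>v D = 0\<^sub>v r" by (intro eq_vecI) (auto simp: scalar_prod_def)
    have E0: "E i j *\<^sub>v 0\<^sub>v D = 0\<^sub>v D" for i j by (intro eq_vecI) (auto simp: scalar_prod_def)
    have W2c: "W2 \<subseteq> carrier_vec D" by (auto simp: W2_def)
    have W20: "0\<^sub>v D \<in> W2" by (simp add: W2_def E0 C0 W0)
    have W2add: "v + w \<in> W2" if "v \<in> W2" "w \<in> W2" for v w
      using that Wadd Ev BC(2) by (auto simp: W2_def mult_add_distrib_mat_vec[OF E(1)] mult_add_distrib_mat_vec[OF BC(2)])
    have W2sm: "c \<cdot>\<^sub>v v \<in> W2" if "v \<in> W2" for c v
      using that Wsm Ev BC(2) by (auto simp: W2_def mult_mat_vec[OF E(1)] mult_mat_vec[OF BC(2)])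
    have W2E: "E k l *\<^sub>v v \<in> W2" if v: "v \<in> W2" and kl: "k < n" "l < n" for k l v
    proof -
      have vc: "v \<in> carrier_vec D" using v W2c by blast
      have "C *\<^sub>v (E 0 i *\<^sub>v (E k l *\<^sub>v v)) \<in> W" if i: "i < n" for i
      proof -
        have "E 0 i *\<^sub>v (E k l *\<^sub>v v) = (E 0 i * E k l) *\<^sub>v v"
          using vc by (intro assoc_mult_mat_vec[symmetric, of _ D D _ D]) auto
        also have "\<dots> = (if i = k then E 0 l *\<^sub>v v else 0\<^sub>v D)" using EE[OF n0 i kl] vc
          by (auto intro!: eq_vecI)
        finally show ?thesis using v kl by (simp add: W2_def C0 W0)
      qed
      then show ?thesis using Ev[OF vc] by (simp add: W2_def)
    qed
    have W2S: "R.ext s *\<^sub>v v \<in> W2" if v: "v \<in> W2" and s: "s \<in> carrier S" for s v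
    proof -
      have vc: "v \<in> carrier_vec D" using v W2c by blast
      have "R.ext s = msum D D (\<lambda>p. \<tau> s $$ p \<cdot>\<^sub>m E (fst p) (snd p)) ({..<n} \<times> {..<n})"
        unfolding F_\<tau>[OF s, symmetric] using s by (intro F_expand) simp
      moreover have "msum D D (\<lambda>p. \<tau> s $$ p \<cdot>\<^sub>m E (fst p) (snd p)) ({..<n} \<times> {..<n}) *\<^sub>v v \<in> W2"
      proof (rule msum_mult_vec_mem[OF W20 W2add vc])
        fix p assume "p \<in> {..<n} \<times> {..<n}"
        then have "E (fst p) (snd p) *\<^sub>v v \<in> W2" using W2E[OF v] by auto
        moreover have "(\<tau> s $$ p \<cdot>\<^sub>m E (fst p) (snd p)) *\<^sub>v v = \<tau> s $$ p \<cdot>\<^sub>v (E (fst p) (snd p) *\<^sub>v v)"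
          using vc by (intro eq_vecI) auto
        ultimately show "(\<tau> s $$ p \<cdot>\<^sub>m E (fst p) (snd p)) *\<^sub>v v \<in> W2" using W2sm by simp
      qed auto
      ultimately show ?thesis by simp
    qed
    have W2\<rho>': "\<rho>' h *\<^sub>v v \<in> W2" if v: "v \<in> W2" and h: "h \<in> H" for h v
    proof -
      have vc: "v \<in> carrier_vec D" using v W2c by blast
      have "C *\<^sub>v (E 0 i *\<^sub>v (\<rho>' h *\<^sub>v v)) \<in> W" if i: "i < n" for i
      proof -
        have "C * (E 0 i * \<rho>' h) = C * (\<rho>' h * (E 0 0 * E 0 i))"
          unfolding comm_E[OF h] using EE[OF n0 n0 n0 i] by simp
        also have "\<dots> = \<Xi> h * (C * E 0 i)" unfolding BC(3)[symmetric] \<Xi>_def using h by (simp add: mult_mat_assoc_dim)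
        finally have e: "C * (E 0 i * \<rho>' h) = \<Xi> h * (C * E 0 i)" .
        have "C *\<^sub>v (E 0 i *\<^sub>v (\<rho>' h *\<^sub>v v)) = C *\<^sub>v ((E 0 i * \<rho>' h) *\<^sub>v v)"
          using vc h by (simp add: assoc_mult_mat_vec[of _ D D _ D])
        also have "\<dots> = (C * (E 0 i * \<rho>' h)) *\<^sub>v v"
          using vc h BC(2) by (intro assoc_mult_mat_vec[symmetric, of _ r D _ D]) (auto intro!: carrier_matI)
        also have "\<dots> = \<Xi> h *\<^sub>v ((C * E 0 i) *\<^sub>v v)"
          unfolding e using vc h BC(2) by (intro assoc_mult_mat_vec[of _ r r _ D]) (auto intro!: carrier_matI)
        also have "(C * E 0 i) *\<^sub>v v = C *\<^sub>v (E 0 i *\<^sub>v v)"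
          using vc BC(2) by (intro assoc_mult_mat_vec[of _ r D _ D]) auto
        finally show ?thesis using inv h v i by (auto simp: W2_def)
      qed
      then show ?thesis using vc h mult_mat_vec_carrier[OF \<rho>'(1)[OF h] vc] by (simp add: W2_def)
    qed
    have W2H: "\<rho> h *\<^sub>v v \<in> W2" if v: "v \<in> W2" and h: "h \<in> H" for h v
    proof -
      have vc: "v \<in> carrier_vec D" using v W2c by blast
      have "\<rho> h *\<^sub>v v = \<rho>' h *\<^sub>v (R' h *\<^sub>v v)" unfolding \<rho>_eq[OF h] using h vc
        by (intro assoc_mult_mat_vec[of _ D D _ D]) auto
      moreover have "R' h *\<^sub>v v \<in> W2" unfolding R'_def using h by (intro W2S[OF v]) simp
      ultimately show ?thesis using W2\<rho>' h by simp
    qed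
    have W2K: "\<rho> k *\<^sub>v v \<in> W2" if v: "v \<in> W2" and k: "k \<in> K" for k v
    proof -
      have vc: "v \<in> carrier_vec D" using v W2c by blast
      have kG: "k \<in> carrier G" using k by simp
      obtain s w where sw: "s \<in> carrier S" "w \<in> carrier S" "homogeneous w (inv k)" "s \<star> w = e"
        using S_unit_pair[OF k] by blast
      \<comment> \<open>\<open>w\<close> lives on the coset of \<open>inv k\<close>, so
        \<open>b\<close> lives on \<open>L\<close>.\<close>
      define b where "b = w \<star> group_elem k"
      have supp: "b x = 0" if x: "x \<in> carrier G" "x \<notin> L" for x
      proof (rule ccontr)
        assume "b x \<noteq> 0"
        then have "k \<otimes> (x \<otimes> inv k) \<in> L" using sw(3) kG x(1) by (auto simp: b_def conv_group_elem homogeneous_def)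
        then have "inv k \<otimes> (k \<otimes> (x \<otimes> inv k)) \<otimes> k \<in> L" by (rule conj_closed(1)[OF kG])
        then show False using x kG by (simp add: m_assoc)
      qed
      have "\<rho> k = R.ext e * \<rho> k" unfolding ext_e using kG by (simp add: mult_mat_one_dim)
      also have "\<dots> = R.ext s * R.ext b"
        unfolding sw(4)[symmetric] b_def using kG by (simp add: extS R.ext_group_elem mult_mat_assoc_dim)
      finally have "\<rho> k *\<^sub>v v = R.ext s *\<^sub>v (R.ext b *\<^sub>v v)" using vc by (simp add: assoc_mult_mat_vec[of _ D D _ D])
      moreover have "R.ext b *\<^sub>v v \<in> W2"
      proof -
        have "R.ext b = msum D D (\<lambda>l. b l \<cdot>\<^sub>m \<rho> l) L" using supp by (intro R.ext_restrict L.subset) auto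
        moreover have "msum D D (\<lambda>l. b l \<cdot>\<^sub>m \<rho> l) L *\<^sub>v v \<in> W2"
        proof (rule msum_mult_vec_mem[OF W20 W2add vc])
          show "finite L" using finite_group L.subset finite_subset by blast
          fix l assume l: "l \<in> L"
          have "(b l \<cdot>\<^sub>m \<rho> l) *\<^sub>v v = b l \<cdot>\<^sub>v (\<rho> l *\<^sub>v v)" using vc l by (intro eq_vecI) auto
          moreover have "\<rho> l *\<^sub>v v \<in> W2" using l L_sub_H by (intro W2H[OF v]) auto
          ultimately show "(b l \<cdot>\<^sub>m \<rho> l) *\<^sub>v v \<in> W2" using W2sm by simp
        qed auto
        ultimately show ?thesis by simp
      qed
      ultimately show ?thesis using W2S sw(1) by simp
    qed
    have "W2 = {0\<^sub>v D} \<or> W2 = carrier_vec D"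
    proof (rule R.invariant_subspace[OF W2c W20 W2add W2sm])
      fix g v assume g: "g \<in> carrier G" and v: "v \<in> W2"
      then have vc: "v \<in> carrier_vec D" using W2c by blast
      obtain h k where hk: "h \<in> H" "k \<in> K" "g = h \<otimes> k" using generated[OF g] by blast
      have "\<rho> g *\<^sub>v v = \<rho> h *\<^sub>v (\<rho> k *\<^sub>v v)" unfolding hk(3) using hk(1,2) vc
        by (simp add: R.rep_mult assoc_mult_mat_vec[of _ D D _ D])
      then show "\<rho> g *\<^sub>v v \<in> W2" using W2H W2K v hk by simp
    qed
    \<comment> \<open>\<open>B\<close> maps \<open>W\<close> into \<open>W2\<close>, and applying
      \<open>C\<close> after \<open>E 0 0\<close> recovers the vector. So if \<open>W2\<close> is
      zero or everything, the same holds for \<open>W\<close>.\<close>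
    moreover have embed: "C *\<^sub>v (E 0 i *\<^sub>v (B *\<^sub>v w)) = (if i = 0 then w else 0\<^sub>v r)" if w: "w \<in> carrier_vec r" and i: "i < n" for w i
    proof -
      have "E 0 i * B = E 0 i * E 0 0 * B" by (simp add: mult_mat_assoc_dim EB)
      also have "\<dots> = (if i = 0 then B else 0\<^sub>m D r)" using EE[OF n0 i n0 n0] EB by (simp add: left_mult_zero_mat[OF BC(1)])
      finally have eb: "E 0 i * B = (if i = 0 then B else 0\<^sub>m D r)" .
      have "E 0 i *\<^sub>v (B *\<^sub>v w) = (E 0 i * B) *\<^sub>v w" using w BC(1) by (intro assoc_mult_mat_vec[symmetric, of _ D D _ r]) auto
      then have "C *\<^sub>v (E 0 i *\<^sub>v (B *\<^sub>v w)) = (C * (E 0 i * B)) *\<^sub>v w"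
        using w BC by (simp add: assoc_mult_mat_vec[of _ r D _ r] eb)
      also have "\<dots> = (if i = 0 then w else 0\<^sub>v r)" unfolding eb using BC w by (auto intro!: eq_vecI)
      finally show ?thesis .
    qed
    ultimately show "W = {0\<^sub>v r} \<or> W = carrier_vec r"
    proof (elim disjE)
      assume z: "W2 = {0\<^sub>v D}"
      have "w = 0\<^sub>v r" if w: "w \<in> W" for w
      proof -
        have wc: "w \<in> carrier_vec r" using w Wc by blast
        have Bw: "B *\<^sub>v w \<in> carrier_vec D" using wc by (intro mult_mat_vec_carrier[OF BC(1)])
        have "B *\<^sub>v w \<in> W2" using Bw embed[OF wc] w W0 by (simp add: W2_def)
        then have b: "B *\<^sub>v w = 0\<^sub>v D" using z by simp
        have "w = C *\<^sub>v (E 0 0 *\<^sub>v (B *\<^sub>v w))" using embed[OF wc n0] by simp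
        then show ?thesis unfolding b E0 C0 .
      qed
      then show ?thesis using W0 by blast
    next
      assume a: "W2 = carrier_vec D"
      have "w \<in> W" if wc: "w \<in> carrier_vec r" for w
      proof -
        have "B *\<^sub>v w \<in> W2" unfolding a using wc by (intro mult_mat_vec_carrier[OF BC(1)])
        then have "C *\<^sub>v (E 0 0 *\<^sub>v (B *\<^sub>v w)) \<in> W" using n0 by (simp add: W2_def)
        then show ?thesis using embed[OF wc n0] by simp
      qed
      then show ?thesis using Wc by blast
    qed
  qed
  have "restrict (\<lambda>h. trace_mat (\<Xi> h)) H \<in> Irr (G\<lparr>carrier := H\<rparr>)" unfolding Irr_def using irr\<Xi> by auto
  then show ?thesis using char by (intro bexI[of _ "restrict (\<lambda>h. trace_mat (\<Xi> h)) H"]) auto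
qed

end

section \<open>Central idempotents acting on irreducible modules\<close>

lemma (in irrep) ext_central_idempotent:
  assumes idem: "f \<star> f = f" and inv: "\<And>g x. g \<in> carrier G \<Longrightarrow> x \<in> carrier G \<Longrightarrow> f (inv g \<otimes> x \<otimes> g) = f x"
  shows "ext f = 0\<^sub>m n n \<or> ext f = 1\<^sub>m n"
proof -
  \<comment> \<open>\<open>f\<close> is a class function and therefore central; Schur's lemma makes
    it act as a scalar, which equals its own square.\<close>
  have comm: "\<rho> g * ext f = ext f * \<rho> g" if g: "g \<in> carrier G" for g
  proof -
    have "group_elem g \<star> f = f \<star> group_elem g"
    proof
      fix x
      show "(group_elem g \<star> f) x = (f \<star> group_elem g) x"
      proof (cases "x \<in> carrier G")
        case True
        have "inv g \<otimes> (x \<otimes> inv g) \<otimes> g = inv g \<otimes> x" using g True by (simp add: m_assoc)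
        then show ?thesis using inv[OF g, of "x \<otimes> inv g"] g True by (simp add: group_elem_conv conv_group_elem)
      qed simp
    qed
    then have "ext (group_elem g) * ext f = ext f * ext (group_elem g)" by (simp flip: ext_conv)
    then show ?thesis using ext_group_elem[OF g] by simp
  qed
  obtain c where c: "ext f = c \<cdot>\<^sub>m 1\<^sub>m n" using schur_scalar[OF ext_carrier(1) comm] by blast
  have "ext f * ext f = ext f" using idem by (simp flip: ext_conv)
  then have "(c * c) \<cdot>\<^sub>m 1\<^sub>m n = c \<cdot>\<^sub>m 1\<^sub>m n" unfolding c
    by (simp add: mult_smult_dim smult_mult_dim smult_smult_mat)
  then have "((c * c) \<cdot>\<^sub>m 1\<^sub>m n) $$ (0, 0) = (c \<cdot>\<^sub>m 1\<^sub>m n) $$ (0, 0)" by simp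
  then have "c * c = c" using dim_pos by simp
  then have "c = 0 \<or> c = 1" by simp
  moreover have "0 \<cdot>\<^sub>m 1\<^sub>m n = (0\<^sub>m n n :: complex mat)" by (rule eq_matI) auto
  ultimately show ?thesis using c by auto
qed

text \<open>Substituting the formula for the idempotent turns the trace into an inner product. Hence
  a character that occurs in the restriction has an idempotent that acts with nonzero trace.\<close>

lemma (in rep) trace_ext_central_idem:
  assumes N: "subgroup N G" and \<Theta>: "representation (G\<lparr>carrier := N\<rparr>) t \<Theta>"
    and \<theta>: "\<theta> = restrict (\<lambda>g. trace_mat (\<Theta> g)) N"
  shows "trace_mat (ext (central_idem G N \<theta>)) =
    of_nat t * char_inner (G\<lparr>carrier := N\<rparr>) (restrict (\<lambda>g. trace_mat (\<rho> g)) N) \<theta>"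
proof -
  have NG: "x \<in> carrier G" if "x \<in> N" for x using that subgroup.subset[OF N] by blast
  have finN: "finite N" using subgroup.subset[OF N] finite_carrier finite_subset by blast
  interpret T: rep "G\<lparr>carrier := N\<rparr>" t \<Theta>
    using subgroup.subgroup_is_group[OF N is_group] \<Theta> finN by (simp add: rep_def rep_axioms_def)
  have one: "\<theta> \<one> = of_nat t" using T.rep_one subgroup.one_closed[OF N] by (simp add: \<theta>)
  have inv: "\<theta> (inv x) = cnj (\<theta> x)" if "x \<in> N" for x
    using T.trace_inv[of x] that subgroup.m_inv_closed[OF N that] m_inv_consistent[OF N that] by (simp add: \<theta>)
  have "trace_mat (ext (central_idem G N \<theta>)) = (\<Sum>g\<in>carrier G. central_idem G N \<theta> g * trace_mat (\<rho> g))"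
    by (rule trace_ext)
  also have "\<dots> = (\<Sum>g\<in>N. central_idem G N \<theta> g * trace_mat (\<rho> g))"
    using subgroup.subset[OF N] finite_carrier by (intro sum.mono_neutral_right) (auto simp: central_idem_def)
  also have "\<dots> = (\<Sum>g\<in>N. of_nat t / of_nat (card N) * (restrict (\<lambda>g. trace_mat (\<rho> g)) N g * cnj (\<theta> g)))"
    by (intro sum.cong refl) (simp add: central_idem_def one inv)
  also have "\<dots> = of_nat t / of_nat (card N) * (\<Sum>g\<in>N. restrict (\<lambda>g. trace_mat (\<rho> g)) N g * cnj (\<theta> g))"
    by (rule sum_distrib_left[symmetric])
  finally show ?thesis by (simp add: char_inner_def Coset.order_def)
qed

context five_algebra
begin

lemma e_conj:
  assumes "g \<in> carrier G" "x \<in> carrier G"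
  shows "e (inv g \<otimes> x \<otimes> g) = e x"
proof (cases "x \<in> L")
  case True
  have i: "inv (inv g \<otimes> x \<otimes> g) = inv g \<otimes> inv x \<otimes> g" using assms by (simp add: inv_mult_group m_assoc)
  have m: "inv g \<otimes> inv x \<otimes> g \<in> L" using assms True by (intro conj_closed) auto
  have "\<phi> (inv g \<otimes> inv x \<otimes> g) = \<phi> (inv x)"
    using invariant_\<Phi>[OF assms(1), of "inv x"] True m by (simp add: \<phi>_eq)
  then show ?thesis using True assms unfolding central_idem_def i by simp
next
  case False
  have "inv g \<otimes> x \<otimes> g \<notin> L"
  proof
    assume "inv g \<otimes> x \<otimes> g \<in> L"
    then have "g \<otimes> (inv g \<otimes> x \<otimes> g) \<otimes> inv g \<in> L" by (rule conj_closed(2)[OF assms(1)])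
    then show False using False assms by (simp add: m_assoc)
  qed
  then show ?thesis using False by (simp add: central_idem_def)
qed

text \<open>As a central idempotent, \<open>e\<close> acts as 0 or 1. It cannot act as 0: the
  idempotent of \<theta> acts with nonzero trace, and it absorbs \<open>e\<close> because
  \<open>e\<close> acts as 1 on the module of \<theta>.\<close>

lemma ext_e_eq_one:
  assumes \<rho>: "irreducible_representation G D \<rho>" and \<theta>: "\<theta> \<in> Irr_above (G\<lparr>carrier := K\<rparr>) L \<phi>"
    and above: "char_inner (G\<lparr>carrier := K\<rparr>) (restrict (\<lambda>g. trace_mat (\<rho> g)) K) \<theta> \<noteq> 0"
  shows "rep.ext G D \<rho> e = 1\<^sub>m D"
proof -
  interpret R: irrep G D \<rho> by unfold_locales (use \<rho> finite_group in auto)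
  let ?GK = "G\<lparr>carrier := K\<rparr>"
  obtain t \<Theta> where \<Theta>: "irreducible_representation ?GK t \<Theta>" "\<theta> = restrict (\<lambda>g. trace_mat (\<Theta> g)) K"
    using \<theta> by (auto simp: Irr_above_def elim: IrrE)
  have gK: "group ?GK" by (rule K.subgroup_is_group[OF is_group])
  have finK: "finite K" using finite_group K.subset finite_subset by blast
  interpret T: irrep ?GK t \<Theta> using gK \<Theta>(1) finK by (simp add: irrep_def irrep_axioms_def)
  have invK: "inv\<^bsub>?GK\<^esub> x = inv x" if "x \<in> K" for x by (rule m_inv_consistent[OF K.subgroup_axioms that])
  have LnK: "L \<lhd> ?GK" by (rule normal_restrict_supergroup[OF K.subgroup_axioms normal_L L_sub_K])
  \<comment> \<open>The facts about \<open>e\<close> inside \<open>K\<close>: the ambient group is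
    \<open>K\<close>, and \<open>L\<close> takes the place of \<open>K\<close>.\<close>
  interpret V: five_algebra ?GK L d \<Phi> L \<phi>
  proof (intro five_algebra.intro invariant_irrep.intro finite_group.intro five_algebra_axioms.intro
      invariant_irrep_axioms.intro finite_group_axioms.intro)
    show "group ?GK" by (rule gK)
    show "finite (carrier ?GK)" using finK by simp
    show "L \<lhd> ?GK" "L \<lhd> ?GK" by (rule LnK)+
    show "irreducible_representation (?GK\<lparr>carrier := L\<rparr>) d \<Phi>" using irred_\<Phi> by simp
    show "trace_mat (\<Phi> (inv\<^bsub>?GK\<^esub> g \<otimes>\<^bsub>?GK\<^esub> l \<otimes>\<^bsub>?GK\<^esub> g)) = trace_mat (\<Phi> l)" if "g \<in> carrier ?GK" "l \<in> L" for g l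
      using invariant_\<Phi>[of g l] that invK by simp
  qed (auto simp: \<phi>_eq)
  have eK: "central_idem ?GK L \<phi> = e"
    using L_sub_K invK by (auto simp: central_idem_def fun_eq_iff)
  have Te: "T.ext e = 0\<^sub>m t t \<or> T.ext e = 1\<^sub>m t"
    by (rule T.ext_central_idempotent) (use V.e_idem V.e_conj eK in auto)
  have "trace_mat (T.ext (central_idem ?GK L \<phi>)) =
      of_nat d * char_inner (?GK\<lparr>carrier := L\<rparr>) (restrict (\<lambda>g. trace_mat (\<Theta> g)) L) \<phi>"
    by (rule T.trace_ext_central_idem[OF normal_imp_subgroup[OF LnK] _ \<phi>_eq]) (use P.rep in simp)
  moreover have "restrict (\<lambda>g. trace_mat (\<Theta> g)) L = restrict \<theta> L"
    unfolding \<Theta>(2) using L_sub_K by (auto simp: restrict_def fun_eq_iff)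
  moreover have "char_inner (?GK\<lparr>carrier := L\<rparr>) (restrict \<theta> L) \<phi> \<noteq> 0" using \<theta> by (simp add: Irr_above_def)
  ultimately have "trace_mat (T.ext e) \<noteq> 0" using P.dim_pos eK by simp
  then have T1: "T.ext e = 1\<^sub>m t" using Te by auto
  let ?f = "central_idem G K \<theta>"
  \<comment> \<open>For \<open>x\<close> in \<open>K\<close> the coefficient of
    \<open>?f \<star> e\<close> at \<open>x\<close> is a multiple of the trace of
    \<open>T.ext e * \<Theta> (inv x)\<close>, and \<open>T.ext e\<close> is the identity by
    \<open>T1\<close>.\<close>
  have fe: "?f \<star> e = ?f"
  proof
    fix x
    show "(?f \<star> e) x = ?f x"
    proof (cases "x \<in> carrier G")
      case False
      then show ?thesis by (auto simp: central_idem_def)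
    next
      case x: True
      show ?thesis
      proof (cases "x \<in> K")
        case False
        have "x \<otimes> inv l \<notin> K" if l: "l \<in> L" for l
        proof
          assume h: "x \<otimes> inv l \<in> K"
          have "x \<otimes> inv l \<otimes> l \<in> K" by (rule K.m_closed[OF h subsetD[OF L_sub_K l]])
          then show False using False x l by (simp add: m_assoc)
        qed
        then have "(\<Sum>l\<in>L. ?f (x \<otimes> inv l) * e l) = 0"
          by (intro sum.neutral) (auto simp: central_idem_def)
        then show ?thesis using False conv_e_apply[OF x, of ?f] by (simp add: central_idem_def[of G K])
      next
        case xK: True
        let ?c = "\<theta> \<one> / of_nat (card K)"
        have xi: "inv x \<in> K" using xK by simp
        have "(?f \<star> e) x = (\<Sum>l\<in>L. ?f (x \<otimes> inv l) * e l)" by (rule conv_e_apply[OF x])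
        also have "\<dots> = (\<Sum>l\<in>L. ?c * trace_mat ((e l \<cdot>\<^sub>m \<Theta> l) * \<Theta> (inv x)))"
        proof (rule sum.cong[OF refl])
          fix l assume l: "l \<in> L"
          then have lK: "l \<in> K" using L_sub_K by blast
          have a: "x \<otimes> inv l \<in> K" using xK lK by simp
          have i: "inv (x \<otimes> inv l) = l \<otimes> inv x" using x l by (simp add: inv_mult_group)
          have "\<theta> (l \<otimes> inv x) = trace_mat (\<Theta> l * \<Theta> (inv x))"
            using T.rep_mult[of l "inv x"] lK xi K.m_closed[OF lK xi] by (simp add: \<Theta>(2))
          then have "?f (x \<otimes> inv l) = ?c * trace_mat (\<Theta> l * \<Theta> (inv x))" using a i by (simp add: central_idem_def)
          moreover have "(e l \<cdot>\<^sub>m \<Theta> l) * \<Theta> (inv x) = e l \<cdot>\<^sub>m (\<Theta> l * \<Theta> (inv x))"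
            using T.dim_rep[of l] T.dim_rep[of "inv x"] lK xi by (intro smult_mult_dim) auto
          moreover have "trace_mat (e l \<cdot>\<^sub>m (\<Theta> l * \<Theta> (inv x))) = e l * trace_mat (\<Theta> l * \<Theta> (inv x))"
            using T.dim_rep[of l] T.dim_rep[of "inv x"] lK xi by (intro trace_mat_smult_dim) auto
          ultimately show "?f (x \<otimes> inv l) * e l = ?c * trace_mat ((e l \<cdot>\<^sub>m \<Theta> l) * \<Theta> (inv x))" by simp
        qed
        also have "\<dots> = ?c * (\<Sum>l\<in>L. trace_mat ((e l \<cdot>\<^sub>m \<Theta> l) * \<Theta> (inv x)))" by (rule sum_distrib_left[symmetric])
        also have "(\<Sum>l\<in>L. trace_mat ((e l \<cdot>\<^sub>m \<Theta> l) * \<Theta> (inv x))) = trace_mat (msum t t (\<lambda>l. (e l \<cdot>\<^sub>m \<Theta> l) * \<Theta> (inv x)) L)"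
          using T.dim_rep T.carrier_rep L_sub_K xi by (intro trace_msum[symmetric]) (auto intro!: carrier_matI)
        also have "msum t t (\<lambda>l. (e l \<cdot>\<^sub>m \<Theta> l) * \<Theta> (inv x)) L = msum t t (\<lambda>l. e l \<cdot>\<^sub>m \<Theta> l) L * \<Theta> (inv x)"
          using T.carrier_rep L_sub_K xi by (intro msum_mult[symmetric]) auto
        also have "msum t t (\<lambda>l. e l \<cdot>\<^sub>m \<Theta> l) L = T.ext e"
          by (rule T.ext_restrict[symmetric]) (use L_sub_K e_support in auto)
        also have "T.ext e * \<Theta> (inv x) = \<Theta> (inv x)" unfolding T1 using T.carrier_rep[of "inv x"] xi by (intro left_mult_one_mat) auto
        finally have fex: "(?f \<star> e) x = ?c * trace_mat (\<Theta> (inv x))" .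
        have "\<theta> (inv x) = trace_mat (\<Theta> (inv x))" using xi by (simp add: \<Theta>(2))
        then have "?f x = ?c * trace_mat (\<Theta> (inv x))" using xK by (simp add: central_idem_def)
        then show ?thesis using fex by simp
      qed
    qed
  qed
  have "trace_mat (R.ext ?f) = of_nat t * char_inner ?GK (restrict (\<lambda>g. trace_mat (\<rho> g)) K) \<theta>"
    by (rule R.trace_ext_central_idem[OF K.subgroup_axioms T.rep \<Theta>(2)])
  then have nz: "trace_mat (R.ext ?f) \<noteq> 0" using above T.dim_pos by simp
  have "R.ext e \<noteq> 0\<^sub>m D D"
  proof
    assume "R.ext e = 0\<^sub>m D D"
    then have "R.ext ?f = R.ext ?f * 0\<^sub>m D D" using R.ext_conv[of ?f e] fe by simp
    also have "\<dots> = 0\<^sub>m D D" by (rule right_mult_zero_mat[OF R.ext_carrier(1)])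
    finally show False using nz by simp
  qed
  moreover have "R.ext e = 0\<^sub>m D D \<or> R.ext e = 1\<^sub>m D"
    by (rule R.ext_central_idempotent[OF e_idem e_conj])
  ultimately show ?thesis by blast
qed

end

section \<open>Combination of the factorization with the parity\<close>

lemma (in group) FactGroup_pow:
  assumes N: "N \<lhd> G" and g: "g \<in> carrier G"
  shows "(N #> g) [^]\<^bsub>G Mod N\<^esub> (k::nat) = N #> (g [^] k)"
proof (induction k)
  case 0
  show ?case using coset_mult_one[OF normal_imp_subgroup[OF N, THEN subgroup.subset]] by (simp add: FactGroup_def)
next
  case (Suc k)
  then show ?case using normal.rcos_sum[OF N, of "g [^] k" g] g by (simp add: FactGroup_def)
qed

theorem corollary6p4:
  fixes G :: "('a, 'b) monoid_scheme" and K L H :: "'a set"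
    and \<theta> \<phi> \<chi> \<xi> :: "'a \<Rightarrow> complex" and \<psi> :: "'a set \<Rightarrow> complex"
  assumes "character_five G K L \<theta> \<phi>"
    and "coprime (Coset.order (G Mod K)) (Coset.order (G\<lparr>carrier := K\<rparr> Mod L))"
    and "odd (Coset.order (G Mod L))"
    and "subgroup H G" and "L \<subseteq> H"
    and "is_complement (G Mod L) (carrier (G\<lparr>carrier := K\<rparr> Mod L)) (carrier (G\<lparr>carrier := H\<rparr> Mod L))"
    and "magic_character_det_one G K L \<phi> H \<psi>"
    and "\<chi> \<in> Irr_above G K \<theta>"
    and "\<xi> \<in> Irr_above (G\<lparr>carrier := H\<rparr>) L \<phi>"
  shows "restrict \<chi> H = restrict (\<lambda>h. \<psi> (L #>\<^bsub>G\<^esub> h) * \<xi> h) H \<longleftrightarrow>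
         (\<exists>m::nat. odd m \<and> char_inner (G\<lparr>carrier := H\<rparr>) (restrict \<chi> H) \<xi> = of_nat m)"
proof -
  let ?GH = "G\<lparr>carrier := H\<rparr>" and ?GK = "G\<lparr>carrier := K\<rparr>"
  have five: "group G" "finite (carrier G)" "K \<lhd> G" "L \<lhd> G" "L \<subseteq> K" "\<phi> \<in> Irr (G\<lparr>carrier := L\<rparr>)"
    "invariant_character G L \<phi>" "\<theta> \<in> Irr_above ?GK L \<phi>"
    using assms(1) by (auto simp: character_five_def)
  interpret group G by fact
  obtain d \<Phi> where \<Phi>: "irreducible_representation (G\<lparr>carrier := L\<rparr>) d \<Phi>" "\<phi> = restrict (\<lambda>l. trace_mat (\<Phi> l)) L"
    using IrrE[OF five(6)] by auto
  interpret A: five_algebra G L d \<Phi> K \<phi>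
  proof (intro five_algebra.intro invariant_irrep.intro finite_group.intro five_algebra_axioms.intro
      invariant_irrep_axioms.intro finite_group_axioms.intro)
    show "trace_mat (\<Phi> (inv\<^bsub>G\<^esub> g \<otimes>\<^bsub>G\<^esub> l \<otimes>\<^bsub>G\<^esub> g)) = trace_mat (\<Phi> l)" if "g \<in> carrier G" "l \<in> L" for g l
    proof -
      have "\<phi> (inv\<^bsub>G\<^esub> g \<otimes>\<^bsub>G\<^esub> l \<otimes>\<^bsub>G\<^esub> g) = \<phi> l" using five(7) that by (simp add: invariant_character_def)
      moreover have "inv\<^bsub>G\<^esub> g \<otimes>\<^bsub>G\<^esub> l \<otimes>\<^bsub>G\<^esub> g \<in> L" using normal.inv_op_closed1[OF five(4)] that by simp
      ultimately show ?thesis using that by (simp add: \<Phi>(2))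
    qed
  qed (fact five \<Phi>)+
  obtain \<sigma> \<tau> where \<sigma>: "\<tau> \<in> S_matrix_isos G K L \<phi>" "magic_representation G K L \<phi> H \<sigma>"
    "\<psi> = restrict (\<lambda>C. trace_mat (\<tau> (\<sigma> C))) (carrier (?GH Mod L))"
    "\<forall>C\<in>carrier (?GH Mod L). Determinant.det (\<tau> (\<sigma> C)) = 1"
    using assms(7) by (auto simp: magic_character_det_one_def)
  obtain n where n: "n\<^sup>2 = Coset.order (?GK Mod L)" "\<tau> \<in> ring_iso (S_alg G K L \<phi>) (ring_mat TYPE(complex) n ())"
    "\<forall>c. \<forall>s\<in>carrier (S_alg G K L \<phi>). \<tau> (\<lambda>x. c * s x) = c \<cdot>\<^sub>m \<tau> s"
    using \<sigma>(1) by (auto simp: S_matrix_isos_def)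
  have order_Mod: "Coset.order (G' Mod N) = card (rcosets\<^bsub>G'\<^esub> N)" for G' :: "('a, 'b) monoid_scheme" and N
    by (simp add: Coset.order_def FactGroup_def)
  have gK: "group ?GK" by (rule A.K.subgroup_is_group[OF is_group])
  have gH: "group ?GH" by (rule subgroup.subgroup_is_group[OF assms(4) is_group])
  have LK: "subgroup L ?GK" by (rule subgroup_incl[OF A.L.subgroup_axioms A.K.subgroup_axioms five(5)])
  have LH: "subgroup L ?GH" by (rule subgroup_incl[OF A.L.subgroup_axioms assms(4,5)])
  have cK: "n\<^sup>2 * card L = card K" 
    using group.lagrange[OF gK LK] unfolding n(1) order_Mod by (simp add: Coset.order_def)
  define m where "m = Coset.order (G Mod K)"
  have cG: "Coset.order (G Mod L) * card L = Coset.order G" "m * card K = Coset.order G"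
    using lagrange[OF A.L.subgroup_axioms] lagrange[OF A.K.subgroup_axioms] by (simp_all add: order_Mod m_def)
  have "Coset.order (G Mod L) * card L = m * n\<^sup>2 * card L" unfolding cG(1) cG(2)[symmetric] cK[symmetric] by simp
  \<comment> \<open>The product of |G:K| and |K:L| = n^2; as it is odd, so are \<open>m\<close> and
    \<open>n\<close>.\<close>
  then have GL: "Coset.order (G Mod L) = m * n\<^sup>2" using A.card_L_pos by simp
  have odd: "odd m" "odd n" using assms(3) unfolding GL by auto
  have m0: "m > 0" using odd(1) odd_pos by blast
  have cop: "coprime m n" using assms(2) unfolding n(1)[symmetric] m_def by simp
  have compl: "carrier (?GH Mod L) \<inter> carrier (?GK Mod L) = {L}"
    "carrier (?GH Mod L) <#>\<^bsub>G Mod L\<^esub> carrier (?GK Mod L) = carrier (G Mod L)"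
    using assms(6) by (auto simp: is_complement_def FactGroup_def)
  have cosetH: "L #>\<^bsub>G\<^esub> h \<in> carrier (?GH Mod L)" if "h \<in> H" for h
    using that by (auto simp: FactGroup_def RCOSETS_def r_coset_def)
  have cosetK: "L #>\<^bsub>G\<^esub> h \<in> carrier (?GK Mod L)" if "h \<in> K" for h
    using that by (auto simp: FactGroup_def RCOSETS_def r_coset_def)
  have HG: "h \<in> carrier G" if "h \<in> H" for h using that subgroup.subset[OF assms(4)] by blast
  have generated: "\<exists>h\<in>H. \<exists>k\<in>K. g = h \<otimes>\<^bsub>G\<^esub> k" if g: "g \<in> carrier G" for g
  proof -
    have "L #>\<^bsub>G\<^esub> g \<in> carrier (G Mod L)" using g by (auto simp: FactGroup_def RCOSETS_def)
    then obtain X Y where XY': "X \<in> carrier (?GH Mod L)" "Y \<in> carrier (?GK Mod L)"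
      "L #>\<^bsub>G\<^esub> g = X \<otimes>\<^bsub>G Mod L\<^esub> Y"
      unfolding compl(2)[symmetric] set_mult_def by blast
    then have XY: "X \<in> carrier (?GH Mod L)" "Y \<in> carrier (?GK Mod L)" "L #>\<^bsub>G\<^esub> g = X <#>\<^bsub>G\<^esub> Y"
      by (simp_all add: FactGroup_def)
    obtain h where h: "h \<in> H" "X = L #>\<^bsub>G\<^esub> h" using XY(1) by (auto simp: FactGroup_def RCOSETS_def r_coset_def)
    obtain k where k: "k \<in> K" "Y = L #>\<^bsub>G\<^esub> k" using XY(2) by (auto simp: FactGroup_def RCOSETS_def r_coset_def)
    have "L #>\<^bsub>G\<^esub> g = L #>\<^bsub>G\<^esub> (h \<otimes>\<^bsub>G\<^esub> k)" using XY(3) h k A.L.rcos_sum HG by simp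
    then have "g \<in> L #>\<^bsub>G\<^esub> (h \<otimes>\<^bsub>G\<^esub> k)" using rcos_self[OF g A.L.subgroup_axioms] by simp
    then obtain l where l: "l \<in> L" "g = l \<otimes>\<^bsub>G\<^esub> (h \<otimes>\<^bsub>G\<^esub> k)" by (auto simp: r_coset_def)
    have "g = (l \<otimes>\<^bsub>G\<^esub> h) \<otimes>\<^bsub>G\<^esub> k" using l h k HG by (simp add: m_assoc)
    moreover have "l \<otimes>\<^bsub>G\<^esub> h \<in> H" using l(1) h(1) assms(5) subgroup.m_closed[OF assms(4)] by blast
    ultimately show ?thesis using k by blast
  qed
  interpret B: five_magic G L d \<Phi> K \<phi> n \<tau> H \<sigma>
  proof (intro five_magic.intro five_matrix.intro A.five_algebra_axioms five_matrix_axioms.intro five_magic_axioms.intro)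
    show "\<tau> (\<lambda>x. c * s x) = c \<cdot>\<^sub>m \<tau> s" if "s \<in> carrier (S_alg G K L \<phi>)" for c s using n(3) that by blast
  qed (fact cK n(2) assms(4,5) \<sigma>(2) generated)+
  \<comment> \<open>The order of G/K is \<open>m\<close>, so the power lies in \<open>K\<close>; it
    also lies in \<open>H\<close>, and \<open>H\<close> and \<open>K\<close> meet in
    \<open>L\<close>.\<close>
  have pow: "h [^]\<^bsub>G\<^esub> m \<in> L" if h: "h \<in> H" for h
  proof -
    have hm: "h [^]\<^bsub>G\<^esub> m \<in> H" for m :: nat
      using h by (induction m) (auto simp: subgroup.one_closed[OF assms(4)] subgroup.m_closed[OF assms(4)])
    interpret GK: group "G Mod K" by (rule A.K.factorgroup_is_group)
    have "K #>\<^bsub>G\<^esub> h \<in> carrier (G Mod K)" using HG[OF h] by (auto simp: FactGroup_def RCOSETS_def)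
    then have "(K #>\<^bsub>G\<^esub> h) [^]\<^bsub>G Mod K\<^esub> m = \<one>\<^bsub>G Mod K\<^esub>" unfolding m_def by (rule GK.pow_order_eq_1)
    then have "K #>\<^bsub>G\<^esub> (h [^]\<^bsub>G\<^esub> m) = K" unfolding FactGroup_pow[OF five(3) HG[OF h]] by (simp add: FactGroup_def)
    then have "h [^]\<^bsub>G\<^esub> m \<in> K" using rcos_self[OF HG[OF hm] A.K.subgroup_axioms, of m] by simp
    then have "L #>\<^bsub>G\<^esub> (h [^]\<^bsub>G\<^esub> m) \<in> {L}" unfolding compl(1)[symmetric] using cosetH[OF hm] cosetK by blast
    then show ?thesis using rcos_self[OF HG[OF hm] A.L.subgroup_axioms, of m] by simp
  qed
  have powH: "h [^]\<^bsub>?GH\<^esub> m \<in> L" if "h \<in> carrier ?GH" for h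
    using pow[of h] that nat_pow_consistent[of h m H] by simp
  have oddH: "odd (card (rcosets\<^bsub>?GH\<^esub> L))"
  proof -
    have "card (rcosets\<^bsub>?GH\<^esub> L) * card L = card H" using group.lagrange[OF gH LH] by (simp add: Coset.order_def)
    moreover have "card (rcosets\<^bsub>G\<^esub> H) * card H = Coset.order G" by (rule lagrange[OF assms(4)])
    ultimately have "card (rcosets\<^bsub>G\<^esub> H) * card (rcosets\<^bsub>?GH\<^esub> L) * card L = Coset.order (G Mod L) * card L"
      using cG(1) by (simp add: mult.assoc)
    then have "card (rcosets\<^bsub>G\<^esub> H) * card (rcosets\<^bsub>?GH\<^esub> L) = Coset.order (G Mod L)" using A.card_L_pos by simp
    then show ?thesis using assms(3) by (metis even_mult_iff)
  qed
  have det: "Determinant.det (B.\<Sigma> h) = 1" if "h \<in> H" for h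
    using \<sigma>(4) cosetH[OF that] by (simp add: B.\<Sigma>_def B.sg_def)
  have \<psi>: "\<psi> (L #>\<^bsub>G\<^esub> h) = trace_mat (B.\<Sigma> h)" if "h \<in> H" for h
    using cosetH[OF that] by (simp add: \<sigma>(3) B.\<Sigma>_def B.sg_def)
  have mod2: "\<exists>y\<in>int_adj (cis (2 * pi / real m)). trace_mat (B.\<Sigma> h) = 1 + 2 * y" if "h \<in> carrier ?GH" for h
    using B.trace_\<Sigma>_mod_2[OF _ m0 odd(1) cop odd(2) pow det, of h] that by simp
  \<comment> \<open>This is applied to \<xi> itself in one direction and to the factor \<xi>' of the
    restriction of \<chi> in the other.\<close>
  have parity: "\<exists>k::nat. char_inner ?GH (restrict (\<lambda>h. trace_mat (B.\<Sigma> h) * \<alpha> h) H) \<xi> = of_nat k \<and> (odd k \<longleftrightarrow> \<alpha> = \<xi>)"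
    if \<alpha>: "\<alpha> \<in> Irr ?GH" for \<alpha>
  proof -
    interpret GH: group ?GH by (rule gH)
    have fH: "finite (carrier ?GH)" using finite_subset[OF subgroup.subset[OF assms(4)] five(2)] by simp
    have \<xi>: "\<xi> \<in> Irr ?GH" using assms(9) by (simp add: Irr_above_def)
    obtain k :: nat where "char_inner ?GH (restrict (\<lambda>h. trace_mat (B.\<Sigma> h) * \<alpha> h) (carrier ?GH)) \<xi> = of_nat k"
      "odd k \<longleftrightarrow> \<alpha> = \<xi>"
      by (rule GH.char_inner_mult_parity[OF fH B.L_normal_H B.representation_\<Sigma> \<alpha> \<xi> m0 powH oddH B.\<Sigma>_L mod2])
    then show ?thesis by auto
  qed
  obtain D \<rho> where \<rho>: "irreducible_representation G D \<rho>" "\<chi> = restrict (\<lambda>g. trace_mat (\<rho> g)) (carrier G)"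
    using assms(8) by (auto simp: Irr_above_def elim: IrrE)
  have "restrict \<chi> K = restrict (\<lambda>g. trace_mat (\<rho> g)) K"
    unfolding \<rho>(2) using A.K.subset by (auto simp: restrict_def fun_eq_iff)
  then have "char_inner ?GK (restrict (\<lambda>g. trace_mat (\<rho> g)) K) \<theta> \<noteq> 0" using assms(8) by (simp add: Irr_above_def)
  then have "rep.ext G D \<rho> (central_idem G L \<phi>) = 1\<^sub>m D" by (rule A.ext_e_eq_one[OF \<rho>(1) five(8)])
  then obtain \<xi>' where \<xi>': "\<xi>' \<in> Irr ?GH" "\<forall>h\<in>H. trace_mat (\<rho> h) = trace_mat (B.\<Sigma> h) * \<xi>' h"
    using B.exists_factor_character[OF \<rho>(1)] by blast
  have \<chi>H: "restrict \<chi> H = restrict (\<lambda>h. trace_mat (B.\<Sigma> h) * \<xi>' h) H"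
    using \<xi>'(2) HG by (auto simp: \<rho>(2) restrict_def fun_eq_iff)
  have \<psi>\<xi>: "restrict (\<lambda>h. \<psi> (L #>\<^bsub>G\<^esub> h) * \<xi> h) H = restrict (\<lambda>h. trace_mat (B.\<Sigma> h) * \<xi> h) H"
    using \<psi> by (auto simp: restrict_def fun_eq_iff)
  show ?thesis
  proof
    assume e: "restrict \<chi> H = restrict (\<lambda>h. \<psi> (L #>\<^bsub>G\<^esub> h) * \<xi> h) H"
    have "\<xi> \<in> Irr ?GH" using assms(9) by (simp add: Irr_above_def)
    then show "\<exists>m::nat. odd m \<and> char_inner ?GH (restrict \<chi> H) \<xi> = of_nat m"
      using parity[of \<xi>] unfolding e \<psi>\<xi> by auto
  next
    assume "\<exists>m::nat. odd m \<and> char_inner ?GH (restrict \<chi> H) \<xi> = of_nat m"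
    then obtain j :: nat where j: "odd j" "char_inner ?GH (restrict \<chi> H) \<xi> = of_nat j" by blast
    obtain k :: nat where k: "char_inner ?GH (restrict \<chi> H) \<xi> = of_nat k" "odd k \<longleftrightarrow> \<xi>' = \<xi>"
      using parity[OF \<xi>'(1)] unfolding \<chi>H by blast
    have "j = k" using j(2) k(1) by (metis of_nat_eq_iff)
    then have "\<xi>' = \<xi>" using j(1) k(2) by simp
    then show "restrict \<chi> H = restrict (\<lambda>h. \<psi> (L #>\<^bsub>G\<^esub> h) * \<xi> h) H" unfolding \<chi>H \<psi>\<xi> by simp
  qed
qed

end
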